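(* Let $K_n$, $n\ge1$, be the $n$-th step in the construction of the Koch snowflake starting from an equilateral triangle $K_1$ with side length $3$. Then $$h(K_2)=h(K_3)=h(K_4)=\frac{6\sqrt3-2\pi}{6-\sqrt{6\pi\sqrt3-18}},$$ where $h(\cdot)$ denotes the Cheeger constant.
   Context: $K_1$ is the (open) equilateral triangle with side length $3$. For $n\ge1$, $K_{n+1}$ is the (open) polygonal region obtained by attaching, externally, $3\cdot4^{n-1}$ equilateral triangles of side length $3^{1-n}$ to the middle thirds of the sides of $K_n$. For an open bounded set $\Omega\subset\mathbb{R}^2$, the Cheeger constant is $h(\Omega)=\inf\{P(F)/|F| : F\subseteq\Omega,\ |F|>0\}$, where $|\cdot|$ is Lebesgue measure and $P(\cdot)$ is the (De Giorgi) perimeter. *)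

theory Defs
  imports "HOL-Analysis.Analysis"
begin

section \<open>De Giorgi perimeter and Cheeger constant\<close>

definition divergence :: "('a::euclidean_space \<Rightarrow> 'a) \<Rightarrow> 'a \<Rightarrow> real" where
  "divergence \<phi> x = (\<Sum>i\<in>Basis. frechet_derivative \<phi> (at x) i \<bullet> i)"

text \<open>Test fields in \<open>C\<^sub>c\<^sup>1\<close> of sup norm at most 1. In finite dimension, continuity of all directional
  derivatives is continuity of the derivative in operator norm.\<close>

definition perimeter_test_fields :: "('a::euclidean_space \<Rightarrow> 'a) set" where
  "perimeter_test_fields = {\<phi>.
     (\<forall>x. \<phi> differentiable (at x)) \<and>
     (\<forall>v. continuous_on UNIV (\<lambda>x. frechet_derivative \<phi> (at x) v)) \<and>
     compact (closure {x. \<phi> x \<noteq> 0}) \<and>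
     (\<forall>x. norm (\<phi> x) \<le> 1)}"

text \<open>The perimeter is taken in the whole space, and is \<open>\<infinity>\<close> if the supremum is unbounded.\<close>

definition perimeter :: "'a::euclidean_space set \<Rightarrow> ereal" where
  "perimeter F = (SUP \<phi>\<in>perimeter_test_fields. ereal (LINT x:F|lebesgue. divergence \<phi> x))"

definition cheeger_constant :: "'a::euclidean_space set \<Rightarrow> ereal" where
  "cheeger_constant \<Omega> =
     (INF F\<in>{F. F \<subseteq> \<Omega> \<and> F \<in> lmeasurable \<and> measure lebesgue F > 0}.
        perimeter F / ereal (measure lebesgue F))"

section \<open>Polygonal approximations of the Koch snowflake\<close>

text \<open>Sides are directed segments \<open>(p, q)\<close> that run counterclockwise around the region, so the
  exterior lies to the right of each side.\<close>

definition rotate_right :: "real^2 \<Rightarrow> real^2" where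
  "rotate_right v = vector [v $ 2, - v $ 1]"

definition first_third :: "(real^2) \<times> (real^2) \<Rightarrow> real^2" where
  "first_third s = fst s + (1/3) *\<^sub>R (snd s - fst s)"

definition second_third :: "(real^2) \<times> (real^2) \<Rightarrow> real^2" where
  "second_third s = fst s + (2/3) *\<^sub>R (snd s - fst s)"

text \<open>The triangle on the middle third has side \<open>L/3\<close>, where \<open>L\<close> is the length of the side, hence
  height \<open>(sqrt 3 / 2) * (L/3)\<close>.\<close>

definition outer_apex :: "(real^2) \<times> (real^2) \<Rightarrow> real^2" where
  "outer_apex s = midpoint (fst s) (snd s) + (sqrt 3 / 6) *\<^sub>R rotate_right (snd s - fst s)"

definition attached_triangle :: "(real^2) \<times> (real^2) \<Rightarrow> (real^2) set" where
  "attached_triangle s = convex hull {first_third s, outer_apex s, second_third s}"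

definition new_sides :: "(real^2) \<times> (real^2) \<Rightarrow> ((real^2) \<times> (real^2)) set" where
  "new_sides s = {(fst s, first_third s), (first_third s, outer_apex s),
                  (outer_apex s, second_third s), (second_third s, snd s)}"

definition counterclockwise :: "real^2 \<Rightarrow> real^2 \<Rightarrow> real^2 \<Rightarrow> bool" where
  "counterclockwise a b c \<longleftrightarrow>
     (b - a) $ 1 * (c - a) $ 2 - (b - a) $ 2 * (c - a) $ 1 > 0"

definition triangle_sides :: "real^2 \<Rightarrow> real^2 \<Rightarrow> real^2 \<Rightarrow> ((real^2) \<times> (real^2)) set" where
  "triangle_sides a b c =
     (if counterclockwise a b c then {(a, b), (b, c), (c, a)} else {(a, c), (c, b), (b, a)})"

primrec koch_sides_after :: "real^2 \<Rightarrow> real^2 \<Rightarrow> real^2 \<Rightarrow> nat \<Rightarrow> ((real^2) \<times> (real^2)) set" where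
  "koch_sides_after a b c 0 = triangle_sides a b c"
| "koch_sides_after a b c (Suc m) = (\<Union>s\<in>koch_sides_after a b c m. new_sides s)"

text \<open>The interior of the union of the closed pieces also contains the open middle thirds along
  which the triangles are glued.\<close>

primrec koch_region_after :: "real^2 \<Rightarrow> real^2 \<Rightarrow> real^2 \<Rightarrow> nat \<Rightarrow> (real^2) set" where
  "koch_region_after a b c 0 = interior (convex hull {a, b, c})"
| "koch_region_after a b c (Suc m) =
     interior (closure (koch_region_after a b c m) \<union>
               (\<Union>s\<in>koch_sides_after a b c m. attached_triangle s))"

text \<open>The steps are numbered from 1: the triangle itself is step 1. Step 0 is meaningless.\<close>

definition koch_region :: "real^2 \<Rightarrow> real^2 \<Rightarrow> real^2 \<Rightarrow> nat \<Rightarrow> (real^2) set" where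
  "koch_region a b c n = koch_region_after a b c (n - 1)"

end

(* Let h be the claimed value and E the hexagram K_2 with its six tips rounded by arcs of radius
   r = 1/h.

   Lower bound: a calibration, that is a field V with |V| <= 1 and div V = h on a set that contains
   every slightly shrunk copy of K_4, gives P(F) >= h |F| for all F inside K_4; since V is only
   Lipschitz, it is mollified to a test field after the shrinking. In each sector of 30 degrees
   between a tip direction and an adjacent reentrant corner direction, V is explicit. Near a tip it is
   the unit normal of the rounding arc translated along the tip axis, hence it is defined on the whole
   strip of half-width < r around that axis. The triangles attached at steps 3 and 4 lie in the strips
   of half-width 1/2 < r around the six tip axes, where V is still defined.

   Upper bound: V is the outward unit normal along the boundary of E, so P(E) <= h |E| follows from a
   cut-off of E that ramps down to 0 near the boundary, without computing the area or the
   length. *)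
theory Submission
  imports Defs
begin

section \<open>Locally Lipschitz functions\<close>

text \<open>The argument reaches K_4 and no further because of one number. Each side of K_2 has
  length 1, and E touches it exactly on the piece of length \<open>z_tan\<close> next to the
  reentrant corner, with 0.08 < \<open>z_tan\<close> < 0.09. The triangles erected over the side at
  steps 3 and 4 keep a distance of at least 1/9 from that corner, so they stand over the free part;
  at step 5 a triangle would stand over [1/27, 2/27], inside the contact part. The unit normal
  prescribes V near sides and tips; the difficulty is to continue it to the centre. V is made
  tangent to the six reentrant rays, so the prescribed field must have total flux zero through each
  of them. By the divergence theorem this flux condition is r P(E) = |E|, the quadratic equation for
  r. Once it holds, the flux is removed by adding the rotated gradient of a stream function. This
  leaves the divergence unchanged and is confined to the regular hexagon spanned by the reentrant
  corners. What remains is to keep the norm at most 1 there.\<close>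

definition loc_lip :: "('a::metric_space \<Rightarrow> 'b::metric_space) \<Rightarrow> 'a \<Rightarrow> bool" where
  "loc_lip f x \<longleftrightarrow> (\<exists>e>0. \<exists>L. L-lipschitz_on (ball x e) f)"

lemma loc_lipI: "e > 0 \<Longrightarrow> L-lipschitz_on (ball x e) f \<Longrightarrow> loc_lip f x"
  unfolding loc_lip_def by blast

lemma loc_lipE:
  assumes "loc_lip f x" "e0 > 0"
  obtains e L where "e > 0" "e \<le> e0" "L-lipschitz_on (ball x e) f"
proof -
  obtain e L where *: "e > 0" "L-lipschitz_on (ball x e) f"
    using assms unfolding loc_lip_def by blast
  have "L-lipschitz_on (ball x (min e e0)) f"
    by (rule lipschitz_on_subset[OF *(2)]) auto
  then show ?thesis using that[of "min e e0" L] * assms(2) by auto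
qed

lemma loc_lip_transform:
  assumes "loc_lip f x" "eventually (\<lambda>y. g y = f y) (nhds x)"
  shows "loc_lip g x"
proof -
  obtain d where d: "d > 0" "\<And>y. dist y x < d \<Longrightarrow> g y = f y"
    using assms(2) unfolding eventually_nhds_metric by blast
  obtain e L where e: "e > 0" "e \<le> d" "L-lipschitz_on (ball x e) f"
    using loc_lipE[OF assms(1) d(1)] .
  have "L-lipschitz_on (ball x e) g"
    by (rule lipschitz_on_transform[OF e(3)]) (use d e in \<open>auto simp: dist_commute\<close>)
  then show ?thesis using loc_lipI e(1) by blast
qed

lemma loc_lip_isCont: "loc_lip f x \<Longrightarrow> isCont f x"
  unfolding loc_lip_def
  by (metis centre_in_ball continuous_on_interior interior_open lipschitz_on_continuous_on open_ball)

lemma loc_lip_compose: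
  assumes f: "loc_lip f x" and g: "loc_lip g (f x)"
  shows "loc_lip (\<lambda>y. g (f y)) x"
proof -
  obtain d M where d: "d > 0" "M-lipschitz_on (ball (f x) d) g"
    using g unfolding loc_lip_def by blast
  obtain e0 where e0: "e0 > 0" "\<And>y. dist y x < e0 \<Longrightarrow> dist (f y) (f x) < d"
    using loc_lip_isCont[OF f] d(1) unfolding continuous_at_eps_delta by blast
  obtain e L where e: "e > 0" "e \<le> e0" "L-lipschitz_on (ball x e) f"
    using loc_lipE[OF f e0(1)] .
  have sub: "f ` ball x e \<subseteq> ball (f x) d"
    using e0(2) e(2) by (auto simp: dist_commute)
  have "(M * L)-lipschitz_on (ball x e) (\<lambda>y. g (f y))"
    by (rule lipschitz_on_compose2[OF e(3)])
       (rule lipschitz_on_subset[OF d(2) sub])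
  then show ?thesis using loc_lipI e(1) by blast
qed

lemma loc_lip_lipschitz: "L-lipschitz_on UNIV f \<Longrightarrow> loc_lip f x"
  by (rule loc_lipI[of 1 L]) (auto intro: lipschitz_on_subset)

lemma loc_lip_const [simp, intro]: "loc_lip (\<lambda>x. c) x"
  by (rule loc_lip_lipschitz[OF lipschitz_on_constant])

lemma loc_lip_ident [simp, intro]: "loc_lip (\<lambda>x. x) x"
  by (rule loc_lip_lipschitz[OF lipschitz_on_id])

lemma loc_lip_bounded_linear: "bounded_linear f \<Longrightarrow> loc_lip f x"
  by (metis bounded_linear.lipschitz_boundE loc_lip_lipschitz)

lemma loc_lip_common:
  assumes "loc_lip f x" "loc_lip g x"
  obtains e L M where "e > 0" "L-lipschitz_on (ball x e) f" "M-lipschitz_on (ball x e) g"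
proof -
  obtain e M where e: "e > 0" "M-lipschitz_on (ball x e) g"
    using assms(2) unfolding loc_lip_def by blast
  obtain d L where d: "d > 0" "d \<le> e" "L-lipschitz_on (ball x d) f"
    using loc_lipE[OF assms(1) e(1)] .
  have "M-lipschitz_on (ball x d) g"
    by (rule lipschitz_on_subset[OF e(2)]) (use d in auto)
  then show ?thesis using that d by blast
qed

lemma loc_lip_add [intro]:
  fixes f g :: "'a::metric_space \<Rightarrow> 'b::real_normed_vector"
  assumes "loc_lip f x" "loc_lip g x"
  shows "loc_lip (\<lambda>y. f y + g y) x"
  by (rule loc_lip_common[OF assms]) (rule loc_lipI, assumption, rule lipschitz_on_add)

lemma loc_lip_minus [intro]:
  fixes f :: "'a::metric_space \<Rightarrow> 'b::real_normed_vector"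
  assumes "loc_lip f x"
  shows "loc_lip (\<lambda>y. - f y) x"
  using assms unfolding loc_lip_def by (auto intro: lipschitz_on_minus)

lemma loc_lip_diff [intro]:
  fixes f g :: "'a::metric_space \<Rightarrow> 'b::real_normed_vector"
  assumes "loc_lip f x" "loc_lip g x"
  shows "loc_lip (\<lambda>y. f y - g y) x"
  using loc_lip_add[OF assms(1) loc_lip_minus[OF assms(2)]] by simp

lemma loc_lip_sum [intro]:
  fixes f :: "'i \<Rightarrow> 'a::metric_space \<Rightarrow> 'b::real_normed_vector"
  assumes "\<And>i. i \<in> I \<Longrightarrow> loc_lip (f i) x"
  shows "loc_lip (\<lambda>y. \<Sum>i\<in>I. f i y) x"
  using assms
  by (induction I rule: infinite_finite_induct) auto

lemma loc_lip_scaleR [intro]: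
  fixes f :: "'a::metric_space \<Rightarrow> real" and g :: "'a \<Rightarrow> 'b::real_normed_vector"
  assumes f: "loc_lip f x" and g: "loc_lip g x"
  shows "loc_lip (\<lambda>y. f y *\<^sub>R g y) x"
proof -
  obtain e L M where e: "e > 0" "L-lipschitz_on (ball x e) f" "M-lipschitz_on (ball x e) g"
    using loc_lip_common[OF f g] .
  have LM: "L \<ge> 0" "M \<ge> 0" using e lipschitz_on_nonneg by auto
  define F where "F = \<bar>f x\<bar> + L * e"
  define K where "K = norm (g x) + M * e"
  have F: "\<bar>f y\<bar> \<le> F" if "y \<in> ball x e" for y
  proof -
    have "\<bar>f y - f x\<bar> \<le> L * dist y x"
      using lipschitz_onD[OF e(2), of y x] that e(1) by (auto simp: dist_real_def)
    also have "\<dots> \<le> L * e" using that LM by (intro mult_left_mono) (auto simp: dist_commute)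
    finally show ?thesis unfolding F_def by linarith
  qed
  have K: "norm (g y) \<le> K" if "y \<in> ball x e" for y
  proof -
    have "dist (g y) (g x) \<le> M * dist y x"
      using lipschitz_onD[OF e(3), of y x] that e(1) by auto
    also have "\<dots> \<le> M * e" using that LM by (intro mult_left_mono) (auto simp: dist_commute)
    finally show ?thesis unfolding K_def dist_norm using norm_triangle_ineq2[of "g y" "g x"] by linarith
  qed
  have K0: "K \<ge> 0" "F \<ge> 0" using LM e(1) unfolding K_def F_def by auto
  have "(F * M + L * K)-lipschitz_on (ball x e) (\<lambda>y. f y *\<^sub>R g y)"
  proof (rule lipschitz_onI)
    fix y z assume yz: "y \<in> ball x e" "z \<in> ball x e"
    have "f y *\<^sub>R g y - f z *\<^sub>R g z = f y *\<^sub>R (g y - g z) + (f y - f z) *\<^sub>R g z"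
      by (simp add: algebra_simps)
    then have "dist (f y *\<^sub>R g y) (f z *\<^sub>R g z) \<le> norm (f y *\<^sub>R (g y - g z)) + norm ((f y - f z) *\<^sub>R g z)"
      unfolding dist_norm by (metis norm_triangle_ineq)
    also have "\<dots> = \<bar>f y\<bar> * dist (g y) (g z) + dist (f y) (f z) * norm (g z)"
      by (simp add: dist_norm)
    also have "\<dots> \<le> F * (M * dist y z) + (L * dist y z) * K"
      using F[OF yz(1)] K[OF yz(2)] lipschitz_onD[OF e(2) yz] lipschitz_onD[OF e(3) yz] LM K0
      by (intro add_mono mult_mono) auto
    finally show "dist (f y *\<^sub>R g y) (f z *\<^sub>R g z) \<le> (F * M + L * K) * dist y z"
      by (simp add: algebra_simps)
  qed (use LM K0 in auto)
  then show ?thesis using loc_lipI e(1) by blast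
qed

lemma loc_lip_mult [intro]:
  fixes f g :: "'a::metric_space \<Rightarrow> real"
  assumes "loc_lip f x" "loc_lip g x"
  shows "loc_lip (\<lambda>y. f y * g y) x"
  using loc_lip_scaleR[OF assms] by simp

lemma loc_lip_power [intro]:
  fixes f :: "'a::metric_space \<Rightarrow> real"
  assumes "loc_lip f x"
  shows "loc_lip (\<lambda>y. f y ^ n) x"
  by (induction n) (auto intro: assms)

lemma loc_lip_max [intro]:
  fixes f g :: "'a::metric_space \<Rightarrow> real"
  assumes "loc_lip f x" "loc_lip g x"
  shows "loc_lip (\<lambda>y. max (f y) (g y)) x"
proof -
  obtain e L M where e: "e > 0" "L-lipschitz_on (ball x e) f" "M-lipschitz_on (ball x e) g"
    using loc_lip_common[OF assms] .
  have LM: "L \<ge> 0" "M \<ge> 0" using e lipschitz_on_nonneg by auto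
  have "(L + M)-lipschitz_on (ball x e) (\<lambda>y. max (f y) (g y))"
  proof (rule lipschitz_onI)
    fix y z assume yz: "y \<in> ball x e" "z \<in> ball x e"
    show "dist (max (f y) (g y)) (max (f z) (g z)) \<le> (L + M) * dist y z"
      using lipschitz_onD[OF e(2) yz] lipschitz_onD[OF e(3) yz]
        mult_nonneg_nonneg[OF LM(1), of "dist y z"] mult_nonneg_nonneg[OF LM(2), of "dist y z"]
      by (auto simp: dist_real_def distrib_right)
  qed (use LM in auto)
  then show ?thesis using loc_lipI e(1) by blast
qed

lemma loc_lip_min [intro]:
  fixes f g :: "'a::metric_space \<Rightarrow> real"
  assumes "loc_lip f x" "loc_lip g x"
  shows "loc_lip (\<lambda>y. min (f y) (g y)) x"
proof -
  have "loc_lip (\<lambda>y. - max (- f y) (- g y)) x" by (intro loc_lip_minus loc_lip_max assms)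
  then show ?thesis by (simp add: minus_max_eq_min)
qed

text \<open>Source of the rules for \<open>inverse\<close>, \<open>sqrt\<close> and
  \<open>arcsin\<close>, whose arguments stay in the open set where these functions are C^1.\<close>

lemma loc_lip_real_deriv:
  fixes f f' :: "real \<Rightarrow> real"
  assumes S: "open S" "x \<in> S" and d: "\<And>y. y \<in> S \<Longrightarrow> (f has_real_derivative f' y) (at y)"
    and c: "continuous_on S f'"
  shows "loc_lip f x"
proof -
  obtain e where e: "e > 0" "cball x e \<subseteq> S" using S open_contains_cball by blast
  have "bounded (f' ` cball x e)"
    by (intro compact_imp_bounded compact_continuous_image continuous_on_subset[OF c] e compact_cball)
  then obtain B where B: "\<And>y. y \<in> cball x e \<Longrightarrow> \<bar>f' y\<bar> \<le> B"
    unfolding bounded_iff by (metis imageI real_norm_def)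
  have B0: "B \<ge> 0" using B[of x] e(1) by force
  have "B-lipschitz_on (ball x e) f"
  proof (rule lipschitz_onI[OF _ B0])
    fix y z assume "y \<in> ball x e" "z \<in> ball x e"
    then have "norm (f y - f z) \<le> B * norm (y - z)"
      by (intro field_differentiable_bound[of "ball x e" f f'])
        (use e(2) B d in \<open>auto intro!: has_field_derivative_at_within d\<close>)
    then show "dist (f y) (f z) \<le> B * dist y z" by (simp add: dist_norm)
  qed
  then show ?thesis using loc_lipI e(1) by blast
qed

lemma loc_lip_inverse:
  fixes f :: "'a::metric_space \<Rightarrow> real"
  assumes "loc_lip f x" "f x \<noteq> 0"
  shows "loc_lip (\<lambda>y. inverse (f y)) x"
proof (rule loc_lip_compose[OF assms(1)])
  show "loc_lip inverse (f x)"
    by (rule loc_lip_real_deriv[of "- {0}" _ _ "\<lambda>y. - (inverse y ^ Suc (Suc 0))"])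
      (use assms(2) DERIV_inverse[of _ UNIV] in \<open>auto intro!: continuous_intros\<close>)
qed

lemma loc_lip_divide [intro]:
  fixes f g :: "'a::metric_space \<Rightarrow> real"
  assumes "loc_lip f x" "loc_lip g x" "g x \<noteq> 0"
  shows "loc_lip (\<lambda>y. f y / g y) x"
  unfolding divide_inverse by (intro loc_lip_mult loc_lip_inverse assms)

lemma loc_lip_sqrt:
  fixes f :: "'a::metric_space \<Rightarrow> real"
  assumes "loc_lip f x" "f x > 0"
  shows "loc_lip (\<lambda>y. sqrt (f y)) x"
proof (rule loc_lip_compose[OF assms(1)])
  show "loc_lip sqrt (f x)"
    by (rule loc_lip_real_deriv[of "{0<..}" _ _ "\<lambda>y. inverse (sqrt y) / 2"])
      (use assms(2) in \<open>auto intro!: DERIV_real_sqrt continuous_intros\<close>)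
qed

lemma loc_lip_arcsin:
  fixes f :: "'a::metric_space \<Rightarrow> real"
  assumes "loc_lip f x" "\<bar>f x\<bar> < 1"
  shows "loc_lip (\<lambda>y. arcsin (f y)) x"
proof (rule loc_lip_compose[OF assms(1)])
  show "loc_lip arcsin (f x)"
    by (rule loc_lip_real_deriv[of "{-1<..<1}" _ _ "\<lambda>y. inverse (sqrt (1 - y\<^sup>2))"])
      (use assms(2) in \<open>auto intro!: DERIV_arcsin continuous_intros simp: power2_eq_1_iff\<close>)
qed

text \<open>Compactness gives a Lipschitz constant on the ball of radius \<open>R + 1\<close>. A
  point of norm at most \<open>R\<close> and a point outside the larger ball are at distance at
  least 1, so a bound on the values replaces the Lipschitz estimate for such pairs.\<close>

lemma loc_lip_bounded_support_lipschitz: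
  fixes g :: "'a::euclidean_space \<Rightarrow> real"
  assumes g: "\<And>x. loc_lip g x" and supp: "\<And>x. norm x > R \<Longrightarrow> g x = 0"
  obtains L where "L \<ge> 0" "L-lipschitz_on UNIV g"
proof -
  have "local_lipschitz {0::real} (cball 0 (R + 1)) (\<lambda>_. g)"
  proof (rule local_lipschitzI)
    fix t :: real and x :: 'a
    obtain e L where e: "e > 0" "L-lipschitz_on (ball x e) g"
      using g unfolding loc_lip_def by blast
    have "L-lipschitz_on (cball x (e/2) \<inter> cball 0 (R + 1)) g"
      by (rule lipschitz_on_subset[OF e(2)]) (use e(1) in auto)
    then show "\<exists>u>0. \<exists>L. \<forall>t\<in>cball t u \<inter> {0}. L-lipschitz_on (cball x u \<inter> cball 0 (R + 1)) g"
      using e(1) half_gt_zero by blast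
  qed
  then have "\<exists>L. L-lipschitz_on (cball 0 (R + 1)) g"
    by (rule local_lipschitz_compact_implies_lipschitz[OF _ compact_cball compact_sing]) auto
  then obtain L where L: "L-lipschitz_on (cball 0 (R + 1)) g" by blast
  have L0: "L \<ge> 0" using L lipschitz_on_nonneg by blast
  have "continuous_on (cball 0 R) g" using g loc_lip_isCont continuous_at_imp_continuous_on by blast
  then have "bounded (g ` cball 0 R)" by (intro compact_imp_bounded compact_continuous_image compact_cball)
  then obtain B where B: "\<And>x. x \<in> cball 0 R \<Longrightarrow> \<bar>g x\<bar> \<le> B"
    unfolding bounded_iff by (metis imageI real_norm_def)
  define K where "K = max L \<bar>B\<bar>"
  have *: "\<bar>g x - g y\<bar> \<le> K * dist x y" if "norm x \<le> R" for x y
  proof (cases "norm y \<le> R + 1")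
    case True
    have "\<bar>g x - g y\<bar> \<le> L * dist x y"
      using lipschitz_onD[OF L, of x y] that True by (auto simp: dist_real_def)
    also have "\<dots> \<le> K * dist x y" unfolding K_def by (intro mult_right_mono) auto
    finally show ?thesis .
  next
    case False
    then have "1 \<le> dist x y" using that norm_triangle_ineq2[of y x] by (simp add: dist_norm norm_minus_commute)
    then have "K * 1 \<le> K * dist x y" using L0 unfolding K_def by (intro mult_left_mono) auto
    then show ?thesis using B[of x] that supp[of y] False unfolding K_def by auto
  qed
  have "K-lipschitz_on UNIV g"
  proof (rule lipschitz_onI)
    fix x y
    show "dist (g x) (g y) \<le> K * dist x y"
    proof (cases "norm x \<le> R \<or> norm y \<le> R")
      case True
      then show ?thesis using *[of x y] *[of y x] by (auto simp: dist_real_def dist_commute abs_minus_commute)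
    next
      case False
      then show ?thesis using supp[of x] supp[of y] L0 unfolding K_def by auto
    qed
  qed (use L0 K_def in auto)
  then show ?thesis using that[of K] L0 K_def by auto
qed

section \<open>Mollification\<close>

lemma integrable_lebesgue_continuous_bounded_support:
  fixes g :: "'a::euclidean_space \<Rightarrow> real"
  assumes g: "continuous_on UNIV g" and supp: "\<And>x. norm x > R \<Longrightarrow> g x = 0"
  shows "integrable lebesgue g"
proof -
  have "bounded (g ` cball 0 R)"
    by (intro compact_imp_bounded compact_continuous_image continuous_on_subset[OF g]) auto
  then obtain B where B: "\<And>x. x \<in> cball 0 R \<Longrightarrow> \<bar>g x\<bar> \<le> B"
    unfolding bounded_iff by (metis imageI real_norm_def)
  have m: "g \<in> borel_measurable borel" using g by (rule borel_measurable_continuous_onI)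
  have "integrable lborel (\<lambda>x::'a. B * indicator (cball 0 R) x)"
    using emeasure_bounded_finite[of "cball (0::'a) R"]
    by (intro integrable_mult_right integrable_real_indicator) (auto simp: infinity_ennreal_def)
  then have "integrable lborel g"
    by (rule Bochner_Integration.integrable_bound)
      (use m B supp in \<open>auto simp: indicator_def not_le intro!: AE_I2 intro: order_trans[OF _ abs_ge_self]\<close>)
  then show ?thesis using m by (subst integrable_completion) auto
qed

lemma lebesgue_integral_translate:
  fixes g :: "'a::euclidean_space \<Rightarrow> real"
  assumes m: "g \<in> borel_measurable borel"
  shows "(LINT x|lebesgue. g (x + v)) = (LINT x|lebesgue. g x)"
proof -
  have "(LINT x|lborel. g x) = (LINT x|distr lborel borel ((+) v). g x)"
    by (simp add: lborel_distr_plus)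
  also have "\<dots> = (LINT x|lborel. g (v + x))"
    by (rule integral_distr) (use m in auto)
  finally show ?thesis using m by (simp add: integral_completion add.commute)
qed

text \<open>Integration by parts along arbitrary directions without Fubini: the difference quotients of a
  compactly supported function integrate to zero by translation invariance.\<close>

lemma integral_sum_directional_derivatives:
  fixes g :: "'i \<Rightarrow> 'a::euclidean_space \<Rightarrow> real" and v :: "'i \<Rightarrow> 'a"
  assumes fin: "finite I" and g: "\<And>i x. i \<in> I \<Longrightarrow> loc_lip (g i) x"
    and supp: "\<And>i x. i \<in> I \<Longrightarrow> norm x > R \<Longrightarrow> g i x = 0"
    and l: "l \<in> borel_measurable lebesgue"
    and ae: "AE x in lebesgue. \<exists>D. (\<forall>i\<in>I. ((\<lambda>t. g i (x + t *\<^sub>R v i)) has_real_derivative D i) (at 0))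
      \<and> l x = (\<Sum>i\<in>I. D i)"
  shows "integrable lebesgue l" "(LINT x|lebesgue. l x) = 0"
proof -
  have "\<exists>L. \<forall>i\<in>I. L i \<ge> 0 \<and> (L i)-lipschitz_on UNIV (g i)"
    by (rule bchoice) (metis g supp loc_lip_bounded_support_lipschitz)
  then obtain L where L: "\<And>i. i \<in> I \<Longrightarrow> L i \<ge> 0" "\<And>i. i \<in> I \<Longrightarrow> (L i)-lipschitz_on UNIV (g i)"
    by blast
  \<comment> \<open>Steps of length at most 1 keep all difference quotients supported in one ball of
    radius \<open>R'\<close>, which yields the dominating function \<open>w\<close>.\<close>
  define a where "a n = inverse (real (Suc n))" for n
  have a0: "a n > 0" and a1: "a n \<le> 1" for n unfolding a_def by (auto simp: field_simps)
  define s where "s n x = (\<Sum>i\<in>I. (g i (x + a n *\<^sub>R v i) - g i x) / a n)" for n x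
  define K where "K = (\<Sum>i\<in>I. L i * norm (v i))"
  define R' where "R' = R + (\<Sum>i\<in>I. norm (v i))"
  define w where "w = (\<lambda>x::'a. K * indicator (cball 0 R') x)"
  have cont: "continuous_on UNIV (g i)" if "i \<in> I" for i
    using g[OF that] loc_lip_isCont continuous_at_imp_continuous_on by blast
  have cont': "continuous_on UNIV (\<lambda>x. g i (x + b))" if "i \<in> I" for i and b :: 'a
    by (intro continuous_on_compose2[OF cont[OF that]] continuous_intros) auto
  have m: "g i \<in> borel_measurable borel" if "i \<in> I" for i
    using cont[OF that] by (rule borel_measurable_continuous_onI)
  have int0: "integrable lebesgue (g i)" if "i \<in> I" for i
    by (rule integrable_lebesgue_continuous_bounded_support[OF cont[OF that]]) (use supp that in auto)
  have int: "integrable lebesgue (\<lambda>x. g i (x + b))" if "i \<in> I" for i and b :: 'a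
  proof (rule integrable_lebesgue_continuous_bounded_support[OF cont'[OF that], of "R + norm b"])
    fix x :: 'a assume "norm x > R + norm b"
    then have "norm (x + b) > R" using norm_triangle_ineq4[of "x + b" b] by simp
    then show "g i (x + b) = 0" using supp that by auto
  qed
  have "(LINT x|lebesgue. s n x) = 0" for n
  proof -
    have "(LINT x|lebesgue. s n x) = (\<Sum>i\<in>I. ((LINT x|lebesgue. g i (x + a n *\<^sub>R v i)) - (LINT x|lebesgue. g i x)) / a n)"
      unfolding s_def using int int0 by (simp add: Bochner_Integration.integral_sum)
    also have "\<dots> = 0" by (intro sum.neutral ballI) (simp add: lebesgue_integral_translate[OF m])
    finally show ?thesis .
  qed
  moreover have sm: "s n \<in> borel_measurable lebesgue" for n
    unfolding s_def using int int0 borel_measurable_integrable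
    by (intro borel_measurable_sum borel_measurable_divide borel_measurable_diff) auto
  moreover have w: "integrable lebesgue w" unfolding w_def
    using emeasure_bounded_finite[of "cball (0::'a) R'"]
    by (intro integrable_mult_right integrable_real_indicator) (auto simp: infinity_ennreal_def)
  moreover have lim: "AE x in lebesgue. (\<lambda>n. s n x) \<longlonglongrightarrow> l x"
    using ae
  proof eventually_elim
    case (elim x)
    then obtain D where D: "\<And>i. i \<in> I \<Longrightarrow> ((\<lambda>t. g i (x + t *\<^sub>R v i)) has_real_derivative D i) (at 0)"
      "l x = (\<Sum>i\<in>I. D i)" by blast
    have al: "filterlim a (at 0) sequentially"
      unfolding a_def filterlim_at using LIMSEQ_inverse_real_of_nat by (auto intro!: always_eventually)
    have "(\<lambda>n. (g i (x + a n *\<^sub>R v i) - g i x) / a n) \<longlonglongrightarrow> D i" if "i \<in> I" for i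
      using filterlim_compose[OF DERIV_D[OF D(1)[OF that]] al] by simp
    then show ?case unfolding s_def D(2) by (intro tendsto_sum) auto
  qed
  moreover have bd: "norm (s n x) \<le> w x" for n x
  proof (cases "norm x \<le> R'")
    case True
    have "norm (s n x) \<le> (\<Sum>i\<in>I. L i * norm (v i))" unfolding s_def
    proof (rule sum_norm_le)
      fix i assume i: "i \<in> I"
      have "\<bar>g i (x + a n *\<^sub>R v i) - g i x\<bar> \<le> L i * dist (x + a n *\<^sub>R v i) x"
        using lipschitz_onD[OF L(2)[OF i], of "x + a n *\<^sub>R v i" x] by (auto simp: dist_real_def)
      also have "\<dots> = L i * norm (v i) * a n" using a0[of n] by (simp add: dist_norm)
      finally show "norm ((g i (x + a n *\<^sub>R v i) - g i x) / a n) \<le> L i * norm (v i)"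
        using a0[of n] by (simp add: divide_simps)
    qed
    then show ?thesis using True unfolding w_def K_def by simp
  next
    case False
    have "(g i (x + a n *\<^sub>R v i) - g i x) / a n = 0" if i: "i \<in> I" for i
    proof -
      have "norm (a n *\<^sub>R v i) \<le> norm (v i)" using a0[of n] a1[of n] by (simp add: mult_left_le_one_le)
      moreover have "norm (v i) \<le> (\<Sum>i\<in>I. norm (v i))" using fin i by (intro member_le_sum) auto
      ultimately have "norm x > R + norm (a n *\<^sub>R v i)" using False unfolding R'_def by linarith
      then have "norm (x + a n *\<^sub>R v i) > R"
        using norm_triangle_ineq4[of "x + a n *\<^sub>R v i" "a n *\<^sub>R v i"] by simp
      moreover have "norm x > R" using False unfolding R'_def by (smt (verit) norm_ge_zero sum_nonneg)
      ultimately show ?thesis using supp[OF i] by simp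
    qed
    then have "s n x = 0" unfolding s_def by (intro sum.neutral) auto
    then show ?thesis using False unfolding w_def by simp
  qed
  ultimately show "integrable lebesgue l" "(LINT x|lebesgue. l x) = 0"
    using integral_dominated_convergence[OF l sm w lim] integrable_dominated_convergence[OF l sm w lim]
    by (auto simp: LIMSEQ_const_iff)
qed

lemma integrable_lebesgue_bounded_support:
  fixes g :: "'a::euclidean_space \<Rightarrow> 'b::euclidean_space"
  assumes m: "g \<in> borel_measurable borel" and B: "\<And>x. norm (g x) \<le> B"
    and supp: "\<And>x. norm x > R \<Longrightarrow> g x = 0"
  shows "integrable lebesgue g"
proof -
  have "integrable lborel (\<lambda>x::'a. B * indicator (cball 0 R) x)"
    using emeasure_bounded_finite[of "cball (0::'a) R"]
    by (intro integrable_mult_right integrable_real_indicator) (auto simp: infinity_ennreal_def)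
  then have "integrable lborel g"
    by (rule Bochner_Integration.integrable_bound)
      (use m B supp in \<open>auto simp: indicator_def not_le intro!: AE_I2 intro: order_trans[OF _ abs_ge_self]\<close>)
  then show ?thesis using m by (subst integrable_completion) auto
qed

section \<open>A C^1 mollifying kernel and mollified fields\<close>

definition bump :: "real \<Rightarrow> 'a::euclidean_space \<Rightarrow> real" where
  "bump e z = (max 0 (e\<^sup>2 - (norm z)\<^sup>2))\<^sup>2"

definition bump_grad :: "real \<Rightarrow> 'a::euclidean_space \<Rightarrow> 'a" where
  "bump_grad e z = (- 4 * max 0 (e\<^sup>2 - (norm z)\<^sup>2)) *\<^sub>R z"

lemma bump_nonneg: "0 \<le> bump e z"
  by (simp add: bump_def)

lemma bump_uminus: "bump e (- z) = bump e z"
  by (simp add: bump_def)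

lemma bump_zero: "e > 0 \<Longrightarrow> norm z \<ge> e \<Longrightarrow> bump e z = 0"
  by (simp add: bump_def max_def power_mono)

lemma bump_grad_zero: "e > 0 \<Longrightarrow> norm z \<ge> e \<Longrightarrow> bump_grad e z = 0"
  by (simp add: bump_grad_def max_def power_mono)

lemma bump_le: "bump e z \<le> e ^ 4"
proof -
  have "bump e z \<le> (e\<^sup>2)\<^sup>2" unfolding bump_def by (intro power_mono) auto
  then show ?thesis by simp
qed

lemma norm_bump_grad_le:
  assumes "e > 0"
  shows "norm (bump_grad e z) \<le> 4 * e\<^sup>2 * e"
proof (cases "norm z \<ge> e")
  case False
  have "norm (bump_grad e z) = 4 * max 0 (e\<^sup>2 - (norm z)\<^sup>2) * norm z"
    by (simp add: bump_grad_def abs_mult)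
  also have "\<dots> \<le> 4 * e\<^sup>2 * e" using False assms by (intro mult_mono) auto
  finally show ?thesis .
qed (use assms in \<open>simp add: bump_grad_zero\<close>)

lemma continuous_on_bump [continuous_intros]: "continuous_on S f \<Longrightarrow> continuous_on S (\<lambda>x. bump e (f x))"
  unfolding bump_def by (intro continuous_intros)

lemma continuous_on_bump_grad [continuous_intros]:
  "continuous_on S f \<Longrightarrow> continuous_on S (\<lambda>x. bump_grad e (f x))"
  unfolding bump_grad_def by (intro continuous_intros)

lemma bump_measurable [measurable]: "bump e \<in> borel_measurable borel"
  by (intro borel_measurable_continuous_onI continuous_intros)

lemma bump_grad_measurable [measurable]: "bump_grad e \<in> borel_measurable borel"
  by (intro borel_measurable_continuous_onI continuous_intros)

text \<open>The square of a positive part has a first order remainder of at most the square of the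
  increment. The resulting bound is quadratic in \<open>v\<close> and uniform for bounded
  \<open>z\<close>, so integrating it against a bounded field gives the differentiability of the
  convolution directly.\<close>

lemma bump_remainder:
  assumes "norm v \<le> 1" "norm z \<le> Z"
  shows "\<bar>bump e (z + v) - bump e z - bump_grad e z \<bullet> v\<bar> \<le> ((2 * Z + 1)\<^sup>2 + 2 * e\<^sup>2) * (norm v)\<^sup>2"
proof -
  define \<alpha> where "\<alpha> = e\<^sup>2 - (norm z)\<^sup>2"
  define \<beta> where "\<beta> = e\<^sup>2 - (norm (z + v))\<^sup>2"
  have ab: "\<beta> - \<alpha> = - (2 * (z \<bullet> v) + (norm v)\<^sup>2)"
    unfolding \<alpha>_def \<beta>_def power2_norm_eq_inner by (simp add: inner_add_left inner_add_right inner_commute)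
  have 1: "\<bar>(max 0 \<beta>)\<^sup>2 - (max 0 \<alpha>)\<^sup>2 - 2 * max 0 \<alpha> * (\<beta> - \<alpha>)\<bar> \<le> (\<beta> - \<alpha>)\<^sup>2"
  proof (cases "\<alpha> \<ge> 0"; cases "\<beta> \<ge> 0")
    assume "\<alpha> \<ge> 0" "\<beta> \<ge> 0"
    moreover have "\<beta>\<^sup>2 - \<alpha>\<^sup>2 - 2 * \<alpha> * (\<beta> - \<alpha>) = (\<beta> - \<alpha>)\<^sup>2"
      by (simp add: power2_eq_square algebra_simps)
    ultimately show ?thesis by simp
  next
    assume a: "\<alpha> \<ge> 0" "\<not> \<beta> \<ge> 0"
    have "(\<beta> - \<alpha>)\<^sup>2 - (- \<alpha>\<^sup>2 - 2 * \<alpha> * (\<beta> - \<alpha>)) = \<beta>\<^sup>2"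
      by (simp add: power2_eq_square algebra_simps)
    moreover have "- \<alpha>\<^sup>2 - 2 * \<alpha> * (\<beta> - \<alpha>) = \<alpha> * (\<alpha> - 2 * \<beta>)"
      by (simp add: power2_eq_square algebra_simps)
    moreover have "\<alpha> * (\<alpha> - 2 * \<beta>) \<ge> 0" using a by auto
    ultimately show ?thesis using a by (simp add: max_def) (smt (verit) zero_le_power2)
  next
    assume a: "\<not> \<alpha> \<ge> 0" "\<beta> \<ge> 0"
    then have "\<beta>\<^sup>2 \<le> (\<beta> - \<alpha>)\<^sup>2" by (intro power_mono) auto
    then show ?thesis using a by (simp add: max_def)
  qed (simp add: max_def)
  have "bump_grad e z \<bullet> v = 2 * max 0 \<alpha> * (\<beta> - \<alpha>) + 2 * max 0 \<alpha> * (norm v)\<^sup>2"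
    unfolding bump_grad_def ab \<alpha>_def[symmetric] by (simp add: algebra_simps)
  then have "\<bar>bump e (z + v) - bump e z - bump_grad e z \<bullet> v\<bar> \<le> (\<beta> - \<alpha>)\<^sup>2 + 2 * max 0 \<alpha> * (norm v)\<^sup>2"
    using 1 unfolding bump_def \<alpha>_def[symmetric] \<beta>_def[symmetric]
    by (smt (verit) mult_nonneg_nonneg zero_le_power2)
  also have "\<dots> \<le> ((2 * Z + 1) * norm v)\<^sup>2 + 2 * e\<^sup>2 * (norm v)\<^sup>2"
  proof (intro add_mono mult_right_mono mult_left_mono)
    have "\<bar>z \<bullet> v\<bar> \<le> Z * norm v"
      by (rule order_trans[OF Cauchy_Schwarz_ineq2]) (use assms in \<open>auto intro: mult_right_mono\<close>)
    moreover have "(norm v)\<^sup>2 \<le> 1 * norm v" unfolding power2_eq_square using assms by (intro mult_right_mono) auto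
    ultimately have "\<bar>\<beta> - \<alpha>\<bar> \<le> (2 * Z + 1) * norm v"
      unfolding ab distrib_right using zero_le_power2[of "norm v"] by linarith
    then show "(\<beta> - \<alpha>)\<^sup>2 \<le> ((2 * Z + 1) * norm v)\<^sup>2" by (simp add: abs_le_square_iff[symmetric])
  qed (auto simp: \<alpha>_def)
  finally show ?thesis by (simp only: power_mult_distrib distrib_right[of _ _ "(norm v)\<^sup>2"])
qed

lemma integrable_bump: "e > 0 \<Longrightarrow> integrable lebesgue (\<lambda>y::'a::euclidean_space. bump e y)"
  by (rule integrable_lebesgue_bounded_support[where B = "e ^ 4" and R = e])
    (auto simp: bump_nonneg bump_le bump_zero)

lemma integral_bump_shift:
  "(LINT y|lebesgue. bump e ((x::'a) - y)) = (LINT y|lebesgue. bump e (y::'a::euclidean_space))"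
proof -
  have "(LINT y|lebesgue. bump e (x - y)) = (LINT y|lebesgue. bump e (y + (- x)))"
    using bump_uminus[of e "x - _"] by (intro Bochner_Integration.integral_cong) auto
  also have "\<dots> = (LINT y|lebesgue. bump e (y::'a))"
    by (rule lebesgue_integral_translate[OF bump_measurable])
  finally show ?thesis .
qed

lemma integral_bump_pos:
  assumes "e > 0"
  shows "0 < (LINT y|lebesgue. bump e (y::'a::euclidean_space))"
proof -
  have "bump e y > 0" if "y \<in> ball 0 e" for y :: 'a
    using that assms by (simp add: bump_def power_strict_mono)
  moreover have "emeasure lebesgue (ball (0::'a) e) > 0"
    using assms content_ball_pos[of e "0::'a"] by (simp add: emeasure_eq_measure2 zero_less_measure_iff[symmetric])
  moreover have "ball (0::'a) e \<in> null_sets lebesgue" if "AE y::'a in lebesgue. bump e y = 0"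
  proof -
    have "AE y::'a in lebesgue. y \<notin> ball 0 e"
      using that by eventually_elim (metis calculation(1) less_irrefl)
    then show ?thesis by (intro AE_iff_null_sets[THEN iffD2]) auto
  qed
  ultimately have "\<not> (AE y::'a in lebesgue. bump e y = 0)" by (auto simp: null_sets_def)
  then show ?thesis
    using integrable_bump[OF assms] integral_nonneg_eq_0_iff_AE[of lebesgue "bump e :: 'a \<Rightarrow> real"]
    by (smt (verit, best) AE_I2 bump_nonneg integral_nonneg_AE)
qed

text \<open>A bounded field whose weak divergence is \<open>H\<close> near \<open>F\<close> need not be regular: its mollification
  is an admissible test field with divergence \<open>H\<close> on \<open>F\<close>.\<close>

lemma perimeter_ge_weak_divergence:
  fixes V :: "'a::euclidean_space \<Rightarrow> 'a"
  assumes V[measurable]: "V \<in> borel_measurable borel" and V1: "\<And>x. norm (V x) \<le> 1"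
    and supp: "\<And>x. norm x > R \<Longrightarrow> V x = 0" and e: "e > 0" and F: "F \<in> lmeasurable"
    and weak: "\<And>x. x \<in> F \<Longrightarrow>
      (LINT y|lebesgue. bump_grad e (x - y) \<bullet> V y) = H * (LINT y|lebesgue. bump e (y::'a))"
  shows "ereal (H * measure lebesgue F) \<le> perimeter F"
proof -
  define c where "c = (LINT y|lebesgue. bump e (y::'a))"
  have c: "c > 0" unfolding c_def using e by (rule integral_bump_pos)
  \<comment> \<open>Dividing by the mass \<open>c\<close> of the kernel makes this a weighted mean
    of \<open>V\<close>, so the norm stays at most 1.\<close>
  define \<Phi> where "\<Phi> x = (LINT y|lebesgue. bump e (x - y) *\<^sub>R V y) /\<^sub>R c" for x
  define D where "D x v = (LINT y|lebesgue. (bump_grad e (x - y) \<bullet> v) *\<^sub>R V y) /\<^sub>R c" for x v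
  have int1: "integrable lebesgue (\<lambda>y. bump e (x - y) *\<^sub>R V y)" for x
  proof (rule integrable_lebesgue_bounded_support[where B = "e ^ 4" and R = R])
    fix y
    show "norm (bump e (x - y) *\<^sub>R V y) \<le> e ^ 4"
      using V1[of y] bump_le[of e "x - y"] bump_nonneg[of e "x - y"]
      by (simp add: mult_le_cancel_left1) (smt (verit) mult_left_le)
  qed (use supp in auto)
  have gb: "\<bar>bump_grad e z \<bullet> v\<bar> \<le> 4 * e\<^sup>2 * e * norm v" for z v :: 'a
    using Cauchy_Schwarz_ineq2[of "bump_grad e z" v] norm_bump_grad_le[OF e, of z]
    by (smt (verit) mult_right_mono norm_ge_zero)
  have gb': "norm ((bump_grad e (x - y) \<bullet> v) *\<^sub>R V y) \<le> 4 * e\<^sup>2 * e * norm v" for x y v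
  proof -
    have "norm ((bump_grad e (x - y) \<bullet> v) *\<^sub>R V y) \<le> \<bar>bump_grad e (x - y) \<bullet> v\<bar> * 1"
      unfolding norm_scaleR using V1[of y] by (intro mult_left_mono) auto
    then show ?thesis using gb[of "x - y" v] by linarith
  qed
  have int2: "integrable lebesgue (\<lambda>y. (bump_grad e (x - y) \<bullet> v) *\<^sub>R V y)" for x v
    by (rule integrable_lebesgue_bounded_support[where B = "4 * e\<^sup>2 * e * norm v" and R = R])
      (use supp gb' in auto)
  have lin: "linear (D x)" for x
    unfolding D_def
    by (rule linearI) (use int2 in \<open>simp_all add: inner_add_right scaleR_add_left scaleR_add_right
      scaleR_left_commute scaleR_scaleR[symmetric] del: scaleR_scaleR\<close>)
  have deriv: "(\<Phi> has_derivative D x) (at x)" for x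
  proof -
    define Z where "Z = norm x + R"
    define K where "K = ((2 * Z + 1)\<^sup>2 + 2 * e\<^sup>2) * measure lebesgue (cball (0::'a) R) / c"
    have K0: "K \<ge> 0" unfolding K_def using c by auto
    have bound: "norm (\<Phi> (x + v) - \<Phi> x - D x v) \<le> K * (norm v)\<^sup>2" if v: "norm v \<le> 1" for v
    proof -
      let ?g = "\<lambda>y. (bump e (x + v - y) - bump e (x - y) - bump_grad e (x - y) \<bullet> v) *\<^sub>R V y"
      let ?w = "\<lambda>y::'a. ((2 * Z + 1)\<^sup>2 + 2 * e\<^sup>2) * (norm v)\<^sup>2 * indicator (cball 0 R) y :: real"
      have "\<Phi> (x + v) - \<Phi> x - D x v = (LINT y|lebesgue. ?g y) /\<^sub>R c"
        unfolding \<Phi>_def D_def using int1 int2 by (simp add: scaleR_diff_left scaleR_diff_right)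
      moreover have "norm (LINT y|lebesgue. ?g y) \<le> (LINT y|lebesgue. ?w y)"
      proof (rule Bochner_Integration.integral_norm_bound_integral)
        show "integrable lebesgue ?g"
          using int1 int2 by (simp add: scaleR_diff_left)
        show "integrable lebesgue ?w"
          by (intro integrable_mult_right integrable_real_indicator)
            (use emeasure_bounded_finite[of "cball (0::'a) R"] in \<open>auto simp: infinity_ennreal_def\<close>)
        fix y
        show "norm (?g y) \<le> ?w y"
        proof (cases "norm y \<le> R")
          case True
          have "norm (x - y) \<le> Z" using True norm_triangle_ineq4[of x y] unfolding Z_def by linarith
          then have "\<bar>bump e (x + v - y) - bump e (x - y) - bump_grad e (x - y) \<bullet> v\<bar>
              \<le> ((2 * Z + 1)\<^sup>2 + 2 * e\<^sup>2) * (norm v)\<^sup>2"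
            using bump_remainder[OF v, of "x - y" Z e] by (simp add: algebra_simps)
          then have "norm (?g y) \<le> ((2 * Z + 1)\<^sup>2 + 2 * e\<^sup>2) * (norm v)\<^sup>2 * 1"
            unfolding norm_scaleR using V1[of y] by (intro mult_mono) auto
          then show ?thesis using True by simp
        qed (use supp in auto)
      qed
      moreover have "(LINT y|lebesgue. ?w y) = K * (norm v)\<^sup>2 * c" unfolding K_def using c by simp
      ultimately have "norm (LINT y|lebesgue. ?g y) \<le> K * (norm v)\<^sup>2 * c"
        and "norm (\<Phi> (x + v) - \<Phi> x - D x v) = norm (LINT y|lebesgue. ?g y) / c"
        using c by (simp_all only: norm_scaleR) (simp_all add: divide_inverse mult.commute)
      then show ?thesis using c by (simp add: divide_le_eq)
    qed
    show ?thesis unfolding has_derivative_at_alt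
    proof (intro conjI allI impI)
      show "bounded_linear (D x)" using lin linear_conv_bounded_linear by blast
      fix \<epsilon> :: real assume \<epsilon>: "\<epsilon> > 0"
      define d where "d = min 1 (\<epsilon> / (K + 1))"
      have "d > 0" unfolding d_def using \<epsilon> K0 by auto
      moreover have "norm (\<Phi> y - \<Phi> x - D x (y - x)) \<le> \<epsilon> * norm (y - x)" if "norm (y - x) < d" for y
      proof -
        have "norm (\<Phi> y - \<Phi> x - D x (y - x)) \<le> K * norm (y - x) * norm (y - x)"
          using bound[of "y - x"] that unfolding d_def power2_eq_square by (simp add: mult.assoc)
        also have "K * norm (y - x) \<le> (K + 1) * (\<epsilon> / (K + 1))"
          using that K0 unfolding d_def by (intro mult_mono) auto
        also have "\<dots> = \<epsilon>" using K0 by simp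
        finally show ?thesis by (simp add: mult_right_mono)
      qed
      ultimately show "\<exists>d>0. \<forall>y. norm (y - x) < d \<longrightarrow> norm (\<Phi> y - \<Phi> x - D x (y - x)) \<le> \<epsilon> * norm (y - x)"
        by blast
    qed
  qed
  have fd: "frechet_derivative \<Phi> (at x) = D x" for x
    using frechet_derivative_at[OF deriv[of x]] by simp
  have contD: "continuous_on UNIV (\<lambda>x. D x v)" for v
  proof (rule continuous_at_imp_continuous_on, intro ballI)
    fix x :: 'a
    have "(\<lambda>n. (LINT y|lebesgue. (bump_grad e (u n - y) \<bullet> v) *\<^sub>R V y))
        \<longlonglongrightarrow> (LINT y|lebesgue. (bump_grad e (x - y) \<bullet> v) *\<^sub>R V y)" if u: "u \<longlonglongrightarrow> x" for u
    proof (rule integral_dominated_convergence)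
      show "integrable lebesgue (\<lambda>y::'a. 4 * e\<^sup>2 * e * norm v * indicator (cball 0 R) y :: real)"
        by (intro integrable_mult_right integrable_real_indicator)
          (use emeasure_bounded_finite[of "cball (0::'a) R"] in \<open>auto simp: infinity_ennreal_def\<close>)
      show "AE y in lebesgue. norm ((bump_grad e (u n - y) \<bullet> v) *\<^sub>R V y)
          \<le> 4 * e\<^sup>2 * e * norm v * indicator (cball 0 R) y" for n
        using gb' supp by (intro AE_I2) (auto simp: indicator_def not_le)
      have "continuous_on UNIV (bump_grad e :: 'a \<Rightarrow> 'a)" by (intro continuous_intros)
      then have "isCont (bump_grad e) (x - y)" for y :: 'a by (simp add: continuous_on_eq_continuous_at)
      then have "(\<lambda>n. bump_grad e (u n - y)) \<longlonglongrightarrow> bump_grad e (x - y)" for y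
        by (rule isCont_tendsto_compose) (intro tendsto_intros u)
      then show "AE y in lebesgue. (\<lambda>n. (bump_grad e (u n - y) \<bullet> v) *\<^sub>R V y)
          \<longlonglongrightarrow> (bump_grad e (x - y) \<bullet> v) *\<^sub>R V y"
        by (intro AE_I2 tendsto_intros)
    qed (use int2 borel_measurable_integrable in auto)
    then show "isCont (\<lambda>x. D x v) x"
      unfolding D_def continuous_at_sequentially comp_def by (intro allI impI tendsto_intros) blast
  qed
  have supp\<Phi>: "\<Phi> x = 0" if "norm x > R + e" for x
  proof -
    have "bump e (x - y) *\<^sub>R V y = 0" for y
    proof (cases "norm y > R")
      case False
      then have "norm (x - y) \<ge> e" using that norm_triangle_ineq2[of x y] by linarith
      then show ?thesis using bump_zero[OF e] by auto
    qed (use supp in auto)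
    then show ?thesis unfolding \<Phi>_def by (simp only: Bochner_Integration.integral_zero scaleR_zero_right)
  qed
  have "norm (\<Phi> x) \<le> 1" for x
  proof -
    have intb: "integrable lebesgue (\<lambda>y. bump e (x - y))"
      by (rule integrable_lebesgue_bounded_support[where B = "e ^ 4" and R = "norm x + e"])
        (use e bump_zero[OF e] in \<open>auto simp: bump_nonneg bump_le\<close>, smt (verit) bump_zero e norm_triangle_ineq2 norm_minus_commute)
    have "norm (LINT y|lebesgue. bump e (x - y) *\<^sub>R V y) \<le> (LINT y|lebesgue. bump e (x - y))"
    proof (rule Bochner_Integration.integral_norm_bound_integral[OF int1 intb])
      fix y show "norm (bump e (x - y) *\<^sub>R V y) \<le> bump e (x - y)"
        using V1[of y] bump_nonneg[of e "x - y"] by (simp add: mult_left_le)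
    qed
    then show ?thesis unfolding \<Phi>_def using c by (simp add: integral_bump_shift c_def[symmetric] divide_simps)
  qed
  moreover have "compact (closure {x. \<Phi> x \<noteq> 0})"
  proof -
    have "{x. \<Phi> x \<noteq> 0} \<subseteq> cball 0 (R + e)" using supp\<Phi> by (auto simp: not_less[symmetric])
    then show ?thesis by (meson bounded_cball bounded_closure bounded_subset closed_closure compact_eq_bounded_closed)
  qed
  ultimately have test: "\<Phi> \<in> perimeter_test_fields"
    unfolding perimeter_test_fields_def using deriv contD fd by (auto simp: differentiable_def)
  have div: "divergence \<Phi> x = H" if x: "x \<in> F" for x
  proof -
    have "D x i \<bullet> i = (LINT y|lebesgue. (bump_grad e (x - y) \<bullet> i) * (V y \<bullet> i)) / c" for i
      unfolding D_def by (simp add: integral_inner_left[OF int2, symmetric] divide_inverse)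
    then have "divergence \<Phi> x = (\<Sum>i\<in>Basis. (LINT y|lebesgue. (bump_grad e (x - y) \<bullet> i) * (V y \<bullet> i))) / c"
      unfolding divergence_def fd by (simp add: sum_divide_distrib)
    also have "(\<Sum>i\<in>Basis. (LINT y|lebesgue. (bump_grad e (x - y) \<bullet> i) * (V y \<bullet> i)))
        = (LINT y|lebesgue. (\<Sum>i\<in>Basis. (bump_grad e (x - y) \<bullet> i) * (V y \<bullet> i)))"
    proof (rule Bochner_Integration.integral_sum[symmetric])
      fix i :: 'a
      have "integrable lebesgue (\<lambda>y. ((bump_grad e (x - y) \<bullet> i) *\<^sub>R V y) \<bullet> i)"
        using int2 by (intro integrable_inner_left) auto
      then show "integrable lebesgue (\<lambda>y. (bump_grad e (x - y) \<bullet> i) * (V y \<bullet> i))" by simp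
    qed
    also have "\<dots> = H * c" using weak[OF x] unfolding c_def by (simp add: euclidean_inner[symmetric])
    finally show ?thesis using c by simp
  qed
  have "(LINT x:F|lebesgue. divergence \<Phi> x) = (LINT x:F|lebesgue. H)"
    using F div by (intro set_lebesgue_integral_cong) (auto simp: fmeasurableD)
  also have "\<dots> = H * measure lebesgue F"
    using F by (simp add: set_lebesgue_integral_def fmeasurableD)
  finally have "(LINT x:F|lebesgue. divergence \<Phi> x) = H * measure lebesgue F" .
  then show ?thesis unfolding perimeter_def using test by (metis SUP_upper)
qed

section \<open>The calibrating field in one cone\<close>

definition cheeger_radius :: real where
  "cheeger_radius = (6 - sqrt (6 * pi * sqrt 3 - 18)) / (6 * sqrt 3 - 2 * pi)"

definition cheeger_curv :: real where
  "cheeger_curv = (6 * sqrt 3 - 2 * pi) / (6 - sqrt (6 * pi * sqrt 3 - 18))"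

abbreviation "r0 \<equiv> cheeger_radius"
abbreviation "h0 \<equiv> cheeger_curv"

lemma sqrt3_bounds: "1732/1000 < sqrt 3" "sqrt 3 < 17321/10000"
  by (rule real_less_rsqrt, simp add: power2_eq_square)
    (rule real_less_lsqrt, simp_all add: power2_eq_square)

lemma sqrt3_sq: "sqrt 3 * sqrt 3 = (3::real)" "(sqrt 3)\<^sup>2 = (3::real)"
  by simp_all

lemma pi_bounds: "314/100 < pi" "pi < 3142/1000"
proof -
  have "(314/100::real) < 3.141592653588" by simp
  then show "314/100 < pi" using pi_approx(1) by (rule less_le_trans)
  have "(3.1415926535899::real) < 3142/1000" by simp
  with pi_approx(2) show "pi < 3142/1000" by (rule le_less_trans)
qed

text \<open>The quadratic is r P = A for the hexagram with its six tips rounded at radius r, where P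
  = 12 - 12 sqrt 3 r + 4 pi r and A = 3 sqrt 3 - (6 sqrt 3 - 2 pi) r^2; \<open>r0\<close> is its
  smaller root. The lower decimal bound puts \<open>r0\<close> above the half-width 1/2 of the
  strips.\<close>

lemma radius_bounds: "527/1000 < r0" "r0 < 531/1000"
  and radius_quadratic: "(6 * sqrt 3 - 2 * pi) * r0\<^sup>2 - 12 * r0 + 3 * sqrt 3 = 0"
  and curv_radius: "h0 = 1 / r0" "h0 * r0 = 1" "r0 * h0 = 1"
proof -
  define A where "A = 6 * sqrt 3 - 2 * pi"
  define d where "d = 6 * pi * sqrt 3 - 18"
  have dA: "d = 36 - 3 * sqrt 3 * A" unfolding d_def A_def by (simp add: algebra_simps)
  have "4092/1000 < A" unfolding A_def using sqrt3_bounds pi_bounds by linarith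
  moreover have "A < 4113/1000" unfolding A_def using sqrt3_bounds pi_bounds by linarith
  ultimately have A: "4092/1000 < A" "A < 4113/1000" by auto
  have "18 < 6 * (pi * sqrt 3)"
    using mult_strict_mono[of 3 pi "1732/1000" "sqrt 3"] sqrt3_bounds pi_bounds by linarith
  then have d0: "d > 0" unfolding d_def by simp
  have 1: "sqrt d < 6 - 527/1000 * A"
  proof (rule real_less_lsqrt)
    have "(6 - 527/1000 * A)\<^sup>2 - d = A * ((527/1000)\<^sup>2 * A - 12 * (527/1000) + 3 * sqrt 3)"
      unfolding dA by (simp add: power2_eq_square algebra_simps)
    moreover have "(527/1000)\<^sup>2 * A - 12 * (527/1000) + 3 * sqrt 3 > 0"
      using A sqrt3_bounds by (simp add: power2_eq_square)
    ultimately show "d < (6 - 527/1000 * A)\<^sup>2" using A mult_pos_pos[of A "(527/1000)\<^sup>2 * A - 12 * (527/1000) + 3 * sqrt 3"] by linarith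
  qed (use A in auto)
  have 2: "6 - 531/1000 * A < sqrt d"
  proof (rule real_less_rsqrt)
    have "d - (6 - 531/1000 * A)\<^sup>2 = A * (12 * (531/1000) - 3 * sqrt 3 - (531/1000)\<^sup>2 * A)"
      unfolding dA by (simp add: power2_eq_square algebra_simps)
    moreover have "12 * (531/1000) - 3 * sqrt 3 - (531/1000)\<^sup>2 * A > 0"
      using A sqrt3_bounds by (simp add: power2_eq_square)
    ultimately show "(6 - 531/1000 * A)\<^sup>2 < d" using A mult_pos_pos[of A "12 * (531/1000) - 3 * sqrt 3 - (531/1000)\<^sup>2 * A"] by linarith
  qed
  have r: "r0 = (6 - sqrt d) / A" and h: "h0 = A / (6 - sqrt d)"
    unfolding cheeger_radius_def cheeger_curv_def A_def d_def by auto
  have Ap: "A > 0" using A by linarith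
  have "527/1000 < r0" unfolding r pos_less_divide_eq[OF Ap] using 1 by linarith
  moreover have "r0 < 531/1000" unfolding r pos_divide_less_eq[OF Ap] using 2 by linarith
  ultimately show b: "527/1000 < r0" "r0 < 531/1000" .
  have Ar: "A * r0 = 6 - sqrt d" using Ap unfolding r by simp
  have "A * (A * r0\<^sup>2 - 12 * r0 + 3 * sqrt 3) = (A * r0)\<^sup>2 - 12 * (A * r0) + 3 * sqrt 3 * A"
    by (simp only: power2_eq_square ring_distribs mult.assoc mult.commute mult.left_commute)
  also have "\<dots> = d - 36 + 3 * sqrt 3 * A" unfolding Ar using d0 by (simp add: power2_diff)
  also have "\<dots> = 0" unfolding dA by simp
  finally show "(6 * sqrt 3 - 2 * pi) * r0\<^sup>2 - 12 * r0 + 3 * sqrt 3 = 0"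
    using Ap by (simp add: A_def)
  show h0r: "h0 = 1 / r0" unfolding r h by simp
  have "r0 \<noteq> 0" using b by linarith
  then show "h0 * r0 = 1" unfolding h0r by simp
  then show "r0 * h0 = 1" by (simp add: mult.commute)
qed

lemma curv_bounds: "1883/1000 < h0" "h0 < 1898/1000"
  using radius_bounds unfolding curv_radius(1) by (auto simp: field_simps)

text \<open>Let \<open>p\<close> and \<open>q\<close> be the skew coordinates along the tip and the
  reentrant direction. The rounding arc touches the side p = sqrt 3 (1 - q) at
  (\<open>p_tan\<close>, \<open>q_tan\<close>), and \<open>z_tan\<close> is the distance from there
  to the reentrant corner. In terms of z = 1 - q, \<open>z_mid\<close> is the kink of
  \<open>bend 0\<close>, where sqrt 3 z = 10 sqrt 3 (z_tan - z).\<close>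

definition q_tan :: real where "q_tan = sqrt 3 * r0"
definition z_tan :: real where "z_tan = 1 - q_tan"
definition p_tan :: real where "p_tan = sqrt 3 * z_tan"
definition z_mid :: real where "z_mid = 10 / 11 * z_tan"

lemma q_tan_bounds: "91/100 < q_tan" "q_tan < 92/100"
proof -
  have "1732/1000 * (527/1000) < sqrt 3 * r0"
    by (intro mult_strict_mono) (use sqrt3_bounds radius_bounds in auto)
  moreover have "sqrt 3 * r0 < 17321/10000 * (531/1000)"
    by (intro mult_strict_mono) (use sqrt3_bounds radius_bounds in auto)
  ultimately show "91/100 < q_tan" "q_tan < 92/100" unfolding q_tan_def by auto
qed

lemma z_tan_bounds: "8/100 < z_tan" "z_tan < 9/100"
  using q_tan_bounds unfolding z_tan_def by auto

lemma z_mid_bounds: "0 < z_mid" "z_mid < z_tan"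
  using z_tan_bounds unfolding z_mid_def by auto

lemma p_tan_bounds: "0 < p_tan" "p_tan < 16/100"
proof -
  have "sqrt 3 * z_tan < 17321/10000 * (9/100)"
    by (intro mult_strict_mono) (use sqrt3_bounds z_tan_bounds in auto)
  then show "0 < p_tan" "p_tan < 16/100" using z_tan_bounds unfolding p_tan_def by auto
qed

lemma curv_q_tan: "h0 * q_tan = sqrt 3"
  unfolding q_tan_def using curv_radius(2) by (simp add: mult.left_commute)

lemma curv_z_tan: "h0 * z_tan = h0 - sqrt 3"
  unfolding z_tan_def using curv_q_tan by (simp add: algebra_simps)

text \<open>The pair \<open>(arc_u q, h0 * q)\<close> gives the components, along two directions at an angle of 30 degrees, of
  the unit normal of the arc that rounds a tip; \<open>arc_prim\<close> is a primitive of \<open>arc_u\<close>.\<close>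

definition arc_u :: "real \<Rightarrow> real" where
  "arc_u q = sqrt (1 - (h0 * q / 2)\<^sup>2) - sqrt 3 * (h0 * q / 2)"

definition arc_prim :: "real \<Rightarrow> real" where
  "arc_prim q = r0 * (arcsin (h0 * q / 2) + h0 * q / 2 * sqrt (1 - (h0 * q / 2)\<^sup>2) - sqrt 3 * (h0 * q / 2)\<^sup>2)"

text \<open>A primitive in \<open>z\<close> of \<open>bend 0 (1 - z)\<close>, whose kinks are at
  \<open>z_mid\<close> and \<open>z_tan\<close>.\<close>

definition flat_prim :: "real \<Rightarrow> real" where
  "flat_prim z = sqrt 3 / 2 * (z\<^sup>2 - 11 * (max 0 (z - z_mid))\<^sup>2 + 10 * (max 0 (z - z_tan))\<^sup>2)"

text \<open>A primitive of \<open>outer_u 0\<close> that vanishes at 0; that it also vanishes at 1 is the Cheeger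
  equation. The slopes 10 and 11/10 here and below are not canonical: they leave the field Lipschitz and
  its norm at most 1.\<close>

definition defect :: "real \<Rightarrow> real" where
  "defect q = arc_prim (min q q_tan) - max 0 (q - q_tan)
    + 11/10 * h0 * (flat_prim (1 - q) - flat_prim z_tan)"

text \<open>The first branch is twice the distance to the side, so that the field is the unit normal
  on the side; the second one vanishes at \<open>q_tan\<close>, where the arc zone begins. The
  factors 11/10 and sqrt 3 / 30 in \<open>outer_u\<close> and \<open>outer_w\<close> are fitted to
  the slope 10: the divergence is 11/10 h0 - h0/10 on the first branch and 0 + h0 on the
  second.\<close>

definition bend :: "real \<Rightarrow> real \<Rightarrow> real" where
  "bend p q = max 0 (min (sqrt 3 * (1 - q) - p) (10 * sqrt 3 * (q - q_tan)))"

text \<open>For \<open>p\<close> at most \<open>p_tan\<close> the arc normal is frozen beyond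
  \<open>q_tan\<close> at the normal of the side. For \<open>p\<close> above 17/100 the value is
  \<open>q\<close> itself, and the arc normal continues across the strip. The transition in between
  happens outside \<open>field_dom\<close>.\<close>

definition clip :: "real \<Rightarrow> real \<Rightarrow> real" where
  "clip p q = min q (q_tan + 10 * max 0 (p - p_tan))"

text \<open>It is 1 on the reentrant ray and 0 outside the regular hexagon spanned by the six
  reentrant corners, whose side in this cone is p = sqrt 3 / 2 (1 - q).\<close>

definition fade :: "real \<Rightarrow> real \<Rightarrow> real" where
  "fade p q = max 0 (1 - 2 * sqrt 3 / 3 * p / (1 - q))"

definition outer_u :: "real \<Rightarrow> real \<Rightarrow> real" where
  "outer_u p q = arc_u (clip p q) - 11/10 * h0 * bend p q"

definition outer_w :: "real \<Rightarrow> real \<Rightarrow> real" where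
  "outer_w p q = h0 * clip p q + h0 * sqrt 3 / 30 * bend p q"

text \<open>Near the reentrant direction the outer field is corrected so that its tip component vanishes
  on \<open>p = 0\<close>, so that the fields of adjacent cones fit together.\<close>

definition field_u :: "real \<Rightarrow> real \<Rightarrow> real" where
  "field_u p q = outer_u p q - outer_u 0 q * (fade p q)\<^sup>2
     + 2 * (defect q / (1 - q)) * fade p q * (1 - fade p q)"

definition field_w :: "real \<Rightarrow> real \<Rightarrow> real" where
  "field_w p q = outer_w p q - 4 * sqrt 3 / 3 * (defect q / (1 - q)) * fade p q"

text \<open>The hexagram together with the strips around the tip axes, kept away from the reentrant
  corners. The value 17/100 is large enough for \<open>clip p q = q\<close> and below sqrt 3 / 9,
  where the triangles of later steps begin.\<close>

definition field_dom :: "real \<Rightarrow> real \<Rightarrow> bool" where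
  "field_dom p q \<longleftrightarrow> 0 \<le> p \<and> 0 \<le> q \<and> q < 1 \<and> (p < sqrt 3 * (1 - q) \<or> 17/100 < p \<and> p < 2)"

section \<open>Regularity and divergence of the field in one cone\<close>

lemma half_curv_less_1: "0 \<le> q \<Longrightarrow> q < 1 \<Longrightarrow> 0 \<le> h0 * q / 2 \<and> h0 * q / 2 < 1"
  using curv_bounds mult_strict_mono[of h0 2 q 1] by auto

lemma one_minus_sq_pos: "\<bar>s\<bar> < 1 \<Longrightarrow> 0 < 1 - s\<^sup>2" for s :: real
  by (simp add: abs_square_less_1)

lemma arc_prim_0: "arc_prim 0 = 0"
  by (simp add: arc_prim_def)

text \<open>This is the Cheeger equation of the rounded hexagram.\<close>

lemma arc_prim_q_tan: "arc_prim q_tan = z_tan + h0 * sqrt 3 / 2 * z_tan\<^sup>2"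
proof -
  have 1: "arcsin (sqrt 3 / 2) = pi / 3"
    by (rule arcsin_unique) (auto simp: sin_60 intro: order_trans[of _ 0])
  have 2: "sqrt (1 - (sqrt 3 / 2)\<^sup>2) = 1 / 2"
    by (simp add: power_divide real_sqrt_divide)
  have L: "arc_prim q_tan = r0 * (pi / 3 - sqrt 3 / 2)"
    unfolding arc_prim_def curv_q_tan 1 2 by (simp add: power_divide algebra_simps)
  have R: "z_tan + h0 * sqrt 3 / 2 * z_tan\<^sup>2 = z_tan + sqrt 3 / 2 * z_tan * (h0 - sqrt 3)"
    unfolding curv_z_tan[symmetric] by (simp add: power2_eq_square)
  have "r0 * (z_tan + sqrt 3 / 2 * z_tan * (h0 - sqrt 3)) = r0 * z_tan + sqrt 3 / 2 * z_tan * (h0 * r0 - sqrt 3 * r0)"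
    by (simp add: algebra_simps)
  also have "\<dots> = r0 * z_tan + sqrt 3 / 2 * z_tan * (1 - sqrt 3 * r0)"
    unfolding curv_radius(2) ..
  also have "\<dots> = r0 * (1 - sqrt 3 * r0) + sqrt 3 / 2 * (1 - sqrt 3 * r0)\<^sup>2"
    unfolding z_tan_def q_tan_def by (simp add: power2_eq_square)
  also have "\<dots> = r0 - sqrt 3 * r0\<^sup>2 + sqrt 3 / 2 - 3 * r0 + 3 * sqrt 3 / 2 * r0\<^sup>2"
    by (simp add: power2_eq_square algebra_simps)
  \<comment> \<open>The one place where the quadratic equation for \<open>r0\<close> enters.\<close>
  also have "\<dots> = r0\<^sup>2 * (pi / 3 - sqrt 3 / 2)"
    using radius_quadratic by (simp add: algebra_simps)
  also have "\<dots> = r0 * arc_prim q_tan" unfolding L by (simp add: power2_eq_square)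
  finally show ?thesis using R radius_bounds by simp
qed

text \<open>The coefficients 1, -11 and 10 cancel the quadratic term, and the choice of
  \<open>z_mid\<close> cancels the linear one.\<close>

lemma flat_prim_large: "z_tan \<le> z \<Longrightarrow> flat_prim z = flat_prim z_tan"
  using z_tan_bounds unfolding flat_prim_def z_mid_def
  by (simp add: power2_eq_square field_simps)

lemma flat_prim_z_tan: "11/10 * h0 * flat_prim z_tan = h0 * sqrt 3 / 2 * z_tan\<^sup>2"
  using z_tan_bounds unfolding flat_prim_def z_mid_def
  by (simp add: power2_eq_square field_simps)

lemma defect_arc: "q \<le> q_tan \<Longrightarrow> defect q = arc_prim q"
  unfolding defect_def using flat_prim_large[of "1 - q"] by (simp add: z_tan_def)

lemma defect_flat: "q_tan \<le> q \<Longrightarrow>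
    defect q = (1 - q) + 11/10 * h0 * (sqrt 3 / 2) * ((1 - q)\<^sup>2 - 11 * (max 0 (1 - q - z_mid))\<^sup>2)"
proof -
  assume q: "q_tan \<le> q"
  have 1: "flat_prim (1 - q) = sqrt 3 / 2 * ((1 - q)\<^sup>2 - 11 * (max 0 (1 - q - z_mid))\<^sup>2)"
    using q unfolding flat_prim_def z_tan_def by (simp add: max_def)
  have 2: "11/10 * h0 * (flat_prim (1 - q) - flat_prim z_tan)
      = 11/10 * h0 * flat_prim (1 - q) - h0 * sqrt 3 / 2 * z_tan\<^sup>2"
    using flat_prim_z_tan by (simp add: right_diff_distrib)
  have 3: "min q q_tan = q_tan" "max 0 (q - q_tan) = z_tan - (1 - q)"
    using q unfolding z_tan_def by auto
  show ?thesis unfolding defect_def unfolding 2 3 arc_prim_q_tan unfolding 1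
    by (simp only: mult.assoc)
qed

lemma clip_0: "0 \<le> p \<Longrightarrow> clip p 0 = 0"
  unfolding clip_def using q_tan_bounds by simp

text \<open>On the reentrant ray \<open>fade\<close> is 1, so the correction cancels
  \<open>outer_u 0 q\<close>. Together with \<open>field_w_0\<close> this lets adjacent cones share
  one formula.\<close>

lemma field_u_0: "q < 1 \<Longrightarrow> field_u 0 q = 0"
  by (simp add: field_u_def fade_def)

lemma bend_below: "q \<le> q_tan \<Longrightarrow> bend p q = 0"
  unfolding bend_def by (intro max_absorb1 min.coboundedI2) (simp add: mult_nonneg_nonpos)

lemma field_w_0: "0 \<le> p \<Longrightarrow> field_w p 0 = 0"
  using q_tan_bounds defect_arc[of 0] arc_prim_0
  by (simp add: field_w_def outer_w_def clip_0 bend_below)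

lemma clip_le: "clip p q \<le> q"
  by (simp add: clip_def)

lemma clip_nonneg: "0 \<le> q \<Longrightarrow> 0 \<le> clip p q"
  using q_tan_bounds by (simp add: clip_def)

lemma loc_lip_arc_u:
  assumes "loc_lip f x" "0 \<le> f x" "f x < 1"
  shows "loc_lip (\<lambda>y. arc_u (f y)) x"
  unfolding arc_u_def
  by (intro loc_lip_diff loc_lip_mult loc_lip_divide loc_lip_power loc_lip_sqrt loc_lip_const assms one_minus_sq_pos)
    (use half_curv_less_1[OF assms(2,3)] in auto)

lemma loc_lip_arc_prim:
  assumes "loc_lip f x" "0 \<le> f x" "f x < 1"
  shows "loc_lip (\<lambda>y. arc_prim (f y)) x"
  unfolding arc_prim_def
  by (intro loc_lip_add loc_lip_diff loc_lip_mult loc_lip_divide loc_lip_power loc_lip_sqrt loc_lip_const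
      loc_lip_arcsin assms one_minus_sq_pos)
    (use half_curv_less_1[OF assms(2,3)] in auto)

lemma loc_lip_flat_prim:
  "loc_lip f x \<Longrightarrow> loc_lip (\<lambda>y. flat_prim (f y)) x"
  unfolding flat_prim_def
  by (intro loc_lip_add loc_lip_diff loc_lip_mult loc_lip_power loc_lip_max loc_lip_const)

lemma loc_lip_defect:
  assumes "loc_lip f x" "0 \<le> f x" "f x < 1"
  shows "loc_lip (\<lambda>y. defect (f y)) x"
  unfolding defect_def
  by (intro loc_lip_add loc_lip_diff loc_lip_mult loc_lip_max loc_lip_min loc_lip_arc_prim loc_lip_flat_prim
      loc_lip_const assms)
    (use assms(2,3) q_tan_bounds in auto)

lemma loc_lip_clip: "loc_lip f x \<Longrightarrow> loc_lip g x \<Longrightarrow> loc_lip (\<lambda>y. clip (f y) (g y)) x"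
  unfolding clip_def
  by (intro loc_lip_min loc_lip_add loc_lip_mult loc_lip_max loc_lip_diff loc_lip_const)

lemma loc_lip_bend: "loc_lip f x \<Longrightarrow> loc_lip g x \<Longrightarrow> loc_lip (\<lambda>y. bend (f y) (g y)) x"
  unfolding bend_def
  by (intro loc_lip_min loc_lip_mult loc_lip_max loc_lip_diff loc_lip_const)

lemma loc_lip_fade: "loc_lip f x \<Longrightarrow> loc_lip g x \<Longrightarrow> g x < 1 \<Longrightarrow> loc_lip (\<lambda>y. fade (f y) (g y)) x"
  unfolding fade_def
  by (intro loc_lip_divide loc_lip_mult loc_lip_max loc_lip_diff loc_lip_const) auto

lemma loc_lip_outer_u:
  assumes "loc_lip f x" "loc_lip g x" "0 \<le> g x" "g x < 1"
  shows "loc_lip (\<lambda>y. outer_u (f y) (g y)) x"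
  unfolding outer_u_def
  by (intro loc_lip_mult loc_lip_diff loc_lip_const loc_lip_arc_u loc_lip_clip loc_lip_bend assms
      clip_nonneg le_less_trans[OF clip_le])

lemma loc_lip_field_u:
  assumes "loc_lip f x" "loc_lip g x" "0 \<le> g x" "g x < 1"
  shows "loc_lip (\<lambda>y. field_u (f y) (g y)) x"
  unfolding field_u_def
  by (intro loc_lip_add loc_lip_diff loc_lip_mult loc_lip_divide loc_lip_power loc_lip_const
      loc_lip_outer_u loc_lip_fade loc_lip_defect assms) (use assms(4) in auto)

lemma loc_lip_field_w:
  assumes "loc_lip f x" "loc_lip g x" "0 \<le> g x" "g x < 1"
  shows "loc_lip (\<lambda>y. field_w (f y) (g y)) x"
  unfolding field_w_def outer_w_def
  by (intro loc_lip_add loc_lip_diff loc_lip_mult loc_lip_divide loc_lip_power loc_lip_const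
      loc_lip_clip loc_lip_bend loc_lip_fade loc_lip_defect assms) (use assms(4) in auto)

lemma DERIV_arc_prim:
  assumes "0 \<le> q" "q < 1"
  shows "(arc_prim has_real_derivative arc_u q) (at q)"
proof -
  define S where "S = h0 * q / 2"
  have S: "0 \<le> S" "S < 1" using half_curv_less_1[OF assms] unfolding S_def by auto
  then have p: "0 < 1 - S\<^sup>2" using one_minus_sq_pos[of S] by simp
  define c where "c = sqrt (1 - S\<^sup>2)"
  have c: "c > 0" "c * c = 1 - S\<^sup>2" using p unfolding c_def by auto
  have "(arc_prim has_real_derivative
     r0 * (h0 / 2 / c + (h0 / 2 * c + S * ((- (2 * S * (h0 / 2))) / (2 * c))) - sqrt 3 * (2 * S * (h0 / 2)))) (at q)"
    unfolding arc_prim_def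
    apply (rule derivative_eq_intros refl | (use S p in \<open>simp add: S_def[symmetric]; fail\<close>))+
    unfolding S_def[symmetric] c_def[symmetric]
    using c S by (simp add: field_simps)
  moreover have "r0 * (h0 / 2 / c + (h0 / 2 * c + S * ((- (2 * S * (h0 / 2))) / (2 * c))) - sqrt 3 * (2 * S * (h0 / 2)))
      = (r0 * h0) * ((1 / c + (c - S\<^sup>2 / c)) / 2 - sqrt 3 * S)"
    by (simp add: power2_eq_square algebra_simps diff_divide_distrib add_divide_distrib)
  moreover have "1 / c - S\<^sup>2 / c = c" using c by (simp add: field_simps)
  then have "1 / c + (c - S\<^sup>2 / c) = 2 * c" by simp
  ultimately show ?thesis using curv_radius(3) unfolding arc_u_def S_def[symmetric] c_def[symmetric] by simp
qed

lemma outer_u_0_arc: "q \<le> q_tan \<Longrightarrow> outer_u 0 q = arc_u q"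
  using p_tan_bounds by (simp add: outer_u_def bend_below clip_def)

lemma arc_u_q_tan: "arc_u q_tan = -1"
proof -
  have "sqrt (1 - (sqrt 3 / 2)\<^sup>2) = 1 / 2" by (simp add: power_divide real_sqrt_divide)
  then show ?thesis unfolding arc_u_def curv_q_tan by simp
qed

lemma bend_0_flat:
  assumes "q_tan \<le> q" "q \<le> 1"
  shows "bend 0 q = sqrt 3 * ((1 - q) - 11 * max 0 (1 - q - z_mid))"
proof -
  have "10 * sqrt 3 * (q - q_tan) = sqrt 3 * ((1 - q) - 11 * (1 - q - z_mid))"
    unfolding z_mid_def z_tan_def by (simp add: field_simps)
  moreover have "0 \<le> sqrt 3 * (1 - q)" "0 \<le> 10 * sqrt 3 * (q - q_tan)" using assms by auto
  ultimately show ?thesis unfolding bend_def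
    by (cases "1 - q \<le> z_mid") (auto simp: max_def min_def)
qed

lemma outer_u_0_flat: "q_tan \<le> q \<Longrightarrow> outer_u 0 q = - 1 - 11/10 * h0 * bend 0 q"
  using p_tan_bounds by (simp add: outer_u_def clip_def min_def arc_u_q_tan)

lemma DERIV_defect:
  assumes q: "0 \<le> q" "q < 1" and n: "q \<noteq> q_tan" "1 - q \<noteq> z_mid"
  shows "(defect has_real_derivative outer_u 0 q) (at q)"
proof (cases "q < q_tan")
  case True
  have "(arc_prim has_real_derivative outer_u 0 q) (at q)"
    using DERIV_arc_prim[OF q] True by (simp add: outer_u_0_arc)
  then show ?thesis
    by (rule has_field_derivative_transform_within_open[of _ _ _ "{..<q_tan}"])
      (use True in \<open>auto simp: defect_arc\<close>)
next
  case False
  then have qt: "q > q_tan" using n by simp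
  let ?c = "11/10 * h0 * (sqrt 3 / 2)"
  show ?thesis
  proof (cases "1 - q < z_mid")
    case True
    have "((\<lambda>q. (1 - q) + ?c * (1 - q)\<^sup>2) has_real_derivative outer_u 0 q) (at q)"
      unfolding outer_u_0_flat[OF less_imp_le[OF qt]] bend_0_flat[OF less_imp_le[OF qt] less_imp_le[OF q(2)]]
      using True by (auto intro!: derivative_eq_intros simp: field_simps)
    then show ?thesis
      by (rule has_field_derivative_transform_within_open[of _ _ _ "{max q_tan (1 - z_mid)<..}"])
        (use True qt in \<open>auto simp: defect_flat\<close>)
  next
    case False
    then have zq: "1 - q > z_mid" using n by simp
    have "((\<lambda>q. (1 - q) + ?c * ((1 - q)\<^sup>2 - 11 * (1 - q - z_mid)\<^sup>2)) has_real_derivative outer_u 0 q) (at q)"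
      unfolding outer_u_0_flat[OF less_imp_le[OF qt]] bend_0_flat[OF less_imp_le[OF qt] less_imp_le[OF q(2)]]
      using zq by (auto intro!: derivative_eq_intros simp: field_simps)
    then show ?thesis
      by (rule has_field_derivative_transform_within_open[of _ _ _ "{q_tan<..<1 - z_mid}"])
        (use zq qt in \<open>auto simp: defect_flat\<close>)
  qed
qed

text \<open>The correction terms added to the outer field are divergence free, because they come from the
  stream function \<open>defect q * (fade p q)\<^sup>2\<close>.\<close>

lemma field_divergence_aux:
  assumes u: "((\<lambda>t. outer_u (p + t) q) has_real_derivative a1) (at 0)"
    and w: "((\<lambda>t. outer_w p (q + t)) has_real_derivative a2) (at 0)"
    and d: "(defect has_real_derivative outer_u 0 q) (at q)"
    and q: "q < 1" and n: "2 * sqrt 3 / 3 * p \<noteq> 1 - q"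
  shows "\<exists>b1 b2. ((\<lambda>t. field_u (p + t) q) has_real_derivative b1) (at 0)
    \<and> ((\<lambda>t. field_w p (q + t)) has_real_derivative b2) (at 0) \<and> b1 + b2 = a1 + a2"
proof (cases "2 * sqrt 3 / 3 * p < 1 - q")
  case False
  then have g: "2 * sqrt 3 / 3 * p > 1 - q" using n by simp
  have "((\<lambda>t. field_u (p + t) q) has_real_derivative a1) (at 0)"
  proof (rule has_field_derivative_transform_within_open[OF u])
    show "open {t. 2 * sqrt 3 / 3 * (p + t) > 1 - q}" by (intro open_Collect_less continuous_intros)
    show "outer_u (p + t) q = field_u (p + t) q" if "t \<in> {t. 2 * sqrt 3 / 3 * (p + t) > 1 - q}" for t
    proof -
      have "fade (p + t) q = 0" using that q by (simp add: fade_def max_def field_simps)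
      then show ?thesis by (simp add: field_u_def)
    qed
  qed (use g in auto)
  moreover have "((\<lambda>t. field_w p (q + t)) has_real_derivative a2) (at 0)"
  proof (rule has_field_derivative_transform_within_open[OF w])
    show "open {t. 2 * sqrt 3 / 3 * p > 1 - (q + t) \<and> q + t < 1}"
      by (intro open_Collect_conj open_Collect_less continuous_intros)
    show "outer_w p (q + t) = field_w p (q + t)" if "t \<in> {t. 2 * sqrt 3 / 3 * p > 1 - (q + t) \<and> q + t < 1}" for t
    proof -
      have "fade p (q + t) = 0" using that q by (simp add: fade_def max_def field_simps)
      then show ?thesis by (simp add: field_w_def)
    qed
  qed (use g q in auto)
  ultimately show ?thesis by blast
next
  case True
  define A where "A = outer_u 0 q"
  define D where "D = defect q"
  define z where "z = 1 - q"
  define k where "k = 2 * sqrt 3 / 3"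
  define \<eta> where "\<eta> = 1 - k * p / z"
  have z: "z > 0" using q z_def by simp
  have "((\<lambda>t. outer_u (p + t) q - A * (1 - k * (p + t) / z)\<^sup>2 + 2 * (D / z) * (1 - k * (p + t) / z) * (1 - (1 - k * (p + t) / z)))
      has_real_derivative a1 + 2 * A * \<eta> * k / z + 2 * (D / z) * (k / z) * (2 * \<eta> - 1)) (at 0)"
    apply (rule derivative_eq_intros u refl | (use z in \<open>simp; fail\<close>))+
    using z by (simp add: \<eta>_def field_simps power2_eq_square)
  then have 1: "((\<lambda>t. field_u (p + t) q) has_real_derivative a1 + 2 * A * \<eta> * k / z + 2 * (D / z) * (k / z) * (2 * \<eta> - 1)) (at 0)"
  proof (rule has_field_derivative_transform_within_open)
    show "open {t. 2 * sqrt 3 / 3 * (p + t) < 1 - q}" by (intro open_Collect_less continuous_intros)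
    show "outer_u (p + t) q - A * (1 - k * (p + t) / z)\<^sup>2 + 2 * (D / z) * (1 - k * (p + t) / z) * (1 - (1 - k * (p + t) / z)) = field_u (p + t) q"
      if "t \<in> {t. 2 * sqrt 3 / 3 * (p + t) < 1 - q}" for t
    proof -
      have "fade (p + t) q = 1 - k * (p + t) / z"
        using that z unfolding k_def z_def by (simp add: fade_def max_def field_simps)
      then show ?thesis by (simp add: field_u_def A_def D_def z_def)
    qed
  qed (use True in auto)
  have d': "((\<lambda>t. defect (q + t)) has_real_derivative A) (at 0)"
    using d DERIV_shift[of defect A 0 q] unfolding A_def by (simp add: add.commute)
  have "((\<lambda>t. outer_w p (q + t) - 2 * k * (defect (q + t) / (1 - (q + t))) * (1 - k * p / (1 - (q + t))))
      has_real_derivative a2 - 2 * k * ((A * z + D) / (z * z) * \<eta> - D / z * (k * p / (z * z)))) (at 0)"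
    apply (rule derivative_eq_intros w d' refl | (use z in \<open>simp add: z_def; fail\<close>))+
    using z by (simp add: \<eta>_def D_def[symmetric] z_def[symmetric] diff_diff_eq[symmetric] del: diff_diff_eq) (simp add: field_simps)
  then have 2: "((\<lambda>t. field_w p (q + t)) has_real_derivative a2 - 2 * k * ((A * z + D) / (z * z) * \<eta> - D / z * (k * p / (z * z)))) (at 0)"
  proof (rule has_field_derivative_transform_within_open)
    show "open {t. 2 * sqrt 3 / 3 * p < 1 - (q + t) \<and> q + t < 1}"
      by (intro open_Collect_conj open_Collect_less continuous_intros)
    show "outer_w p (q + t) - 2 * k * (defect (q + t) / (1 - (q + t))) * (1 - k * p / (1 - (q + t))) = field_w p (q + t)"
      if "t \<in> {t. 2 * sqrt 3 / 3 * p < 1 - (q + t) \<and> q + t < 1}" for t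
    proof -
      have "fade p (q + t) = 1 - k * p / (1 - (q + t))"
        using that unfolding k_def by (simp add: fade_def max_def field_simps)
      then show ?thesis by (simp add: field_w_def k_def)
    qed
  qed (use True q in auto)
  \<comment> \<open>The derivatives of the two corrections are the mixed second derivatives of the
    stream function with opposite signs; expressed through \<eta> they cancel.\<close>
  have "k * p / z = 1 - \<eta>" by (simp add: \<eta>_def)
  then have kp: "k * p = (1 - \<eta>) * z" using z by (simp add: field_simps)
  have E: "2 * A * \<eta> * k / z + 2 * (D / z) * (k / z) * (2 * \<eta> - 1)
      - 2 * k * ((A * z + D) / (z * z) * \<eta> - D / z * (k * p / (z * z))) = 0"
    unfolding kp using z by (simp add: field_simps)
  show ?thesis
    by (rule exI, rule exI, rule conjI, rule 1, rule conjI, rule 2) (use E in linarith)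
qed

text \<open>The excluded lines carry the kinks. It suffices to treat the outer field in four zones:
  the arc zone, the strip beyond the side, and the two branches of \<open>bend\<close>. In the first
  two zones \<open>outer_u\<close> does not depend on \<open>p\<close>, and \<open>outer_w\<close>
  is \<open>h0 * q\<close>.\<close>

lemma field_divergence:
  assumes dom: "field_dom p q" and n: "q \<noteq> q_tan" "1 - q \<noteq> z_mid" "p \<noteq> 0"
    "2 * sqrt 3 / 3 * p \<noteq> 1 - q" "sqrt 3 * (1 - q) - p \<noteq> 10 * sqrt 3 * (q - q_tan)"
  shows "\<exists>b1 b2. ((\<lambda>t. field_u (p + t) q) has_real_derivative b1) (at 0)
    \<and> ((\<lambda>t. field_w p (q + t)) has_real_derivative b2) (at 0) \<and> b1 + b2 = h0"
proof -
  have q: "0 \<le> q" "q < 1" and p: "p > 0" using dom n unfolding field_dom_def by auto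
  have "\<exists>a1 a2. ((\<lambda>t. outer_u (p + t) q) has_real_derivative a1) (at 0)
    \<and> ((\<lambda>t. outer_w p (q + t)) has_real_derivative a2) (at 0) \<and> a1 + a2 = h0"
  proof (cases "q < q_tan")
    case True
    have "clip (p + t) q = q" for t
      using True unfolding clip_def by (simp add: min_def max_def)
    then have "outer_u (p + t) q = arc_u q" for t
      using True unfolding outer_u_def by (simp add: bend_below)
    then have "((\<lambda>t. outer_u (p + t) q) has_real_derivative 0) (at 0)" by simp
    moreover have "((\<lambda>t. h0 * (q + t)) has_real_derivative h0) (at 0)"
      by (auto intro!: derivative_eq_intros)
    then have "((\<lambda>t. outer_w p (q + t)) has_real_derivative h0) (at 0)"
      by (rule has_field_derivative_transform_within_open[of _ _ _ "{..<q_tan - q}"])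
        (use True in \<open>auto simp: outer_w_def bend_below clip_def min_def max_def\<close>)
    ultimately show ?thesis by (intro exI[of _ 0] exI[of _ h0]) auto
  next
    case False
    then have qt: "q > q_tan" using n by simp
    then have pt: "sqrt 3 * (1 - q) < p_tan" unfolding p_tan_def z_tan_def by simp
    show ?thesis
    proof (cases "p < sqrt 3 * (1 - q)")
      case False
      then have pp: "17/100 < p" using dom unfolding field_dom_def by auto
      then have p1: "q_tan + 10 * max 0 (p - p_tan) > 1" using q_tan_bounds p_tan_bounds by simp
      have "((\<lambda>t. arc_u q) has_real_derivative 0) (at 0)" by simp
      then have "((\<lambda>t. outer_u (p + t) q) has_real_derivative 0) (at 0)"
      proof (rule has_field_derivative_transform_within_open[of _ _ _ "{17/100 - p<..}"])
        fix t assume "t \<in> {17/100 - p<..}"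
        then have t: "17/100 < p + t" by simp
        then have "q_tan + 10 * max 0 (p + t - p_tan) > 1" using q_tan_bounds p_tan_bounds by simp
        moreover have "bend (p + t) q = 0"
          unfolding bend_def using t pt p_tan_bounds by (intro max_absorb1 min.coboundedI1) simp
        ultimately show "arc_u q = outer_u (p + t) q" using q unfolding outer_u_def clip_def by simp
      qed (use pp in auto)
      moreover have "((\<lambda>t. h0 * (q + t)) has_real_derivative h0) (at 0)"
        by (auto intro!: derivative_eq_intros)
      then have "((\<lambda>t. outer_w p (q + t)) has_real_derivative h0) (at 0)"
      proof (rule has_field_derivative_transform_within_open[of _ _ _ "{q_tan - q<..<1 - q}"])
        fix t assume "t \<in> {q_tan - q<..<1 - q}"
        then have t: "q_tan < q + t" "q + t < 1" by auto
        then have "sqrt 3 * (1 - (q + t)) < p_tan" unfolding p_tan_def z_tan_def by simp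
        then have "bend p (q + t) = 0"
          unfolding bend_def using pp p_tan_bounds by (intro max_absorb1 min.coboundedI1) simp
        moreover have "clip p (q + t) = q + t"
          using t p1 unfolding clip_def by (intro min_absorb1) linarith
        ultimately show "h0 * (q + t) = outer_w p (q + t)" unfolding outer_w_def by simp
      qed (use q qt in auto)
      ultimately show ?thesis by (intro exI[of _ 0] exI[of _ h0]) auto
    next
      case True
      have c: "clip p' q' = q_tan" if "p' < p_tan" "q' > q_tan" for p' q'
        using that unfolding clip_def by simp
      show ?thesis
      proof (cases "sqrt 3 * (1 - q) - p < 10 * sqrt 3 * (q - q_tan)")
        case less: True
        let ?b = "\<lambda>p q. sqrt 3 * (1 - q) - p"
        have b: "bend p' q' = ?b p' q'" if "p' < sqrt 3 * (1 - q')" "?b p' q' < 10 * sqrt 3 * (q' - q_tan)" for p' q'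
          using that unfolding bend_def by simp
        have "((\<lambda>t. -1 - 11/10 * h0 * ?b (p + t) q) has_real_derivative 11/10 * h0) (at 0)"
          by (auto intro!: derivative_eq_intros)
        then have "((\<lambda>t. outer_u (p + t) q) has_real_derivative 11/10 * h0) (at 0)"
        proof (rule has_field_derivative_transform_within_open)
          show "open {t. p + t < sqrt 3 * (1 - q) \<and> ?b (p + t) q < 10 * sqrt 3 * (q - q_tan)}"
            by (intro open_Collect_conj open_Collect_less continuous_intros)
          show "- 1 - 11/10 * h0 * ?b (p + t) q = outer_u (p + t) q"
            if "t \<in> {t. p + t < sqrt 3 * (1 - q) \<and> ?b (p + t) q < 10 * sqrt 3 * (q - q_tan)}" for t
            using that pt qt b[of "p + t" q] c[of "p + t" q] by (simp add: outer_u_def arc_u_q_tan)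
        qed (use True less in auto)
        moreover have "((\<lambda>t. sqrt 3 + h0 * sqrt 3 / 30 * ?b p (q + t)) has_real_derivative - (h0 / 10)) (at 0)"
          by (auto intro!: derivative_eq_intros)
        then have "((\<lambda>t. outer_w p (q + t)) has_real_derivative - (h0 / 10)) (at 0)"
        proof (rule has_field_derivative_transform_within_open)
          show "open {t. p < sqrt 3 * (1 - (q + t)) \<and> ?b p (q + t) < 10 * sqrt 3 * (q + t - q_tan) \<and> q_tan < q + t}"
            by (intro open_Collect_conj open_Collect_less continuous_intros)
          show "sqrt 3 + h0 * sqrt 3 / 30 * ?b p (q + t) = outer_w p (q + t)"
            if "t \<in> {t. p < sqrt 3 * (1 - (q + t)) \<and> ?b p (q + t) < 10 * sqrt 3 * (q + t - q_tan) \<and> q_tan < q + t}" for t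
            using that True pt b[of p "q + t"] c[of p "q + t"] by (simp add: outer_w_def curv_q_tan)
        qed (use True less qt in auto)
        ultimately show ?thesis by (intro exI[of _ "11/10 * h0"] exI[of _ "- (h0 / 10)"]) auto
      next
        case False
        then have gr: "sqrt 3 * (1 - q) - p > 10 * sqrt 3 * (q - q_tan)" using n by simp
        have b: "bend p' q' = 10 * sqrt 3 * (q' - q_tan)"
          if "10 * sqrt 3 * (q' - q_tan) < sqrt 3 * (1 - q') - p'" "q_tan < q'" for p' q'
          using that unfolding bend_def by simp
        have "((\<lambda>t. -1 - 11/10 * h0 * (10 * sqrt 3 * (q - q_tan))) has_real_derivative 0) (at 0)" by simp
        then have "((\<lambda>t. outer_u (p + t) q) has_real_derivative 0) (at 0)"
        proof (rule has_field_derivative_transform_within_open)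
          show "open {t. p + t < p_tan \<and> 10 * sqrt 3 * (q - q_tan) < sqrt 3 * (1 - q) - (p + t)}"
            by (intro open_Collect_conj open_Collect_less continuous_intros)
          show "-1 - 11/10 * h0 * (10 * sqrt 3 * (q - q_tan)) = outer_u (p + t) q"
            if "t \<in> {t. p + t < p_tan \<and> 10 * sqrt 3 * (q - q_tan) < sqrt 3 * (1 - q) - (p + t)}" for t
            using that qt b[of q "p + t"] c[of "p + t" q] by (simp add: outer_u_def arc_u_q_tan)
        qed (use True pt gr in auto)
        moreover have "((\<lambda>t. sqrt 3 + h0 * sqrt 3 / 30 * (10 * sqrt 3 * (q + t - q_tan))) has_real_derivative h0) (at 0)"
          by (auto intro!: derivative_eq_intros)
        then have "((\<lambda>t. outer_w p (q + t)) has_real_derivative h0) (at 0)"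
        proof (rule has_field_derivative_transform_within_open)
          show "open {t. 10 * sqrt 3 * (q + t - q_tan) < sqrt 3 * (1 - (q + t)) - p \<and> q_tan < q + t}"
            by (intro open_Collect_conj open_Collect_less continuous_intros)
          show "sqrt 3 + h0 * sqrt 3 / 30 * (10 * sqrt 3 * (q + t - q_tan)) = outer_w p (q + t)"
            if "t \<in> {t. 10 * sqrt 3 * (q + t - q_tan) < sqrt 3 * (1 - (q + t)) - p \<and> q_tan < q + t}" for t
            using that True pt b[of "q + t" p] c[of p "q + t"] by (simp add: outer_w_def curv_q_tan)
        qed (use gr qt in auto)
        ultimately show ?thesis by (intro exI[of _ 0] exI[of _ h0]) auto
      qed
    qed
  qed
  then show ?thesis using field_divergence_aux[OF _ _ DERIV_defect[OF q n(1,2)] q(2) n(4)] by metis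
qed

section \<open>The norm bound in one cone\<close>

lemma sqrt3_mult: "sqrt 3 * (sqrt 3 * x) = 3 * x" for x :: real
  by (simp add: mult.assoc[symmetric])

lemma q_tan_half: "0 \<le> q \<Longrightarrow> q \<le> q_tan \<Longrightarrow> 0 \<le> h0 * q / 2 \<and> h0 * q / 2 \<le> sqrt 3 / 2"
  using curv_q_tan curv_bounds mult_left_mono[of q q_tan h0] by auto

lemma sqrt_one_minus_ge_half:
  assumes "0 \<le> s" "s \<le> sqrt 3 / 2"
  shows "1 / 2 \<le> sqrt (1 - s\<^sup>2)"
proof (rule real_le_rsqrt)
  have "s\<^sup>2 \<le> (sqrt 3 / 2)\<^sup>2" using assms by (intro power_mono) auto
  then show "(1/2)\<^sup>2 \<le> 1 - s\<^sup>2" by (simp add: power_divide)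
qed

text \<open>\<open>arc_u\<close> changes sign at \<open>r0\<close>, where the arc normal makes 30
  degrees with the tip axis and so has the reentrant direction. Hence \<open>arc_prim\<close>
  increases up to \<open>r0\<close> and decreases afterwards.\<close>

lemma arc_u_nonneg:
  assumes "0 \<le> q" "q \<le> r0"
  shows "0 \<le> arc_u q"
proof -
  define s where "s = h0 * q / 2"
  have s: "0 \<le> s" "s \<le> 1/2"
    using assms curv_bounds curv_radius(2) mult_left_mono[of q r0 h0] unfolding s_def by auto
  have "sqrt 3 * s \<le> sqrt (1 - s\<^sup>2)"
  proof (rule real_le_rsqrt)
    have "s\<^sup>2 \<le> (1/2)\<^sup>2" using s by (intro power_mono) auto
    then show "(sqrt 3 * s)\<^sup>2 \<le> 1 - s\<^sup>2" by (simp add: power_mult_distrib power_divide)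
  qed
  then show ?thesis unfolding arc_u_def s_def by simp
qed

lemma arc_u_nonpos:
  assumes "r0 \<le> q"
  shows "arc_u q \<le> 0"
proof -
  define s where "s = h0 * q / 2"
  have s: "1/2 \<le> s"
    using assms curv_bounds curv_radius(2) mult_left_mono[of r0 q h0] unfolding s_def by auto
  have "sqrt (1 - s\<^sup>2) \<le> sqrt 3 * s"
  proof (rule real_le_lsqrt)
    have "(1/2)\<^sup>2 \<le> s\<^sup>2" using s by (intro power_mono) auto
    then show "1 - s\<^sup>2 \<le> (sqrt 3 * s)\<^sup>2" by (simp add: power_mult_distrib power_divide)
  qed (use s in auto)
  then show ?thesis unfolding arc_u_def s_def by simp
qed

lemma arc_prim_q_tan_ge: "z_tan \<le> arc_prim q_tan"
  unfolding arc_prim_q_tan using curv_bounds by simp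

lemma arc_prim_ge_tan:
  assumes "r0 \<le> q" "q \<le> q_tan"
  shows "z_tan \<le> arc_prim q"
proof -
  have "arc_prim q_tan \<le> arc_prim q"
  proof (rule DERIV_nonpos_imp_nonincreasing[OF assms(2)])
    fix x assume "q \<le> x" "x \<le> q_tan"
    then show "\<exists>y. (arc_prim has_real_derivative y) (at x) \<and> y \<le> 0"
      using DERIV_arc_prim[of x] arc_u_nonpos[of x] assms radius_bounds q_tan_bounds by auto
  qed
  then show ?thesis using arc_prim_q_tan_ge by simp
qed

lemma arc_prim_nonneg:
  assumes "0 \<le> q" "q \<le> q_tan"
  shows "0 \<le> arc_prim q"
proof (cases "q \<le> r0")
  case True
  have "arc_prim 0 \<le> arc_prim q"
  proof (rule DERIV_nonneg_imp_nondecreasing[OF assms(1)])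
    fix x assume "0 \<le> x" "x \<le> q"
    then show "\<exists>y. (arc_prim has_real_derivative y) (at x) \<and> 0 \<le> y"
      using DERIV_arc_prim[of x] arc_u_nonneg[of x] True radius_bounds by auto
  qed
  then show ?thesis by (simp add: arc_prim_0)
next
  case False
  then show ?thesis using arc_prim_ge_tan[of q] assms z_tan_bounds by auto
qed

text \<open>With \<open>arc_prim_lower\<close> this says that \<open>field_w 0 q\<close> lies
  between -1 and 1. The difference of the two sides decreases in \<open>q\<close>, so only
  \<open>q_tan\<close> has to be checked, where \<open>arc_prim_q_tan\<close> gives the
  value.\<close>

lemma arc_prim_upper:
  assumes "0 \<le> q" "q \<le> q_tan"
  shows "4 * sqrt 3 / 3 * arc_prim q \<le> (1 - q) * (1 + h0 * q)"
proof -
  let ?R = "\<lambda>q. (1 - q) * (1 + h0 * q) - 4 * sqrt 3 / 3 * arc_prim q"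
  have "?R q_tan \<le> ?R q"
  proof (rule DERIV_nonpos_imp_nonincreasing[OF assms(2)])
    fix x assume "q \<le> x" "x \<le> q_tan"
    then have x: "0 \<le> x" "x \<le> q_tan" "x < 1" using assms q_tan_bounds by auto
    have d: "(?R has_real_derivative (1 - x) * h0 - (1 + h0 * x) - 4 * sqrt 3 / 3 * arc_u x) (at x)"
      by (rule derivative_eq_intros DERIV_arc_prim x refl | simp)+
    have "(1 - x) * h0 - (1 + h0 * x) - 4 * sqrt 3 / 3 * arc_u x = h0 - 1 - 4 * sqrt 3 / 3 * sqrt (1 - (h0 * x / 2)\<^sup>2)"
      by (simp add: arc_u_def algebra_simps)
    moreover have "4 * sqrt 3 / 3 * (1/2) \<le> 4 * sqrt 3 / 3 * sqrt (1 - (h0 * x / 2)\<^sup>2)"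
      using sqrt_one_minus_ge_half q_tan_half[OF x(1,2)] by (intro mult_left_mono) auto
    ultimately have "(1 - x) * h0 - (1 + h0 * x) - 4 * sqrt 3 / 3 * arc_u x \<le> 0"
      using curv_bounds sqrt3_bounds by linarith
    then show "\<exists>y. (?R has_real_derivative y) (at x) \<and> y \<le> 0" using d by blast
  qed
  moreover have "?R q_tan \<ge> 0"
  proof -
    have "?R q_tan = z_tan * (1 + sqrt 3) - 4 * sqrt 3 / 3 * (z_tan + h0 * sqrt 3 / 2 * z_tan\<^sup>2)"
      unfolding arc_prim_q_tan curv_q_tan by (simp add: z_tan_def)
    also have "\<dots> = z_tan * (1 + sqrt 3 - 4 * sqrt 3 / 3 - 2 * (h0 * z_tan))"
      by (simp add: power2_eq_square algebra_simps)
    also have "\<dots> \<ge> 0" unfolding curv_z_tan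
      by (intro mult_nonneg_nonneg) (use z_tan_bounds curv_bounds sqrt3_bounds in auto)
    finally show ?thesis .
  qed
  ultimately show ?thesis by simp
qed

lemma arc_prim_lower:
  assumes "0 \<le> q" "q \<le> q_tan"
  shows "(1 - q) * (h0 * q - 1) \<le> 4 * sqrt 3 / 3 * arc_prim q"
proof (cases "q \<le> r0")
  case True
  then have "h0 * q \<le> 1" using curv_bounds curv_radius(2) mult_left_mono[of q r0 h0] by auto
  then have "(1 - q) * (h0 * q - 1) \<le> 0" using assms q_tan_bounds by (intro mult_nonneg_nonpos) auto
  then show ?thesis using arc_prim_nonneg[OF assms] by (smt (verit) mult_nonneg_nonneg real_sqrt_ge_zero divide_nonneg_nonneg)
next
  case False
  have "(1 - q) * (h0 * q - 1) = h0 * ((1 - q) * (q - r0))"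
    using curv_radius(2) by (simp add: algebra_simps)
  \<comment> \<open>The product (1 - q) (q - r0) is at most the square of half of 1 - r0, and 1 - r0
    < 473/1000. The crude bound by \<open>z_tan\<close> for \<open>arc_prim\<close> leaves enough
    room.\<close>
  also have "\<dots> \<le> 1898/1000 * (473/2000)\<^sup>2"
  proof (rule mult_mono)
    have "((1 - r0) / 2)\<^sup>2 - (1 - q) * (q - r0) = (q - (1 + r0) / 2)\<^sup>2"
      by (simp add: power2_eq_square field_simps)
    moreover have "((1 - r0) / 2)\<^sup>2 \<le> (473/2000)\<^sup>2" using radius_bounds by (intro power_mono) auto
    ultimately show "(1 - q) * (q - r0) \<le> (473/2000)\<^sup>2" by (smt (verit) zero_le_power2)
    show "0 \<le> (1 - q) * (q - r0)" using False assms q_tan_bounds by (intro mult_nonneg_nonneg) auto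
  qed (use curv_bounds in auto)
  also have "\<dots> \<le> 4 * (1732/1000) / 3 * (8/100)" by (simp add: power2_eq_square)
  also have "\<dots> \<le> 4 * sqrt 3 / 3 * arc_prim q"
    using sqrt3_bounds z_tan_bounds arc_prim_ge_tan[of q] False assms by (intro mult_mono) auto
  finally show ?thesis .
qed

text \<open>Convexity in \<open>\<eta>\<close> reduces the norm bound to the ray \<open>p = 0\<close>, where the field is a multiple of
  a unit vector.\<close>

lemma arc_norm_aux:
  fixes c s \<delta> \<eta> :: real
  assumes c: "c\<^sup>2 + s\<^sup>2 = 1" and nn: "0 \<le> s" "0 \<le> \<delta>" "0 \<le> \<eta>" "\<eta> \<le> 1"
    and b: "\<bar>2 * s - 4 * sqrt 3 / 3 * \<delta>\<bar> \<le> 1"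
  defines "A \<equiv> c - sqrt 3 * s + 2 * \<delta>"
  shows "(c - \<eta>\<^sup>2 * A)\<^sup>2 + (s - 2 * sqrt 3 / 3 * \<delta> * \<eta>)\<^sup>2 \<le> 1"
proof -
  define X where "X = - 2 * c * A + A\<^sup>2 + 4/3 * \<delta>\<^sup>2"
  define Y where "Y = 4 * sqrt 3 / 3 * s * \<delta>"
  have Y: "Y \<ge> 0" unfolding Y_def using nn by simp
  \<comment> \<open>At \<eta> = 1 the squared norm equals the square on the right, and
    \<open>X - Y\<close> is its excess over 1.\<close>
  have "X - Y = (2 * s - 4 * sqrt 3 / 3 * \<delta>)\<^sup>2 - (c\<^sup>2 + s\<^sup>2)"
    unfolding X_def Y_def A_def
    by (simp add: power2_eq_square algebra_simps)
  moreover have "(2 * s - 4 * sqrt 3 / 3 * \<delta>)\<^sup>2 \<le> 1" using b by (simp add: abs_square_le_1)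
  ultimately have XY: "X \<le> Y" using c by simp
  have \<eta>XY: "\<eta> * X \<le> Y"
  proof (cases "X \<ge> 0")
    case True
    then have "\<eta> * X \<le> 1 * X" using nn by (intro mult_right_mono) auto
    then show ?thesis using XY by simp
  next
    case False
    then show ?thesis using nn Y by (smt (verit) mult_nonneg_nonpos)
  qed
  \<comment> \<open>Bounding \<eta>^4 by \<eta>^2 leaves 1 + \<eta> (\<eta> X - Y) as an upper bound
    of the squared norm.\<close>
  have "\<eta> ^ 4 \<le> \<eta>\<^sup>2" using nn by (intro power_decreasing) auto
  then have "A\<^sup>2 * \<eta> ^ 4 \<le> A\<^sup>2 * \<eta>\<^sup>2" by (intro mult_left_mono) auto
  moreover have "(c - \<eta>\<^sup>2 * A)\<^sup>2 + (s - 2 * sqrt 3 / 3 * \<delta> * \<eta>)\<^sup>2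
      = (c\<^sup>2 + s\<^sup>2) + \<eta> * (\<eta> * X - Y) + (A\<^sup>2 * \<eta> ^ 4 - A\<^sup>2 * \<eta>\<^sup>2)"
    unfolding X_def Y_def by (simp add: power2_eq_square power4_eq_xxxx algebra_simps)
  moreover have "\<eta> * (\<eta> * X - Y) \<le> 0" using nn \<eta>XY by (intro mult_nonneg_nonpos) auto
  ultimately show ?thesis using c by simp
qed

text \<open>The zone beyond \<open>q_tan\<close>: \<open>m\<close> stands for
  \<open>h0 * bend p q\<close>, \<open>e1\<close> for \<open>11/10 * h0 * bend 0 q\<close>, and
  \<open>1 + e2\<close> for \<open>defect q / (1 - q)\<close>. At \<eta> = 0 the squared norm is 1 -
  L, so the outer field has slack L, which the correction must not exceed; as in
  \<open>arc_norm_aux\<close> this is decided at \<eta> = 1.\<close>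

lemma flat_norm_aux:
  fixes m e1 e2 \<eta> :: real
  assumes m: "0 \<le> m" "11/10 * m \<le> e1" "e1 \<le> 29/100" and e2: "e1 / 2 \<le> e2" "e2 \<le> 17/100"
    and \<eta>: "0 \<le> \<eta>" "\<eta> \<le> 1"
  defines "A \<equiv> 1 + 2 * e2 - e1" and "\<delta> \<equiv> 1 + e2"
  shows "(1/2 - 105/100 * m - \<eta>\<^sup>2 * A)\<^sup>2
    + (sqrt 3 / 2 + sqrt 3 * m / 60 - 2 * sqrt 3 / 3 * \<delta> * \<eta>)\<^sup>2 \<le> 1"
proof -
  define X where "X = A\<^sup>2 - A + 21/10 * m * A + 4/3 * \<delta>\<^sup>2"
  define L where "L = m - (11025/10000 + 1/1200) * m\<^sup>2"
  have m3: "m \<le> 3/10" using m by simp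
  have L: "L \<ge> 0"
  proof -
    have "(11025/10000 + 1/1200) * m\<^sup>2 \<le> m" unfolding power2_eq_square
      using m3 m mult_left_mono[of "(11025/10000 + 1/1200) * m" 1 m] by (simp add: mult.left_commute)
    then show ?thesis unfolding L_def by simp
  qed
  have A: "1 \<le> A" "A \<le> 134/100 - 11/10 * m" using m e2 unfolding A_def by auto
  have "A * (A - 1 + 21/10 * m) \<le> (134/100 - 11/10 * m) * ((134/100 - 11/10 * m) - 1 + 21/10 * m)"
    using A m m3 by (intro mult_mono) auto
  moreover have "4/3 * \<delta>\<^sup>2 - 2 * \<delta> \<le> - (5148/10000)"
  proof -
    have d: "1 \<le> \<delta>" "\<delta> \<le> 117/100" using m e2 unfolding \<delta>_def by auto
    \<comment> \<open>On [1, 117/100] the square lies below its chord.\<close>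
    have "(\<delta> - 1) * (117/100 - \<delta>) \<ge> 0" using d by (intro mult_nonneg_nonneg) auto
    then have "\<delta>\<^sup>2 \<le> 217/100 * \<delta> - 117/100" by (simp add: power2_eq_square field_simps)
    then show ?thesis using d by simp
  qed
  moreover have "m\<^sup>2 \<le> 3/10 * m" unfolding power2_eq_square using m m3 by (intro mult_right_mono) auto
  ultimately have XL: "X - 2 * \<delta> \<le> L" using m
    unfolding X_def L_def by (simp add: power2_eq_square algebra_simps)
  have \<eta>X: "\<eta> * (\<eta> * X - 2 * \<delta>) \<le> L"
  proof (cases "\<eta> * X - 2 * \<delta> \<le> 0")
    case True
    then show ?thesis using \<eta> L by (smt (verit) mult_nonneg_nonpos)
  next
    case False
    have d: "0 \<le> \<delta>" using m e2 unfolding \<delta>_def by auto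
    have X0: "X \<ge> 0"
    proof (rule ccontr)
      assume "\<not> X \<ge> 0"
      then have "\<eta> * X \<le> 0" using \<eta> by (intro mult_nonneg_nonpos) auto
      then show False using False d by simp
    qed
    have "\<eta> * X \<le> 1 * X" using \<eta> X0 by (intro mult_right_mono) auto
    moreover have "\<eta> * (\<eta> * X - 2 * \<delta>) \<le> 1 * (\<eta> * X - 2 * \<delta>)" using \<eta> False by (intro mult_right_mono) auto
    ultimately show ?thesis using XL by simp
  qed
  have "\<eta> ^ 4 \<le> \<eta>\<^sup>2" using \<eta> by (intro power_decreasing) auto
  then have "A\<^sup>2 * \<eta> ^ 4 \<le> A\<^sup>2 * \<eta>\<^sup>2" by (intro mult_left_mono) auto
  moreover have "0 \<le> m * \<delta> * \<eta> / 15" using m e2 \<eta> unfolding \<delta>_def by auto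
  moreover have "(1/2 - 105/100 * m - \<eta>\<^sup>2 * A)\<^sup>2 + (sqrt 3 / 2 + sqrt 3 * m / 60 - 2 * sqrt 3 / 3 * \<delta> * \<eta>)\<^sup>2
    = 1 - L + \<eta> * (\<eta> * X - 2 * \<delta>) + (A\<^sup>2 * \<eta> ^ 4 - A\<^sup>2 * \<eta>\<^sup>2) - m * \<delta> * \<eta> / 15"
    unfolding X_def L_def by (simp add: power2_eq_square power4_eq_xxxx field_simps sqrt3_mult)
  ultimately show ?thesis using \<eta>X by simp
qed

lemma outer_u_outer_w_arc:
  assumes "clip p q = q" "bend p q = 0"
  shows "outer_u p q = sqrt (1 - (h0 * q / 2)\<^sup>2) - sqrt 3 * (h0 * q / 2)" "outer_w p q = h0 * q"
  using assms by (simp_all add: outer_u_def outer_w_def arc_u_def)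

text \<open>For directions at 30 degrees the two squares are the components along and across the tip
  axis.\<close>

lemma hex_norm_form: "u\<^sup>2 + w\<^sup>2 + sqrt 3 * u * w = (u + sqrt 3 / 2 * w)\<^sup>2 + (w / 2)\<^sup>2"
  by (simp add: power2_eq_square field_simps)

lemma fade_nonneg: "0 \<le> fade p q"
  by (simp add: fade_def)

lemma fade_le_1: "0 \<le> p \<Longrightarrow> q < 1 \<Longrightarrow> fade p q \<le> 1"
  by (simp add: fade_def)

text \<open>All three bounds come from \<open>h0 * sqrt 3 * z_tan\<close>, which equals sqrt 3 h0 -
  3 and is at most 0.29. The factor 11/10 in \<open>e1\<close> is absorbed because 11/10 of
  \<open>z_mid\<close> is \<open>z_tan\<close>.\<close>

lemma flat_excess_bounds:
  assumes q: "q_tan \<le> q" "q < 1"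
  defines "e1 \<equiv> 11/10 * h0 * bend 0 q" and "e2 \<equiv> defect q / (1 - q) - 1"
  shows "e1 \<le> 29/100" "e1 / 2 \<le> e2" "e2 \<le> 17/100"
proof -
  define z where "z = 1 - q"
  define w where "w = max 0 (z - z_mid)"
  have z: "0 < z" "z \<le> z_tan" using q unfolding z_def z_tan_def by auto
  have w: "0 \<le> w" "w \<le> z" using z z_mid_bounds unfolding w_def by auto
  have b: "bend 0 q = sqrt 3 * (z - 11 * w)"
    using bend_0_flat[of q] q unfolding z_def w_def by simp
  have "e2 = (defect q - z) / z" unfolding e2_def z_def[symmetric] using z by (simp add: field_simps)
  also have "defect q - z = 11/10 * h0 * (sqrt 3 / 2) * (z\<^sup>2 - 11 * w\<^sup>2)"
    using defect_flat[OF q(1)] unfolding z_def w_def by simp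
  finally have e2: "e2 = 11/10 * h0 * (sqrt 3 / 2) * ((z\<^sup>2 - 11 * w\<^sup>2) / z)" by simp
  have e1: "e1 = 11/10 * h0 * sqrt 3 * (z - 11 * w)" unfolding e1_def b by simp
  have hz: "h0 * sqrt 3 * z_tan \<le> 29/100"
  proof -
    have "sqrt 3 * h0 \<le> 17321/10000 * (1898/1000)"
      by (intro mult_mono) (use sqrt3_bounds curv_bounds in auto)
    moreover have "h0 * sqrt 3 * z_tan = sqrt 3 * h0 - 3" using curv_z_tan
      by (metis mult.assoc mult.commute right_diff_distrib sqrt3_sq(1))
    ultimately show ?thesis by simp
  qed
  have pos: "0 < h0 * sqrt 3" using curv_bounds by simp
  have zm: "z - 11 * w \<le> z_mid"
    unfolding w_def using z_mid_bounds by (auto simp: max_def)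
  have "e1 = (h0 * sqrt 3) * (11/10 * (z - 11 * w))" unfolding e1 by simp
  also have "\<dots> \<le> (h0 * sqrt 3) * z_tan"
    using zm pos by (intro mult_left_mono) (auto simp: z_mid_def)
  finally show "e1 \<le> 29/100" using hz by simp
  have "(z - 11 * w) \<le> (z\<^sup>2 - 11 * w\<^sup>2) / z"
  proof -
    have "11 * w * w \<le> 11 * w * z" using w by (intro mult_left_mono) auto
    then show ?thesis using z by (simp add: field_simps power2_eq_square)
  qed
  then have "11/10 * h0 * (sqrt 3 / 2) * (z - 11 * w) \<le> e2" unfolding e2
    using curv_bounds by (intro mult_left_mono) auto
  then show "e1 / 2 \<le> e2" unfolding e1 by simp
  have "(z\<^sup>2 - 11 * w\<^sup>2) / z \<le> z_tan"
  proof (cases "z \<le> z_mid")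
    case True
    then show ?thesis using z z_mid_bounds unfolding w_def by (simp add: power2_eq_square)
  next
    case False
    then have w': "w = z - 10/11 * z_tan" unfolding w_def z_mid_def by simp
    have "z\<^sup>2 - 11 * w\<^sup>2 = 10/11 * z_tan * z_tan - 10 * (z_tan - z)\<^sup>2"
      unfolding w' by (simp add: power2_eq_square field_simps)
    also have "\<dots> \<le> z_mid * z_tan" unfolding z_mid_def by simp
    also have "\<dots> \<le> z * z_tan" using False z by (intro mult_right_mono) auto
    finally show ?thesis using z by (simp add: divide_le_eq mult.commute)
  qed
  then have "e2 \<le> 11/10 * h0 * (sqrt 3 / 2) * z_tan" unfolding e2
    using curv_bounds by (intro mult_left_mono) auto
  then show "e2 \<le> 17/100" using hz by simp
qed

lemma field_norm:
  assumes dom: "field_dom p q"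
  shows "(field_u p q)\<^sup>2 + (field_w p q)\<^sup>2 + sqrt 3 * field_u p q * field_w p q \<le> 1"
proof -
  have q: "0 \<le> q" "q < 1" and p: "p \<ge> 0" using dom unfolding field_dom_def by auto
  define \<eta> where "\<eta> = fade p q"
  define \<delta> where "\<delta> = defect q / (1 - q)"
  define A where "A = outer_u 0 q + 2 * \<delta>"
  have \<eta>: "0 \<le> \<eta>" "\<eta> \<le> 1" unfolding \<eta>_def using fade_nonneg fade_le_1 p q by auto
  have a: "field_u p q + sqrt 3 / 2 * field_w p q = (outer_u p q + sqrt 3 / 2 * outer_w p q) - \<eta>\<^sup>2 * A"
    unfolding field_u_def field_w_def \<eta>_def[symmetric] \<delta>_def[symmetric] A_def
    by (simp add: power2_eq_square field_simps)
  have b: "field_w p q / 2 = outer_w p q / 2 - 2 * sqrt 3 / 3 * \<delta> * \<eta>"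
    unfolding field_w_def \<eta>_def[symmetric] \<delta>_def[symmetric] by simp
  define s where "s = h0 * q / 2"
  define c where "c = sqrt (1 - s\<^sup>2)"
  have s: "0 \<le> s" "s < 1" using half_curv_less_1[OF q] unfolding s_def by auto
  then have cs: "c\<^sup>2 + s\<^sup>2 = 1" using one_minus_sq_pos[of s] unfolding c_def by simp
  have arc: "outer_u p q + sqrt 3 / 2 * outer_w p q = c" "outer_w p q / 2 = s"
    if "clip p q = q" "bend p q = 0"
    unfolding outer_u_outer_w_arc[OF that] s_def c_def by simp_all
  show ?thesis
  proof (cases "q \<le> q_tan")
    case True
    have cb: "clip p q = q" "bend p q = 0" using True by (auto simp: clip_def bend_below min_def max_def)
    have D: "defect q = arc_prim q" using True by (rule defect_arc)
    have \<delta>0: "0 \<le> \<delta>" unfolding \<delta>_def D using arc_prim_nonneg[OF q(1) True] q by simp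
    have "4 * sqrt 3 / 3 * \<delta> \<le> 1 + h0 * q" "h0 * q - 1 \<le> 4 * sqrt 3 / 3 * \<delta>"
      using arc_prim_upper[OF q(1) True] arc_prim_lower[OF q(1) True] q
      unfolding \<delta>_def D by (simp_all add: field_simps)
    then have "\<bar>2 * s - 4 * sqrt 3 / 3 * \<delta>\<bar> \<le> 1" unfolding s_def by simp
    from arc_norm_aux[OF cs s(1) \<delta>0 \<eta> this]
    show ?thesis unfolding hex_norm_form a b arc[OF cb] A_def outer_u_0_arc[OF True] arc_u_def
        s_def[symmetric] c_def[symmetric] .
  next
    case False
    then have qt: "q_tan \<le> q" by simp
    show ?thesis
    proof (cases "p < sqrt 3 * (1 - q)")
      case False
      then have pp: "17/100 < p" using dom unfolding field_dom_def by auto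
      have z: "1 - q \<le> z_tan" using qt unfolding z_tan_def by simp
      have "sqrt 3 * (1 - q) \<le> p_tan" unfolding p_tan_def using z by simp
      then have "bend p q = 0"
        unfolding bend_def using pp p_tan_bounds by (intro max_absorb1 min.coboundedI1) simp
      moreover have "clip p q = q"
      proof -
        have "10 * max 0 (p - p_tan) = 10 * (p - p_tan)" using pp p_tan_bounds by simp
        then show ?thesis using pp q q_tan_bounds p_tan_bounds unfolding clip_def by simp
      qed
      moreover have "\<eta> = 0"
      proof -
        have "1 - q \<le> 2 * sqrt 3 / 3 * p"
          using z z_tan_bounds pp sqrt3_bounds mult_mono[of 1 "2 * sqrt 3 / 3" "17/100" p] by auto
        then show ?thesis unfolding \<eta>_def fade_def using q by (simp add: field_simps)
      qed
      ultimately show ?thesis unfolding hex_norm_form a b using arc cs by simp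
    next
      case True
      have "sqrt 3 * (1 - q) \<le> sqrt 3 * (1 - q_tan)" using qt by simp
      then have pt: "p \<le> p_tan" using True unfolding p_tan_def z_tan_def by linarith
      then have cl: "clip p q = q_tan" using qt unfolding clip_def by simp
      define e1 where "e1 = 11/10 * h0 * bend 0 q"
      define e2 where "e2 = \<delta> - 1"
      define m where "m = h0 * bend p q"
      have e: "e1 \<le> 29/100" "e1 / 2 \<le> e2" "e2 \<le> 17/100"
        using flat_excess_bounds[OF qt q(2)] unfolding e1_def e2_def \<delta>_def by auto
      have "bend p q \<le> bend 0 q" unfolding bend_def using p by (intro max.mono min.mono) auto
      then have m1: "11/10 * m \<le> e1" unfolding m_def e1_def using curv_bounds by simp
      have m0: "0 \<le> m" unfolding m_def bend_def using curv_bounds by simp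
      have ou: "outer_u p q = - 1 - 11/10 * m" unfolding outer_u_def cl arc_u_q_tan m_def by simp
      have ow: "outer_w p q = sqrt 3 + sqrt 3 * m / 30"
        unfolding outer_w_def cl curv_q_tan m_def by simp
      have 1: "outer_u p q + sqrt 3 / 2 * outer_w p q = 1/2 - 105/100 * m"
        unfolding ou ow by (simp add: field_simps)
      have 2: "outer_w p q / 2 = sqrt 3 / 2 + sqrt 3 * m / 60" unfolding ow by simp
      have A: "A = 1 + 2 * e2 - e1" unfolding A_def outer_u_0_flat[OF qt] e1_def e2_def by simp
      have \<delta>: "\<delta> = 1 + e2" unfolding e2_def by simp
      show ?thesis unfolding hex_norm_form a b 1 2 A
        using flat_norm_aux[OF m0 m1 e \<eta>] \<delta> by simp
    qed
  qed
qed

section \<open>The field on the whole hexagram\<close>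

text \<open>\<open>hex_cos k\<close> and \<open>hex_sin k\<close> are the cosine and sine of 30 k
  degrees; as tables they can be evaluated by the simplifier in each of the twelve cases.\<close>

definition hex_cos :: "nat \<Rightarrow> real" where
  "hex_cos k = [1, sqrt 3 / 2, 1/2, 0, -1/2, - sqrt 3 / 2, -1, - sqrt 3 / 2, -1/2, 0, 1/2, sqrt 3 / 2] ! k"

definition hex_sin :: "nat \<Rightarrow> real" where
  "hex_sin k = [0, 1/2, sqrt 3 / 2, 1, sqrt 3 / 2, 1/2, 0, -1/2, - sqrt 3 / 2, -1, - sqrt 3 / 2, -1/2] ! k"

text \<open>A tent function: on the two cones next to direction \<open>k\<close> it is the
  coordinate along that direction, on all others 0. The inner products with the directions at plus
  and minus 60 degrees achieve this, because each of them is orthogonal to one neighbour of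
  \<open>k\<close>. Being a single expression in max and min, it is Lipschitz across the boundaries
  of the cones, and nothing has to be glued.\<close>

definition hex_coord :: "nat \<Rightarrow> real \<Rightarrow> real \<Rightarrow> real" where
  "hex_coord k X Y = 2 * max 0 (min
     (hex_cos ((k + 10) mod 12) * X + hex_sin ((k + 10) mod 12) * Y)
     (hex_cos ((k + 2) mod 12) * X + hex_sin ((k + 2) mod 12) * Y))"

lemma hex_coord_values:
  "hex_coord 0 X Y = 2 * max 0 (min (X / 2 + - sqrt 3 * Y / 2) (X / 2 + sqrt 3 * Y / 2))"
  "hex_coord 1 X Y = 2 * max 0 (min (sqrt 3 * X / 2 + - Y / 2) (Y))"
  "hex_coord (Suc 0) X Y = 2 * max 0 (min (sqrt 3 * X / 2 + - Y / 2) (Y))"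
  "hex_coord 2 X Y = 2 * max 0 (min (X) (- X / 2 + sqrt 3 * Y / 2))"
  "hex_coord 3 X Y = 2 * max 0 (min (sqrt 3 * X / 2 + Y / 2) (- sqrt 3 * X / 2 + Y / 2))"
  "hex_coord 4 X Y = 2 * max 0 (min (X / 2 + sqrt 3 * Y / 2) (- X))"
  "hex_coord 5 X Y = 2 * max 0 (min (Y) (- sqrt 3 * X / 2 + - Y / 2))"
  "hex_coord 6 X Y = 2 * max 0 (min (- X / 2 + sqrt 3 * Y / 2) (- X / 2 + - sqrt 3 * Y / 2))"
  "hex_coord 7 X Y = 2 * max 0 (min (- sqrt 3 * X / 2 + Y / 2) (- Y))"
  "hex_coord 8 X Y = 2 * max 0 (min (- X) (X / 2 + - sqrt 3 * Y / 2))"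
  "hex_coord 9 X Y = 2 * max 0 (min (- sqrt 3 * X / 2 + - Y / 2) (sqrt 3 * X / 2 + - Y / 2))"
  "hex_coord 10 X Y = 2 * max 0 (min (- X / 2 + - sqrt 3 * Y / 2) (X))"
  "hex_coord 11 X Y = 2 * max 0 (min (- Y) (sqrt 3 * X / 2 + Y / 2))"
  by (simp_all add: hex_coord_def hex_cos_def hex_sin_def)

text \<open>A triple \<open>(k, j, s)\<close> stands for the cone between the tip direction \<open>k\<close> and the adjacent reentrant
  direction \<open>j\<close>; the sign \<open>s\<close> records on which side of \<open>k\<close> the direction \<open>j\<close> lies.\<close>

definition hex_cones :: "(nat \<times> nat \<times> real) list" where
  "hex_cones = [(0,1,1), (2,1,-1), (2,3,1), (4,3,-1), (4,5,1), (6,5,-1),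
    (6,7,1), (8,7,-1), (8,9,1), (10,9,-1), (10,11,1), (0,11,-1)]"

lemma hex_values [simp]:
  "hex_cos 0 = 1" "hex_cos 1 = sqrt 3 / 2" "hex_cos (Suc 0) = sqrt 3 / 2" "hex_cos 2 = 1/2" "hex_cos 3 = 0"
  "hex_cos 4 = -1/2" "hex_cos 5 = - sqrt 3 / 2" "hex_cos 6 = -1" "hex_cos 7 = - sqrt 3 / 2"
  "hex_cos 8 = -1/2" "hex_cos 9 = 0" "hex_cos 10 = 1/2" "hex_cos 11 = sqrt 3 / 2"
  "hex_sin 0 = 0" "hex_sin 1 = 1/2" "hex_sin (Suc 0) = 1/2" "hex_sin 2 = sqrt 3 / 2" "hex_sin 3 = 1"
  "hex_sin 4 = sqrt 3 / 2" "hex_sin 5 = 1/2" "hex_sin 6 = 0" "hex_sin 7 = -1/2"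
  "hex_sin 8 = - sqrt 3 / 2" "hex_sin 9 = -1" "hex_sin 10 = - sqrt 3 / 2" "hex_sin 11 = -1/2"
  by (simp_all add: hex_cos_def hex_sin_def)

lemma hex_cones_cases:
  assumes "(k, j, s) \<in> set hex_cones"
  shows "k < 12" "j < 12" "even k" "odd j" "k \<noteq> j" "s = 1 \<or> s = -1"
    "(hex_cos k)\<^sup>2 + (hex_sin k)\<^sup>2 = 1" "(hex_cos j)\<^sup>2 + (hex_sin j)\<^sup>2 = 1"
    "hex_cos k * hex_cos j + hex_sin k * hex_sin j = sqrt 3 / 2"
    "hex_cos k * hex_sin j - hex_sin k * hex_cos j = s / 2"
  using assms unfolding hex_cones_def by (auto simp: power_divide)

lemma less_12_cases: "(i::nat) < 12 \<Longrightarrow> i \<in> {0,1,2,3,4,5,6,7,8,9,10,11}"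
  by simp arith

lemma hex_coord_cone:
  assumes c: "(k, j, s) \<in> set hex_cones" and pq: "0 \<le> p" "0 \<le> q" and i: "i < 12"
  shows "hex_coord i (p * hex_cos k + q * hex_cos j) (p * hex_sin k + q * hex_sin j)
    = (if i = k then p else if i = j then q else 0)"
proof -
  \<comment> \<open>Once the products with sqrt 3 are named, all cases are linear.\<close>
  obtain a where a: "p * sqrt 3 = a" "a * sqrt 3 = p * 3" "p \<le> a"
    using pq sqrt3_bounds mult_left_mono[of 1 "sqrt 3" p] by auto
  obtain b where b: "q * sqrt 3 = b" "b * sqrt 3 = q * 3" "q \<le> b"
    using pq sqrt3_bounds mult_left_mono[of 1 "sqrt 3" q] by auto
  have "(k, j) \<in> {(0,1), (2,1), (2,3), (4,3), (4,5), (6,5), (6,7), (8,7), (8,9), (10,9), (10,11), (0,11)}"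
    using c unfolding hex_cones_def by auto
  then show ?thesis using less_12_cases[OF i] pq a(3) b(3) 
    by (elim insertE emptyE Pair_inject; hypsubst;
      auto simp: hex_coord_values sqrt3_mult algebra_simps add_divide_distrib diff_divide_distrib max_def min_def a(1,2) b(1,2))
qed

text \<open>The inequalities are the signs of the two coordinates in the cone, which is found by
  quadrant and then by slope.\<close>

lemma hex_cover:
  obtains k j s where "(k, j, s) \<in> set hex_cones"
    "0 \<le> 2 * s * (hex_sin j * X - hex_cos j * Y)" "0 \<le> 2 * s * (hex_cos k * Y - hex_sin k * X)"
proof -
  note m = that
  have that: thesis if "(k, j, s) \<in> set hex_cones" "0 \<le> s * (hex_sin j * X - hex_cos j * Y)"
    "0 \<le> s * (hex_cos k * Y - hex_sin k * X)" for k j s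
    using m[OF that(1)] that(2,3) by simp
  show thesis
  proof (cases "0 \<le> X"; cases "0 \<le> Y")
    assume XY: "0 \<le> X" "0 \<le> Y"
    show thesis
    proof (cases "sqrt 3 * Y \<le> X")
      case True then show thesis using XY by (intro that[of 0 1 1]) (auto simp: hex_cones_def)
    next
      case False then show thesis using XY
        using that[of 2 1 "-1"] that[of 2 3 1]
        by (cases "Y \<le> sqrt 3 * X") (auto simp: hex_cones_def)
    qed
  next
    assume XY: "\<not> 0 \<le> X" "0 \<le> Y"
    show thesis
    proof (cases "sqrt 3 * Y \<le> - X")
      case True then show thesis using XY by (intro that[of 6 5 "-1"]) (auto simp: hex_cones_def)
    next
      case False then show thesis using XY
        using that[of 4 5 1] that[of 4 3 "-1"]
        by (cases "Y \<le> - sqrt 3 * X") (auto simp: hex_cones_def)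
    qed
  next
    assume XY: "0 \<le> X" "\<not> 0 \<le> Y"
    show thesis
    proof (cases "- sqrt 3 * Y \<le> X")
      case True then show thesis using XY by (intro that[of 0 11 "-1"]) (auto simp: hex_cones_def)
    next
      case False then show thesis using XY
        using that[of 10 11 1] that[of 10 9 "-1"]
        by (cases "- Y \<le> sqrt 3 * X") (auto simp: hex_cones_def)
    qed
  next
    assume XY: "\<not> 0 \<le> X" "\<not> 0 \<le> Y"
    show thesis
    proof (cases "- sqrt 3 * Y \<le> - X")
      case True then show thesis using XY by (intro that[of 6 7 1]) (auto simp: hex_cones_def)
    next
      case False then show thesis using XY
        using that[of 8 7 "-1"] that[of 8 9 1]
        by (cases "- Y \<le> - sqrt 3 * X") (auto simp: hex_cones_def)
    qed
  qed
qed

text \<open>The orthonormal frame is a parameter. It will be chosen with \<open>u\<close> pointing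
  from the centre to a vertex of the given triangle, so that no rigid motion has to be carried
  through perimeters and regions.\<close>

locale hex_frame =
  fixes u w :: "'a::euclidean_space"
  assumes uu: "u \<bullet> u = 1" and ww: "w \<bullet> w = 1" and uw: "u \<bullet> w = 0"
    and frame: "\<And>x. x = (x \<bullet> u) *\<^sub>R u + (x \<bullet> w) *\<^sub>R w"
begin

lemma wu: "w \<bullet> u = 0"
  using uw by (simp add: inner_commute)

definition dir :: "nat \<Rightarrow> 'a" where
  "dir k = hex_cos k *\<^sub>R u + hex_sin k *\<^sub>R w"

definition coord :: "nat \<Rightarrow> 'a \<Rightarrow> real" where
  "coord k x = hex_coord k (x \<bullet> u) (x \<bullet> w)"

definition tip_part :: "'a \<Rightarrow> real" where
  "tip_part x = (\<Sum>i\<in>{i\<in>{..<12}. even i}. coord i x)"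

definition reent_part :: "'a \<Rightarrow> real" where
  "reent_part x = (\<Sum>i\<in>{i\<in>{..<12}. odd i}. coord i x)"

text \<open>Using the sums \<open>reent_part\<close> and \<open>tip_part\<close> instead of the
  coordinates of one cone gives one formula for the whole plane. Away from its own two cones
  \<open>coord i\<close> is 0, and there the component vanishes as long as
  \<open>reent_part x < 1\<close>.\<close>

definition calib_comp :: "nat \<Rightarrow> 'a \<Rightarrow> real" where
  "calib_comp i x = (if even i then field_u (coord i x) (reent_part x) else field_w (tip_part x) (coord i x))"

definition calib :: "'a \<Rightarrow> 'a" where
  "calib x = (\<Sum>i<12. calib_comp i x *\<^sub>R dir i)"

text \<open>\<open>dual_tip j s\<close> and \<open>dual_reent k s\<close> are the basis dual to
  \<open>dir k\<close> and \<open>dir j\<close>; the factor 2 is the inverse of the sine of 30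
  degrees.\<close>

definition dual_tip :: "nat \<Rightarrow> real \<Rightarrow> 'a" where
  "dual_tip j s = (2 * s) *\<^sub>R (hex_sin j *\<^sub>R u - hex_cos j *\<^sub>R w)"

definition dual_reent :: "nat \<Rightarrow> real \<Rightarrow> 'a" where
  "dual_reent k s = (2 * s) *\<^sub>R (hex_cos k *\<^sub>R w - hex_sin k *\<^sub>R u)"

definition in_cone :: "nat \<Rightarrow> nat \<Rightarrow> real \<Rightarrow> 'a \<Rightarrow> bool" where
  "in_cone k j s x \<longleftrightarrow> (k, j, s) \<in> set hex_cones \<and> 0 \<le> x \<bullet> dual_tip j s \<and> 0 \<le> x \<bullet> dual_reent k s"

lemma inner_dual_tip: "x \<bullet> dual_tip j s = 2 * s * (hex_sin j * (x \<bullet> u) - hex_cos j * (x \<bullet> w))"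
  by (simp add: dual_tip_def inner_diff_right)

lemma inner_dual_reent: "x \<bullet> dual_reent k s = 2 * s * (hex_cos k * (x \<bullet> w) - hex_sin k * (x \<bullet> u))"
  by (simp add: dual_reent_def inner_diff_right)

lemma dir_u: "dir k \<bullet> u = hex_cos k" and dir_w: "dir k \<bullet> w = hex_sin k"
  by (simp_all add: dir_def inner_add_left uu ww uw wu)

lemma inner_dir: "x \<bullet> dir k = hex_cos k * (x \<bullet> u) + hex_sin k * (x \<bullet> w)"
  by (simp add: dir_def inner_add_right)

lemma frame_eqI: "x \<bullet> u = y \<bullet> u \<Longrightarrow> x \<bullet> w = y \<bullet> w \<Longrightarrow> x = y"
  using frame[of x] frame[of y] by simp

lemma dual_dir:
  assumes "(k, j, s) \<in> set hex_cones"
  shows "dir k \<bullet> dual_tip j s = 1" "dir j \<bullet> dual_tip j s = 0"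
    "dir k \<bullet> dual_reent k s = 0" "dir j \<bullet> dual_reent k s = 1"
    "dir k \<bullet> dir k = 1" "dir j \<bullet> dir j = 1" "dir k \<bullet> dir j = sqrt 3 / 2" "dir j \<bullet> dir k = sqrt 3 / 2"
proof -
  note c = hex_cones_cases[OF assms]
  have "s * s = 1" using c(6) by auto
  then have "2 * s * (hex_cos k * hex_sin j - hex_sin k * hex_cos j) = 1" unfolding c(10) by simp
  then show "dir k \<bullet> dual_tip j s = 1" "dir j \<bullet> dual_reent k s = 1"
    by (simp_all add: inner_dual_tip inner_dual_reent dir_u dir_w mult.commute)
  show "dir j \<bullet> dual_tip j s = 0" "dir k \<bullet> dual_reent k s = 0"
    by (simp_all add: inner_dual_tip inner_dual_reent dir_u dir_w mult.commute)
  show "dir k \<bullet> dir k = 1" "dir j \<bullet> dir j = 1"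
    using c(7,8) by (simp_all add: inner_dir dir_u dir_w power2_eq_square)
  show "dir k \<bullet> dir j = sqrt 3 / 2" "dir j \<bullet> dir k = sqrt 3 / 2"
    using c(9) by (simp_all add: inner_dir dir_u dir_w mult.commute)
qed

lemma cone_decomp:
  assumes "(k, j, s) \<in> set hex_cones"
  shows "x = (x \<bullet> dual_tip j s) *\<^sub>R dir k + (x \<bullet> dual_reent k s) *\<^sub>R dir j"
proof (rule frame_eqI)
  note c = hex_cones_cases[OF assms]
  have s: "s * s = 1" using c(6) by auto
  let ?X = "x \<bullet> u" and ?Y = "x \<bullet> w"
  have "2 * s * (hex_sin j * ?X - hex_cos j * ?Y) * hex_cos k + 2 * s * (hex_cos k * ?Y - hex_sin k * ?X) * hex_cos j
     = 2 * s * (hex_cos k * hex_sin j - hex_sin k * hex_cos j) * ?X" by (simp add: algebra_simps)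
  then show "x \<bullet> u = ((x \<bullet> dual_tip j s) *\<^sub>R dir k + (x \<bullet> dual_reent k s) *\<^sub>R dir j) \<bullet> u"
    unfolding c(10) using s by (simp add: inner_add_left dir_u inner_dual_tip inner_dual_reent)
  have "2 * s * (hex_sin j * ?X - hex_cos j * ?Y) * hex_sin k + 2 * s * (hex_cos k * ?Y - hex_sin k * ?X) * hex_sin j
     = 2 * s * (hex_cos k * hex_sin j - hex_sin k * hex_cos j) * ?Y" by (simp add: algebra_simps)
  then show "x \<bullet> w = ((x \<bullet> dual_tip j s) *\<^sub>R dir k + (x \<bullet> dual_reent k s) *\<^sub>R dir j) \<bullet> w"
    unfolding c(10) using s by (simp add: inner_add_left dir_w inner_dual_tip inner_dual_reent)
qed

lemma cone_exists: obtains k j s where "in_cone k j s x"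
  using hex_cover[of "x \<bullet> u" "x \<bullet> w"] unfolding in_cone_def inner_dual_tip inner_dual_reent by metis

lemma cone_coord:
  assumes "in_cone k j s x" "i < 12"
  shows "coord i x = (if i = k then x \<bullet> dual_tip j s else if i = j then x \<bullet> dual_reent k s else 0)"
proof -
  have c: "(k, j, s) \<in> set hex_cones" and pq: "0 \<le> x \<bullet> dual_tip j s" "0 \<le> x \<bullet> dual_reent k s"
    using assms unfolding in_cone_def by auto
  have "x \<bullet> u = (x \<bullet> dual_tip j s) * hex_cos k + (x \<bullet> dual_reent k s) * hex_cos j"
    "x \<bullet> w = (x \<bullet> dual_tip j s) * hex_sin k + (x \<bullet> dual_reent k s) * hex_sin j"
    by (subst cone_decomp[OF c], simp add: inner_add_left dir_u dir_w)+
  then show ?thesis unfolding coord_def using hex_coord_cone[OF c pq assms(2)] by simp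
qed

lemma cone_parts:
  assumes "in_cone k j s x"
  shows "tip_part x = x \<bullet> dual_tip j s" "reent_part x = x \<bullet> dual_reent k s"
proof -
  note c = hex_cones_cases[of k j s]
  have c: "k < 12" "j < 12" "even k" "odd j" using assms c unfolding in_cone_def by auto
  have "tip_part x = (\<Sum>i\<in>{i\<in>{..<12}. even i}. if i = k then x \<bullet> dual_tip j s else 0)"
    unfolding tip_part_def by (intro sum.cong) (use cone_coord[OF assms] c in auto)
  then show "tip_part x = x \<bullet> dual_tip j s" using c by simp
  have "reent_part x = (\<Sum>i\<in>{i\<in>{..<12}. odd i}. if i = j then x \<bullet> dual_reent k s else 0)"
    unfolding reent_part_def by (intro sum.cong) (use cone_coord[OF assms] c in auto)
  then show "reent_part x = x \<bullet> dual_reent k s" using c by simp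
qed

lemma parts_nonneg: "0 \<le> tip_part x" "0 \<le> reent_part x"
  by (rule cone_exists[of x]; simp add: cone_parts in_cone_def)+

lemma cone_comp:
  assumes "in_cone k j s x" "i < 12" "reent_part x < 1"
  shows "calib_comp i x = (if i = k then field_u (tip_part x) (reent_part x)
    else if i = j then field_w (tip_part x) (reent_part x) else 0)"
proof -
  have c: "even k" "odd j" using assms hex_cones_cases[of k j s] unfolding in_cone_def by auto
  show ?thesis using c assms(3) parts_nonneg[of x] cone_coord[OF assms(1,2)] cone_parts[OF assms(1)]
    unfolding calib_comp_def by (auto simp: field_u_0 field_w_0)
qed

lemma cone_calib:
  assumes "in_cone k j s x" "reent_part x < 1"
  shows "calib x = field_u (tip_part x) (reent_part x) *\<^sub>R dir k + field_w (tip_part x) (reent_part x) *\<^sub>R dir j"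
proof -
  have c: "k < 12" "j < 12" "k \<noteq> j" using assms hex_cones_cases[of k j s] unfolding in_cone_def by auto
  have "calib x = (\<Sum>i<12. (if i = k then field_u (tip_part x) (reent_part x) *\<^sub>R dir k else 0)
      + (if i = j then field_w (tip_part x) (reent_part x) *\<^sub>R dir j else 0))"
    unfolding calib_def by (intro sum.cong) (use cone_comp[OF assms(1) _ assms(2)] c in auto)
  then show ?thesis using c by (simp add: sum.distrib)
qed

definition dom :: "'a \<Rightarrow> bool" where
  "dom x \<longleftrightarrow> field_dom (tip_part x) (reent_part x)"

lemma norm_calib_le:
  assumes "dom x"
  shows "norm (calib x) \<le> 1"
proof -
  obtain k j s where c: "in_cone k j s x" by (rule cone_exists)
  then have c': "(k, j, s) \<in> set hex_cones" unfolding in_cone_def by simp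
  let ?U = "field_u (tip_part x) (reent_part x)" and ?W = "field_w (tip_part x) (reent_part x)"
  have "reent_part x < 1" using assms unfolding dom_def field_dom_def by simp
  note cal = cone_calib[OF c this]
  have "(norm (calib x))\<^sup>2 = ?U\<^sup>2 + ?W\<^sup>2 + sqrt 3 * ?U * ?W"
    unfolding cal power2_norm_eq_inner
    by (simp add: inner_add_left inner_add_right dual_dir[OF c'] power2_eq_square algebra_simps)
  also have "\<dots> \<le> 1" using field_norm assms unfolding dom_def by blast
  finally show ?thesis by (simp add: abs_square_le_1)
qed

lemma loc_lip_inner: "loc_lip (\<lambda>x. x \<bullet> v) (x::'a)"
  by (rule loc_lip_bounded_linear[OF bounded_linear_inner_left])

lemma loc_lip_coord: "loc_lip (coord k) x"
  unfolding coord_def hex_coord_def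
  by (intro loc_lip_mult loc_lip_max loc_lip_min loc_lip_add loc_lip_const loc_lip_inner)

lemma loc_lip_parts: "loc_lip tip_part x" "loc_lip reent_part x"
  unfolding tip_part_def reent_part_def by (intro loc_lip_sum loc_lip_coord)+

lemma loc_lip_comp:
  assumes "i < 12" "dom x"
  shows "loc_lip (calib_comp i) x"
proof -
  have r: "reent_part x < 1" using assms unfolding dom_def field_dom_def by simp
  show ?thesis
  proof (cases "even i")
    case True
    then show ?thesis unfolding calib_comp_def using r parts_nonneg
      by (simp add: loc_lip_field_u loc_lip_coord loc_lip_parts)
  next
    case False
    obtain k j s where c: "in_cone k j s x" by (rule cone_exists)
    have "coord i x \<le> reent_part x" "0 \<le> coord i x"
      using cone_coord[OF c assms(1)] cone_parts[OF c] parts_nonneg[of x] False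
        hex_cones_cases[of k j s] c unfolding in_cone_def by auto
    then show ?thesis unfolding calib_comp_def using r False
      by (simp add: loc_lip_field_w loc_lip_coord loc_lip_parts)
  qed
qed

lemma loc_lip_calib: "dom x \<Longrightarrow> loc_lip calib x"
  unfolding calib_def by (intro loc_lip_sum loc_lip_scaleR loc_lip_const) (auto intro: loc_lip_comp)

lemma continuous_on_parts [continuous_intros]:
  assumes "continuous_on S f"
  shows "continuous_on S (\<lambda>x. tip_part (f x))" "continuous_on S (\<lambda>x. reent_part (f x))"
  by (rule continuous_on_compose2[OF _ assms order_refl[THEN subset_trans, OF subset_UNIV]],
      auto intro!: continuous_at_imp_continuous_on loc_lip_isCont loc_lip_parts)+

lemma open_dom: "open {x. dom x}"
proof -
  have "{x. dom x} = {x. reent_part x < 1 \<and> (tip_part x < sqrt 3 * (1 - reent_part x)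
      \<or> 17/100 < tip_part x \<and> tip_part x < 2)}"
    unfolding dom_def field_dom_def using parts_nonneg by auto
  also have "open \<dots>"
    by (intro open_Collect_conj open_Collect_disj open_Collect_less continuous_intros)
  finally show ?thesis .
qed

lemma norm_le_parts: "norm x \<le> tip_part x + reent_part x"
proof -
  obtain k j s where c: "in_cone k j s x" by (rule cone_exists)
  then have c': "(k, j, s) \<in> set hex_cones" unfolding in_cone_def by simp
  have n: "norm (dir k) = 1" "norm (dir j) = 1" using dual_dir[OF c'] by (simp_all add: norm_eq_1)
  have "norm x \<le> norm (tip_part x *\<^sub>R dir k) + norm (reent_part x *\<^sub>R dir j)"
    using cone_decomp[OF c', of x] cone_parts[OF c] norm_triangle_ineq by metis
  then show ?thesis using n parts_nonneg[of x] by simp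
qed

lemma dom_norm: "dom x \<Longrightarrow> norm x \<le> 4"
proof -
  assume d: "dom x"
  then have r: "0 \<le> reent_part x" "reent_part x < 1" unfolding dom_def field_dom_def by auto
  have "sqrt 3 * (1 - reent_part x) \<le> sqrt 3 * 1" using r by (intro mult_left_mono) auto
  moreover have "tip_part x < sqrt 3 * (1 - reent_part x) \<or> tip_part x < 2"
    using d unfolding dom_def field_dom_def by auto
  ultimately have "tip_part x \<le> 2" using sqrt3_bounds by linarith
  then show ?thesis using norm_le_parts[of x] r by simp
qed

end

section \<open>Divergence of the global field\<close>

context hex_frame
begin

text \<open>These lines carry the boundaries of the cones and the kinks of the field; on the last
  one the two branches of \<open>bend\<close> meet.\<close>

definition generic :: "real \<Rightarrow> real \<Rightarrow> bool" where
  "generic p q \<longleftrightarrow> p \<noteq> 0 \<and> q \<noteq> 0 \<and> q \<noteq> q_tan \<and> q \<noteq> 1 - z_mid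
    \<and> 2 * sqrt 3 / 3 * p + q \<noteq> 1 \<and> p + 11 * sqrt 3 * q \<noteq> sqrt 3 + 10 * sqrt 3 * q_tan"

lemma negligible_cone_line:
  assumes l: "l \<noteq> 0" and ab: "a \<noteq> 0 \<or> b \<noteq> 0" and c: "(k, j, s) \<in> set hex_cones"
  shows "negligible {x. a * ((1 / l) *\<^sub>R (x - z) \<bullet> dual_tip j s) + b * ((1 / l) *\<^sub>R (x - z) \<bullet> dual_reent k s) = d}"
proof -
  define v where "v = a *\<^sub>R dual_tip j s + b *\<^sub>R dual_reent k s"
  have "dir k \<bullet> v = a" "dir j \<bullet> v = b"
    unfolding v_def by (simp_all add: inner_add_right dual_dir[OF c])
  then have "v \<noteq> 0" using ab by auto
  then have "negligible {x. v \<bullet> x = d * l + v \<bullet> z}" by (intro negligible_hyperplane) auto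
  moreover have "{x. a * ((1 / l) *\<^sub>R (x - z) \<bullet> dual_tip j s) + b * ((1 / l) *\<^sub>R (x - z) \<bullet> dual_reent k s) = d}
      \<subseteq> {x. v \<bullet> x = d * l + v \<bullet> z}"
  proof (intro subsetI CollectI, elim CollectE)
    fix x assume "a * ((1 / l) *\<^sub>R (x - z) \<bullet> dual_tip j s) + b * ((1 / l) *\<^sub>R (x - z) \<bullet> dual_reent k s) = d"
    then have "(1 / l) * (v \<bullet> (x - z)) = d"
      unfolding v_def by (simp add: inner_add_left inner_commute algebra_simps)
    then show "v \<bullet> x = d * l + v \<bullet> z" using l by (simp add: field_simps inner_diff_right)
  qed
  ultimately show ?thesis by (rule negligible_subset)
qed

lemma AE_generic:
  assumes l: "l \<noteq> 0"
  shows "AE x in lebesgue. \<forall>k j s. in_cone k j s ((1 / l) *\<^sub>R (x - z)) \<longrightarrow>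
    generic ((1 / l) *\<^sub>R (x - z) \<bullet> dual_tip j s) ((1 / l) *\<^sub>R (x - z) \<bullet> dual_reent k s)"
proof -
  define lines :: "(real \<times> real \<times> real) set" where
    "lines = {(1, 0, 0), (0, 1, 0), (0, 1, q_tan), (0, 1, 1 - z_mid), (2 * sqrt 3 / 3, 1, 1),
      (1, 11 * sqrt 3, sqrt 3 + 10 * sqrt 3 * q_tan)}"
  define N where "N = (\<Union>(k, j, s)\<in>set hex_cones. \<Union>(a, b, d)\<in>lines.
    {x. a * ((1 / l) *\<^sub>R (x - z) \<bullet> dual_tip j s) + b * ((1 / l) *\<^sub>R (x - z) \<bullet> dual_reent k s) = d})"
  have "negligible N" unfolding N_def
  proof (intro negligible_Union finite_imageI)
    fix A assume "A \<in> (\<lambda>(k, j, s). \<Union>(a, b, d)\<in>lines.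
      {x. a * ((1 / l) *\<^sub>R (x - z) \<bullet> dual_tip j s) + b * ((1 / l) *\<^sub>R (x - z) \<bullet> dual_reent k s) = d}) ` set hex_cones"
    then obtain k j s where c: "(k, j, s) \<in> set hex_cones" and A: "A = (\<Union>(a, b, d)\<in>lines.
      {x. a * ((1 / l) *\<^sub>R (x - z) \<bullet> dual_tip j s) + b * ((1 / l) *\<^sub>R (x - z) \<bullet> dual_reent k s) = d})"
      by auto
    show "negligible A" unfolding A
    proof (intro negligible_Union finite_imageI)
      show "finite lines" by (simp add: lines_def)
      fix B assume "B \<in> (\<lambda>(a, b, d). {x. a * ((1 / l) *\<^sub>R (x - z) \<bullet> dual_tip j s)
        + b * ((1 / l) *\<^sub>R (x - z) \<bullet> dual_reent k s) = d}) ` lines"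
      then obtain a b d where abd: "(a, b, d) \<in> lines" and B: "B = {x. a * ((1 / l) *\<^sub>R (x - z) \<bullet> dual_tip j s)
        + b * ((1 / l) *\<^sub>R (x - z) \<bullet> dual_reent k s) = d}" by auto
      have "a \<noteq> 0 \<or> b \<noteq> 0" using abd unfolding lines_def by auto
      then show "negligible B" unfolding B by (rule negligible_cone_line[OF l _ c])
    qed
  qed simp
  then have "N \<in> null_sets lebesgue" by (simp add: negligible_iff_null_sets)
  then have "AE x in lebesgue. x \<notin> N" by (rule AE_not_in)
  then show ?thesis
  proof eventually_elim
    case (elim x)
    show ?case
    proof (intro allI impI)
      fix k j s assume "in_cone k j s ((1 / l) *\<^sub>R (x - z))"
      then have "(k, j, s) \<in> set hex_cones" unfolding in_cone_def by simp
      then have "\<forall>(a, b, d)\<in>lines. a * ((1 / l) *\<^sub>R (x - z) \<bullet> dual_tip j s) + b * ((1 / l) *\<^sub>R (x - z) \<bullet> dual_reent k s) \<noteq> d"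
        using elim unfolding N_def by fastforce
      then show "generic ((1 / l) *\<^sub>R (x - z) \<bullet> dual_tip j s) ((1 / l) *\<^sub>R (x - z) \<bullet> dual_reent k s)"
        unfolding lines_def generic_def by simp
    qed
  qed
qed

text \<open>The field is the sum of \<open>calib_comp i\<close> times \<open>dir i\<close>, so its
  divergence is the sum of the derivatives of the components, each along its own direction. Moving
  along \<open>dir k\<close> changes only the first coordinate of the cone, and along
  \<open>dir j\<close> only the second; the other components are 0 nearby.\<close>

lemma comp_directional_derivatives:
  assumes c: "in_cone k j s y" and g: "generic (y \<bullet> dual_tip j s) (y \<bullet> dual_reent k s)" and d: "dom y"
  obtains b1 b2 where "b1 + b2 = h0"
    "\<And>i. i < 12 \<Longrightarrow> ((\<lambda>t. calib_comp i (y + t *\<^sub>R dir i)) has_real_derivative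
      (if i = k then b1 else if i = j then b2 else 0)) (at 0)"
proof -
  have c': "(k, j, s) \<in> set hex_cones" using c unfolding in_cone_def by simp
  note cc = hex_cones_cases[OF c']
  define p where "p = y \<bullet> dual_tip j s"
  define q where "q = y \<bullet> dual_reent k s"
  have pq: "p > 0" "q > 0" using c g unfolding in_cone_def generic_def p_def q_def by auto
  have fd: "field_dom p q" using d cone_parts[OF c] unfolding dom_def p_def q_def by simp
  then have q1: "q < 1" unfolding field_dom_def by simp
  have gen: "q \<noteq> q_tan" "1 - q \<noteq> z_mid" "p \<noteq> 0" "2 * sqrt 3 / 3 * p \<noteq> 1 - q"
    "sqrt 3 * (1 - q) - p \<noteq> 10 * sqrt 3 * (q - q_tan)"
    using g unfolding generic_def p_def[symmetric] q_def[symmetric] by (auto simp: algebra_simps)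
  obtain b1 b2 where b: "((\<lambda>t. field_u (p + t) q) has_real_derivative b1) (at 0)"
    "((\<lambda>t. field_w p (q + t)) has_real_derivative b2) (at 0)" "b1 + b2 = h0"
    using field_divergence[OF fd gen] by blast
  have "((\<lambda>t. calib_comp i (y + t *\<^sub>R dir i)) has_real_derivative
      (if i = k then b1 else if i = j then b2 else 0)) (at 0)" if i: "i < 12" for i
  proof -
    define S where "S = {t. 0 < p + t * (dir i \<bullet> dual_tip j s) \<and> 0 < q + t * (dir i \<bullet> dual_reent k s)
      \<and> q + t * (dir i \<bullet> dual_reent k s) < 1}"
    have S: "open S" "0 \<in> S" unfolding S_def
      by (intro open_Collect_conj open_Collect_less continuous_intros) (use pq q1 in auto)
    define F where "F t = (if i = k then field_u (p + t) q else if i = j then field_w p (q + t) else 0)" for t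
    have F: "F t = calib_comp i (y + t *\<^sub>R dir i)" if t: "t \<in> S" for t
    proof -
      have t': "(y + t *\<^sub>R dir i) \<bullet> dual_tip j s = p + t * (dir i \<bullet> dual_tip j s)"
        "(y + t *\<^sub>R dir i) \<bullet> dual_reent k s = q + t * (dir i \<bullet> dual_reent k s)"
        by (simp_all add: inner_add_left p_def q_def)
      have ct: "in_cone k j s (y + t *\<^sub>R dir i)"
        unfolding in_cone_def t' using t c' unfolding S_def by auto
      have "reent_part (y + t *\<^sub>R dir i) < 1"
        unfolding cone_parts[OF ct] t' using t unfolding S_def by auto
      from cone_comp[OF ct i this] show ?thesis
        unfolding cone_parts[OF ct] t' F_def using cc(5) by (auto simp: dual_dir[OF c'])
    qed
    have "(F has_real_derivative (if i = k then b1 else if i = j then b2 else 0)) (at 0)"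
      unfolding F_def using b by auto
    then show ?thesis
      by (rule has_field_derivative_transform_within_open[OF _ S(1) S(2)]) (use F in auto)
  qed
  then show ?thesis using that b(3) by blast
qed

text \<open>The field dilated by \<open>l\<close> about \<open>z\<close>, with divergence
  \<open>h0 / l\<close>. Extension by 0 makes it a bounded Borel field on the whole space.\<close>

definition calib_at :: "real \<Rightarrow> 'a \<Rightarrow> 'a \<Rightarrow> 'a" where
  "calib_at l z x = (if dom ((1 / l) *\<^sub>R (x - z)) then calib ((1 / l) *\<^sub>R (x - z)) else 0)"

lemma norm_calib_at_le: "norm (calib_at l z x) \<le> 1"
  unfolding calib_at_def using norm_calib_le by auto

lemma loc_lip_affine: "loc_lip (\<lambda>x. c *\<^sub>R (x - z)) (x::'a)"
  by (intro loc_lip_scaleR loc_lip_diff loc_lip_const loc_lip_ident)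

lemma open_dom_at: "open {x. dom ((1 / l) *\<^sub>R (x - z))}"
  using open_vimage[OF open_dom, of "\<lambda>x. (1 / l) *\<^sub>R (x - z)"]
  by (simp add: vimage_def continuous_intros)

lemma calib_at_measurable [measurable]: "calib_at l z \<in> borel_measurable borel"
proof -
  have "continuous_on {x. dom ((1 / l) *\<^sub>R (x - z))} (\<lambda>x. calib ((1 / l) *\<^sub>R (x - z)))"
    by (intro continuous_at_imp_continuous_on ballI loc_lip_isCont loc_lip_compose[OF loc_lip_affine] loc_lip_calib) simp
  then have "(\<lambda>x. indicator {x. dom ((1 / l) *\<^sub>R (x - z))} x *\<^sub>R calib ((1 / l) *\<^sub>R (x - z))) \<in> borel_measurable borel"
    by (intro borel_measurable_continuous_on_indicator borel_open open_dom_at)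
  also have "(\<lambda>x. indicator {x. dom ((1 / l) *\<^sub>R (x - z))} x *\<^sub>R calib ((1 / l) *\<^sub>R (x - z))) = calib_at l z"
    by (auto simp: calib_at_def indicator_def fun_eq_iff)
  finally show ?thesis .
qed

lemma calib_at_supp:
  assumes "l > 0" "norm x > 4 * l + norm z"
  shows "calib_at l z x = 0"
proof -
  have "norm ((1 / l) *\<^sub>R (x - z)) > 4"
    using assms norm_triangle_ineq2[of x z] by (simp add: pos_less_divide_eq del: scaleR_right_diff_distrib)
  then show ?thesis unfolding calib_at_def using dom_norm by fastforce
qed

text \<open>The gradient is required only almost everywhere, since the lemma serves both the
  mollifying kernel and the cut-off of the rounded hexagram. The products of \<open>g\<close> with
  the components are locally Lipschitz everywhere: at points where the field is not defined,
  \<open>g\<close> vanishes nearby.\<close>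

lemma weak_divergence:
  assumes l: "l > 0" and g: "\<And>x. loc_lip g x" and supp: "\<And>x. norm x > R \<Longrightarrow> g x = 0"
    and dz: "\<And>x. dom ((1 / l) *\<^sub>R (x - z)) \<or> eventually (\<lambda>y. g y = 0) (nhds x)"
    and d: "AE x in lebesgue. (g has_derivative (\<lambda>v. gr x \<bullet> v)) (at x)"
    and m: "gr \<in> borel_measurable lebesgue"
  shows "integrable lebesgue (\<lambda>x. calib_at l z x \<bullet> gr x + h0 / l * g x)"
    "(LINT x|lebesgue. calib_at l z x \<bullet> gr x + h0 / l * g x) = 0"
proof -
  let ?y = "\<lambda>x. (1 / l) *\<^sub>R (x - z)"
  define G where "G i x = g x * calib_comp i (?y x)" for i x
  have "continuous_on UNIV g" using g by (intro continuous_at_imp_continuous_on ballI loc_lip_isCont)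
  then have gm: "g \<in> borel_measurable lebesgue" 
    by (intro measurable_completion) (auto intro: borel_measurable_continuous_onI)
  have cm: "calib_at l z \<in> borel_measurable lebesgue" by (intro measurable_completion) auto
  have lm: "(\<lambda>x. calib_at l z x \<bullet> gr x + h0 / l * g x) \<in> borel_measurable lebesgue"
    using gm cm m by measurable
  have GL: "loc_lip (G i) x" if i: "i \<in> {..<12}" for i x
  proof (cases "dom (?y x)")
    case True
    then show ?thesis unfolding G_def using i
      by (intro loc_lip_mult g loc_lip_compose[OF loc_lip_affine] loc_lip_comp) auto
  next
    case False
    then have "eventually (\<lambda>y. G i y = 0) (nhds x)"
      using dz[of x] unfolding G_def by (auto elim: eventually_mono)
    then show ?thesis by (rule loc_lip_transform[OF loc_lip_const])
  qed
  have ae: "AE x in lebesgue. \<exists>D. (\<forall>i\<in>{..<12}. ((\<lambda>t. G i (x + t *\<^sub>R dir i)) has_real_derivative D i) (at 0))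
      \<and> calib_at l z x \<bullet> gr x + h0 / l * g x = (\<Sum>i<12. D i)"
    using AE_generic[OF less_imp_neq[OF l, symmetric], of z] d
  proof eventually_elim
    case (elim x)
    show ?case
    proof (cases "dom (?y x)")
      case False
      then have ev: "eventually (\<lambda>y. g y = 0) (nhds x)" using dz[of x] by simp
      have "((\<lambda>t. G i (x + t *\<^sub>R dir i)) has_real_derivative 0) (at 0)" for i
      proof -
        obtain S where S: "open S" "x \<in> S" "\<And>y. y \<in> S \<Longrightarrow> g y = 0"
          using ev unfolding eventually_nhds by blast
        have "open ((\<lambda>t. x + t *\<^sub>R dir i) -` S)"
          by (intro open_vimage S continuous_intros)
        moreover have "((\<lambda>t::real. 0::real) has_real_derivative 0) (at 0)" by simp
        ultimately show ?thesis
          by (elim has_field_derivative_transform_within_open) (use S in \<open>auto simp: G_def\<close>)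
      qed
      moreover have "g x = 0" using ev by (rule eventually_nhds_x_imp_x)
      ultimately show ?thesis using False by (intro exI[of _ "\<lambda>_. 0"]) (auto simp: calib_at_def)
    next
      case True
      obtain k j s where c: "in_cone k j s (?y x)" by (rule cone_exists)
      have gen: "generic (?y x \<bullet> dual_tip j s) (?y x \<bullet> dual_reent k s)"
        using elim(1) c by simp
      obtain b1 b2 where b: "b1 + b2 = h0"
        "\<And>i. i < 12 \<Longrightarrow> ((\<lambda>t. calib_comp i (?y x + t *\<^sub>R dir i)) has_real_derivative
          (if i = k then b1 else if i = j then b2 else 0)) (at 0)"
        by (rule comp_directional_derivatives[OF c gen True]) blast
      have kj: "k < 12" "j < 12" "k \<noteq> j" using c hex_cones_cases[of k j s] unfolding in_cone_def by auto
      define B where "B i = (if i = k then b1 else if i = j then b2 else 0)" for i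
      have "((\<lambda>t. G i (x + t *\<^sub>R dir i)) has_real_derivative (gr x \<bullet> dir i) * calib_comp i (?y x) + B i / l * g x) (at 0)"
        if i: "i < 12" for i
      proof -
        have 1: "((\<lambda>t. g (x + t *\<^sub>R dir i)) has_real_derivative gr x \<bullet> dir i) (at 0)"
        proof -
          have l: "((\<lambda>t. x + t *\<^sub>R dir i) has_derivative (\<lambda>t. t *\<^sub>R dir i)) (at 0)"
            by (auto intro!: derivative_eq_intros)
          have "(g has_derivative (\<lambda>v. gr x \<bullet> v)) (at (x + 0 *\<^sub>R dir i))" using elim(2) by simp
          from diff_chain_at[OF l this] show ?thesis
            by (intro has_derivative_imp_has_field_derivative[where D = "\<lambda>t. t * (gr x \<bullet> dir i)"])
              (simp_all add: o_def)
        qed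
        have "((\<lambda>t. calib_comp i (?y x + t *\<^sub>R dir i)) has_real_derivative B i) (at (0 / l))"
          using b(2)[OF i] unfolding B_def by simp
        then have "((\<lambda>t. calib_comp i (?y x + (t / l) *\<^sub>R dir i)) has_real_derivative B i * (1 / l)) (at 0)"
          by (rule DERIV_chain2) (use \<open>l > 0\<close> in \<open>auto intro!: derivative_eq_intros\<close>)
        then have 2: "((\<lambda>t. calib_comp i (?y (x + t *\<^sub>R dir i))) has_real_derivative B i * (1 / l)) (at 0)"
          by (simp add: algebra_simps)
        show ?thesis unfolding G_def using DERIV_mult[OF 1 2] by (simp add: algebra_simps)
      qed
      moreover have "(\<Sum>i<12. (gr x \<bullet> dir i) * calib_comp i (?y x) + B i / l * g x)
          = calib_at l z x \<bullet> gr x + h0 / l * g x"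
      proof -
        have "(\<Sum>i<12. B i) = (\<Sum>i<12. (if i = k then b1 else 0) + (if i = j then b2 else 0))"
          unfolding B_def using kj by (intro sum.cong) auto
        also have "\<dots> = h0" using kj b(1) by (simp add: sum.distrib)
        finally have "(\<Sum>i<12. B i / l * g x) = h0 / l * g x"
          by (simp add: sum_distrib_right[symmetric] sum_divide_distrib[symmetric])
        moreover have "(\<Sum>i<12. (gr x \<bullet> dir i) * calib_comp i (?y x)) = calib_at l z x \<bullet> gr x"
          using True by (simp add: calib_at_def calib_def inner_commute[of _ "gr x"] inner_sum_right mult.commute)
        ultimately show ?thesis by (simp add: sum.distrib)
      qed
      ultimately show ?thesis
        by (intro exI[of _ "\<lambda>i. (gr x \<bullet> dir i) * calib_comp i (?y x) + B i / l * g x"]) auto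
    qed
  qed
  have Gs: "G i x = 0" if "norm x > R" for i x using supp that unfolding G_def by simp
  show "integrable lebesgue (\<lambda>x. calib_at l z x \<bullet> gr x + h0 / l * g x)"
    "(LINT x|lebesgue. calib_at l z x \<bullet> gr x + h0 / l * g x) = 0"
    using integral_sum_directional_derivatives[where I = "{..<12::nat}" and g = G and v = dir and R = R, OF _ GL Gs lm ae]
    by auto
qed

end

section \<open>The lower bound for perimeters\<close>

lemma has_derivative_bump: "(bump e has_derivative (\<lambda>v. bump_grad e z \<bullet> v)) (at z)"
  unfolding has_derivative_at_alt
proof (intro conjI allI impI)
  show "bounded_linear (\<lambda>v. bump_grad e z \<bullet> v)" by (rule bounded_linear_inner_right)
  fix \<epsilon> :: real assume \<epsilon>: "\<epsilon> > 0"
  define K where "K = (2 * norm z + 1)\<^sup>2 + 2 * e\<^sup>2"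
  have K: "K > 0" 
  proof -
    have "0 < 2 * norm z + 1" using norm_ge_zero[of z] by linarith
    then show ?thesis unfolding K_def by (simp add: add_pos_nonneg)
  qed
  have "norm (bump e y - bump e z - bump_grad e z \<bullet> (y - z)) \<le> \<epsilon> * norm (y - z)"
    if y: "norm (y - z) < min 1 (\<epsilon> / K)" for y
  proof -
    have "norm (bump e y - bump e z - bump_grad e z \<bullet> (y - z)) \<le> K * (norm (y - z))\<^sup>2"
      using bump_remainder[of "y - z" z "norm z" e] y unfolding K_def by simp
    also have "\<dots> = (K * norm (y - z)) * norm (y - z)" by (simp add: power2_eq_square)
    also have "\<dots> \<le> \<epsilon> * norm (y - z)" using y K by (intro mult_right_mono) (auto simp: field_simps)
    finally show ?thesis .
  qed
  then show "\<exists>d>0. \<forall>y. norm (y - z) < d \<longrightarrow> norm (bump e y - bump e z - bump_grad e z \<bullet> (y - z)) \<le> \<epsilon> * norm (y - z)"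
    using \<epsilon> K by (intro exI[of _ "min 1 (\<epsilon> / K)"]) auto
qed

lemma loc_lip_norm: "loc_lip f x \<Longrightarrow> loc_lip (\<lambda>y. norm (f y)) x"
proof (rule loc_lip_compose[of f x norm])
  show "loc_lip norm (f x)"
    by (rule loc_lip_lipschitz[of 1], rule lipschitz_onI) (auto simp: dist_norm norm_triangle_ineq3)
qed

lemma loc_lip_bump: "loc_lip f x \<Longrightarrow> loc_lip (\<lambda>y. bump e (f y)) x"
  unfolding bump_def by (intro loc_lip_power loc_lip_max loc_lip_diff loc_lip_const loc_lip_norm)

context hex_frame
begin

text \<open>A compact set around all regions in question: the closed hexagram and, about the tip
  axes, strips of half-width 1/2. The value sqrt 3 / 9 is the least \<open>tip_part\<close> on the
  triangles attached at steps 3 and 4.\<close>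

definition hull_dom :: "'a \<Rightarrow> bool" where
  "hull_dom y \<longleftrightarrow> sqrt 3 / 3 * tip_part y + reent_part y \<le> 1
     \<or> sqrt 3 / 9 \<le> tip_part y \<and> reent_part y \<le> 1 \<and> tip_part y \<le> sqrt 3"

lemma parts_scale:
  assumes "0 \<le> c"
  shows "tip_part (c *\<^sub>R x) = c * tip_part x" "reent_part (c *\<^sub>R x) = c * reent_part x"
proof -
  obtain k j s where k: "in_cone k j s x" by (rule cone_exists)
  then have "in_cone k j s (c *\<^sub>R x)" using assms unfolding in_cone_def by auto
  then show "tip_part (c *\<^sub>R x) = c * tip_part x" "reent_part (c *\<^sub>R x) = c * reent_part x"
    by (simp_all add: cone_parts[OF k] cone_parts)
qed

lemma hull_dom_scale:
  assumes "hull_dom y" and l: "1 < l" "l < 11/10"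
  shows "dom ((1 / l) *\<^sub>R y)"
proof -
  define p q where "p = tip_part y" and "q = reent_part y"
  have pq: "0 \<le> p" "0 \<le> q" unfolding p_def q_def by (rule parts_nonneg)+
  have "field_dom (p / l) (q / l)"
  proof (cases "sqrt 3 / 3 * p + q \<le> 1")
    case True
    have "sqrt 3 * (sqrt 3 / 3 * p + q) \<le> sqrt 3 * 1" using True by (intro mult_left_mono) auto
    then have "p + sqrt 3 * q \<le> sqrt 3" by (simp add: distrib_left sqrt3_mult)
    also have "\<dots> < sqrt 3 * l" using l by simp
    finally have "p / l < sqrt 3 * (1 - q / l)" using l by (simp add: field_simps)
    moreover have "0 \<le> sqrt 3 / 3 * p" using pq by simp
    then have "q \<le> 1" using True by linarith
    then have "q / l < 1" using l by simp
    ultimately show ?thesis unfolding field_dom_def using pq l by auto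
  next
    case False
    then have h: "sqrt 3 / 9 \<le> p" "q \<le> 1" "p \<le> sqrt 3" using assms(1) unfolding hull_dom_def p_def q_def by auto
    \<comment> \<open>This rests on 187/1000 < sqrt 3 / 9, hence the bound 11/10 on
      \<open>l\<close>.\<close>
    have "17/100 * l < p" using l h sqrt3_bounds by linarith
    then show ?thesis unfolding field_dom_def using pq l h sqrt3_bounds by (auto simp: field_simps)
  qed
  then show ?thesis unfolding dom_def p_def q_def using l parts_scale[of "1 / l" y] by simp
qed

lemma compact_hull_dom: "compact {x. hull_dom (x - z)}"
proof -
  have "closed {x. hull_dom (x - z)}" unfolding hull_dom_def
    by (intro closed_Collect_disj closed_Collect_conj closed_Collect_le continuous_intros)
  moreover have "norm (x - z) \<le> 3" if "hull_dom (x - z)" for x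
  proof -
    have "tip_part (x - z) \<le> sqrt 3 \<and> reent_part (x - z) \<le> 1"
    proof (cases "sqrt 3 / 3 * tip_part (x - z) + reent_part (x - z) \<le> 1")
      case True
      have nn: "0 \<le> sqrt 3 / 3 * tip_part (x - z)" "0 \<le> reent_part (x - z)"
        using parts_nonneg[of "x - z"] by auto
      then have "sqrt 3 * (sqrt 3 / 3 * tip_part (x - z)) \<le> sqrt 3 * 1"
        using True by (intro mult_left_mono) auto
      moreover have "sqrt 3 * (sqrt 3 / 3 * tip_part (x - z)) = tip_part (x - z)"
        by (simp add: sqrt3_mult)
      ultimately have "tip_part (x - z) \<le> sqrt 3" by linarith
      then show ?thesis using True nn by linarith
    qed (use that in \<open>auto simp: hull_dom_def\<close>)
    then show ?thesis using norm_le_parts[of "x - z"] sqrt3_bounds by linarith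
  qed
  then have "{x. hull_dom (x - z)} \<subseteq> cball z 3" by (auto simp: dist_norm norm_minus_commute)
  then have "bounded {x. hull_dom (x - z)}" using bounded_cball bounded_subset by blast
  ultimately show ?thesis using compact_eq_bounded_closed by blast
qed

lemma perimeter_ge_scaled:
  assumes F: "F \<in> lmeasurable" "F \<subseteq> {x. hull_dom (x - z)}" and l: "1 < l" "l < 11/10"
  shows "ereal (h0 / l * measure lebesgue F) \<le> perimeter F"
proof -
  have "{x. hull_dom (x - z)} \<subseteq> {x. dom ((1 / l) *\<^sub>R (x - z))}" using hull_dom_scale l by blast
  \<comment> \<open>The mollification radius: every kernel centred in the hull is supported in the
    domain of the field.\<close>
  then obtain e where e: "e > 0" "(\<Union>x\<in>{x. hull_dom (x - z)}. cball x e) \<subseteq> {x. dom ((1 / l) *\<^sub>R (x - z))}"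
    using compact_subset_open_imp_cball_epsilon_subset[OF compact_hull_dom open_dom_at] by blast
  have "(LINT y|lebesgue. bump_grad e (x - y) \<bullet> calib_at l z y) = h0 / l * (LINT y|lebesgue. bump e (y::'a))"
    if x: "x \<in> F" for x
  proof -
    let ?g = "\<lambda>y. bump e (x - y)" and ?gr = "\<lambda>y. - bump_grad e (x - y)"
    have 1: "loc_lip ?g y" for y by (intro loc_lip_bump loc_lip_diff loc_lip_const loc_lip_ident)
    have 2: "?g y = 0" if "norm y > norm x + e" for y
      using that norm_triangle_ineq2[of y x] by (intro bump_zero[OF e(1)]) (simp add: norm_minus_commute)
    have 3: "dom ((1 / l) *\<^sub>R (y - z)) \<or> eventually (\<lambda>y. ?g y = 0) (nhds y)" for y
    proof (cases "y \<in> cball x e")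
      case True
      then show ?thesis using x F(2) e(2) by blast
    next
      case False
      have "eventually (\<lambda>y. y \<in> - cball x e) (nhds y)"
        using False by (intro eventually_nhds_in_open) auto
      then have "eventually (\<lambda>y. ?g y = 0) (nhds y)"
        by eventually_elim (auto intro!: bump_zero[OF e(1)] simp: dist_norm)
      then show ?thesis by simp
    qed
    have 4: "(?g has_derivative (\<lambda>v. ?gr y \<bullet> v)) (at y)" for y
    proof -
      have "((\<lambda>y. x - y) has_derivative (\<lambda>v. - v)) (at y)" by (auto intro!: derivative_eq_intros)
      from diff_chain_at[OF this has_derivative_bump] show ?thesis by (simp add: o_def)
    qed
    have "continuous_on UNIV ?gr" by (intro continuous_intros)
    then have 5: "?gr \<in> borel_measurable lebesgue"
      by (intro measurable_completion) (auto intro: borel_measurable_continuous_onI)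
    have l0: "l > 0" using l by simp
    note wd = weak_divergence[OF l0 1 2 3 AE_I2[OF 4] 5]
    have ig: "integrable lebesgue ?g"
      using 1 loc_lip_isCont 2
      by (intro integrable_lebesgue_continuous_bounded_support[of _ "norm x + e"] continuous_at_imp_continuous_on) auto
    have "integrable lebesgue (\<lambda>y. (calib_at l z y \<bullet> ?gr y + h0 / l * ?g y) - h0 / l * ?g y)"
      using wd(1) ig by (intro Bochner_Integration.integrable_diff integrable_mult_right) auto
    then have ic: "integrable lebesgue (\<lambda>y. calib_at l z y \<bullet> ?gr y)" by simp
    have "(LINT y|lebesgue. calib_at l z y \<bullet> ?gr y) + h0 / l * (LINT y|lebesgue. ?g y) = 0"
      using wd(2) ic ig by simp
    moreover have "(LINT y|lebesgue. calib_at l z y \<bullet> ?gr y) = - (LINT y|lebesgue. bump_grad e (x - y) \<bullet> calib_at l z y)"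
      by (simp add: inner_commute)
    ultimately show ?thesis by (simp add: integral_bump_shift)
  qed
  moreover have "calib_at l z x = 0" if "norm x > 4 * l + norm z" for x
    using calib_at_supp that l by simp
  ultimately show ?thesis
    by (intro perimeter_ge_weak_divergence[OF calib_at_measurable norm_calib_at_le _ e(1) F(1)]) auto
qed

lemma perimeter_ge:
  assumes F: "F \<in> lmeasurable" "F \<subseteq> {x. hull_dom (x - z)}"
  shows "ereal (h0 * measure lebesgue F) \<le> perimeter F"
proof (rule LIMSEQ_le_const2)
  \<comment> \<open>At most 1 + 1/21, hence below 11/10.\<close>
  define L where "L n = 1 + inverse (real (Suc (n + 20)))" for n
  have "(\<lambda>n. inverse (real (Suc (n + 20)))) \<longlonglongrightarrow> 0"
    by (rule LIMSEQ_ignore_initial_segment[OF LIMSEQ_inverse_real_of_nat])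
  then have "L \<longlonglongrightarrow> 1 + 0" unfolding L_def by (intro tendsto_add tendsto_const)
  then have "(\<lambda>n. h0 / L n * measure lebesgue F) \<longlonglongrightarrow> h0 / 1 * measure lebesgue F"
    by (intro tendsto_intros) auto
  then show "(\<lambda>n. ereal (h0 / L n * measure lebesgue F)) \<longlonglongrightarrow> ereal (h0 * measure lebesgue F)"
    by (intro tendsto_ereal) simp
  have "1 < L n \<and> L n < 11/10" for n
    unfolding L_def by (auto simp: field_simps)
  then show "\<exists>N. \<forall>n\<ge>N. ereal (h0 / L n * measure lebesgue F) \<le> perimeter F"
    using perimeter_ge_scaled[OF F] by blast
qed

end

text \<open>Coordinates along and across the side of the hexagram, relative to the centre of the rounding arc.\<close>

definition arc_a :: "real \<Rightarrow> real \<Rightarrow> real" where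
  "arc_a p q = sqrt 3 / 2 * p - (1 - q) / 2 - z_tan"

definition arc_b :: "real \<Rightarrow> real \<Rightarrow> real" where
  "arc_b p q = r0 - sqrt 3 / 2 * (1 - q) + p / 2"

text \<open>On the tip side of the point of tangency this is the squared distance to the centre of
  the arc; on the other side it depends only on the distance to the side. Its level sets consist of
  arcs and segments parallel to the boundary of E. Squares of positive parts make it C^1 within a
  cone.\<close>

definition arc_sq :: "real \<Rightarrow> real \<Rightarrow> real" where
  "arc_sq p q = (max 0 (arc_a p q))\<^sup>2 + (max 0 (arc_b p q))\<^sup>2"

section \<open>The field along curves parallel to the boundary of E\<close>

lemma arc_b_le:
  assumes "arc_sq p q < R\<^sup>2" "0 \<le> R"
  shows "arc_b p q < R"
proof -
  have "(max 0 (arc_b p q))\<^sup>2 < R\<^sup>2" using assms(1) unfolding arc_sq_def by (smt (verit) zero_le_power2)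
  then have "max 0 (arc_b p q) < R" using assms(2) by (rule power2_less_imp_less)
  then show ?thesis by simp
qed

lemma arc_b_inside: "arc_b p q < r0 \<Longrightarrow> p < sqrt 3 * (1 - q)"
  by (simp add: arc_b_def)

text \<open>Half the gradient of \<open>arc_sq\<close> has components \<open>max 0 a\<close> along
  the side and \<open>max 0 b\<close> along its normal, and norm \<open>sqrt (arc_sq p q)\<close>.
  So the second alternative says that the norm of this vector exceeds its inner product with the
  field by at most 2 e. The first alternative is a neighbourhood of the reentrant corner, where the
  normal of the boundary jumps.\<close>

lemma strip_estimate:
  assumes p: "0 \<le> p" and q: "0 \<le> q" and e: "0 < e" "e \<le> 1/1000"
    and n: "(r0 - 2 * e)\<^sup>2 < arc_sq p q" "arc_sq p q < (r0 - e)\<^sup>2"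
  defines "U \<equiv> field_u p q" and "W \<equiv> field_w p q"
  shows "(p \<le> 5 * e \<and> 0 \<le> 1 - q \<and> 1 - q \<le> 5 * e) \<or>
    sqrt (arc_sq p q) - (max 0 (arc_a p q) * (sqrt 3 / 2 * U + W / 2) + max 0 (arc_b p q) * (U / 2 + sqrt 3 / 2 * W)) \<le> 2 * e"
proof -
  define a where "a = arc_a p q"
  define b where "b = arc_b p q"
  define t where "t = r0 - b"
  define N where "N = sqrt (arc_sq p q)"
  have re: "0 \<le> r0 - e" "0 \<le> r0 - 2 * e" using radius_bounds e by auto
  have N: "r0 - 2 * e < N" "N < r0 - e" unfolding N_def
    using n re by (auto intro: real_less_rsqrt real_less_lsqrt)
  have N2: "N\<^sup>2 = (max 0 a)\<^sup>2 + (max 0 b)\<^sup>2" unfolding N_def arc_sq_def a_def b_def by simp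
  have N0: "N > 0" using N re by simp
  have b: "b < r0 - e" unfolding b_def by (rule arc_b_le[OF n(2) re(1)])
  have xi: "sqrt 3 * (1 - q) - p = 2 * t" unfolding t_def b_def arc_b_def by simp
  have pq: "p < sqrt 3 * (1 - q)" using b e xi unfolding t_def by simp
  have z: "0 < 1 - q"
  proof (rule ccontr)
    assume "\<not> 0 < 1 - q"
    then have "sqrt 3 * (1 - q) \<le> 0" by (simp add: mult_nonneg_nonpos)
    then show False using p pq by simp
  qed
  have arc_case: "U = sqrt (1 - (h0 * q / 2)\<^sup>2) - sqrt 3 * (h0 * q / 2)" "W = h0 * q"
    if "q \<le> q_tan" "fade p q = 0"
  proof -
    have "clip p q = q" "bend p q = 0" using that(1) by (auto simp: clip_def bend_below min_def max_def)
    then show "U = sqrt (1 - (h0 * q / 2)\<^sup>2) - sqrt 3 * (h0 * q / 2)" "W = h0 * q"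
      using that(2) by (simp_all add: U_def W_def field_u_def field_w_def outer_u_outer_w_arc)
  qed
  show ?thesis
  proof (cases "a \<le> 0")
    case True
    have Nb: "N = b" using True N2 N0
      by (smt (verit) max_def power2_eq_iff_nonneg zero_power2)
    then have t: "e < t" "t < 2 * e" using N unfolding t_def by auto
    show ?thesis
    \<comment> \<open>Inside the hexagon of \<open>fade\<close>, \<open>p\<close> is at most half of
      sqrt 3 (1 - q), while the difference of these two is 2 t < 4 e; so the point is close to the
      corner.\<close>
    proof (cases "2 * sqrt 3 / 3 * p < 1 - q")
      case fade: True
      have "sqrt 3 / 2 * (2 * sqrt 3 / 3 * p) \<le> sqrt 3 / 2 * (1 - q)"
        using fade by (intro mult_left_mono) auto
      then have p': "p \<le> sqrt 3 / 2 * (1 - q)" by (simp add: sqrt3_mult)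
      then have "sqrt 3 / 2 * (1 - q) \<le> 4 * e" using xi t by simp
      moreover have "8/10 * (1 - q) \<le> sqrt 3 / 2 * (1 - q)"
        using sqrt3_bounds z by (intro mult_right_mono) auto
      ultimately show ?thesis using p' z by auto
    next
      case False
      then have f0: "fade p q = 0" using z by (simp add: fade_def field_simps)
      \<comment> \<open>If the normal component of the field falls short of 1 by at most 2 h0 e,
        multiplication by b < r0 turns this into 2 e.\<close>
      have goal: ?thesis if "1 - 2 * h0 * e \<le> U / 2 + sqrt 3 / 2 * W"
      proof -
        have "b * (1 - (U / 2 + sqrt 3 / 2 * W)) \<le> r0 * (2 * h0 * e)"
        proof (cases "1 - (U / 2 + sqrt 3 / 2 * W) \<ge> 0")
          case True
          then show ?thesis using that Nb N0 b e radius_bounds by (intro mult_mono) auto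
        next
          case False
          then have "b * (1 - (U / 2 + sqrt 3 / 2 * W)) \<le> 0" using Nb N0 by (intro mult_nonneg_nonpos) auto
          moreover have "0 \<le> r0 * (2 * h0 * e)" using radius_bounds curv_bounds e by simp
          ultimately show ?thesis by linarith
        qed
        also have "r0 * (2 * h0 * e) = 2 * e" using curv_radius(3) by simp
        finally have "b - b * (U / 2 + sqrt 3 / 2 * W) \<le> 2 * e" by (simp add: right_diff_distrib)
        then show ?thesis using True Nb N0
          unfolding N_def[symmetric] a_def[symmetric] b_def[symmetric] by simp
      qed
      show ?thesis
      proof (cases "q \<le> q_tan")
        case qt: True
        define S where "S = h0 * q / 2"
        have S: "0 \<le> S" "S \<le> sqrt 3 / 2" using q_tan_half[OF q qt] unfolding S_def by auto
        have "sqrt 3 / 2 * p \<le> (1 - q) / 2 + z_tan" using True unfolding a_def arc_a_def by linarith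
        moreover have "p = sqrt 3 * (1 - q) - 2 * t" using xi by simp
        ultimately have "sqrt 3 / 2 * (sqrt 3 * (1 - q) - 2 * t) \<le> (1 - q) / 2 + z_tan" by simp
        then have "3/2 * (1 - q) - sqrt 3 * t \<le> (1 - q) / 2 + z_tan"
          by (simp add: right_diff_distrib sqrt3_mult)
        then have "q_tan - sqrt 3 * t \<le> q" unfolding z_tan_def by (simp add: field_simps)
        then have "h0 * (q_tan - sqrt 3 * t) \<le> h0 * q" using curv_bounds by (intro mult_left_mono) auto
        then have "sqrt 3 - sqrt 3 * (h0 * t) \<le> 2 * S" unfolding S_def by (simp add: right_diff_distrib curv_q_tan mult.left_commute)
        then have "sqrt 3 * (sqrt 3 - sqrt 3 * (h0 * t)) \<le> sqrt 3 * (2 * S)" by (intro mult_left_mono) auto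
        then have S2: "3 - 3 * (h0 * t) \<le> 2 * (sqrt 3 * S)" by (simp add: right_diff_distrib sqrt3_mult)
        have "h0 * t \<le> h0 * (2 * e)" using t curv_bounds by (intro mult_left_mono) auto
        moreover have "0 \<le> h0 * e" using curv_bounds e by simp
        moreover have "1/2 \<le> sqrt (1 - S\<^sup>2)" using sqrt_one_minus_ge_half[OF S] .
        moreover have "U / 2 + sqrt 3 / 2 * W = (sqrt (1 - S\<^sup>2) + sqrt 3 * S) / 2"
          unfolding arc_case[OF qt f0] S_def by (simp add: field_simps)
        ultimately have "1 - 2 * h0 * e \<le> U / 2 + sqrt 3 / 2 * W" using S2 by (simp add: field_simps)
        then show ?thesis by (rule goal)
      next
        case False
        then have qt: "q_tan \<le> q" by simp
        have "sqrt 3 * (1 - q) \<le> sqrt 3 * (1 - q_tan)" using qt by simp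
        then have "p \<le> p_tan" using pq unfolding p_tan_def z_tan_def by linarith
        then have cl: "clip p q = q_tan" using qt unfolding clip_def by simp
        define m where "m = h0 * bend p q"
        have "bend p q \<le> 2 * t" unfolding bend_def using xi t e by auto
        then have "m \<le> h0 * (2 * t)" unfolding m_def using curv_bounds by (intro mult_left_mono) auto
        moreover have "h0 * t \<le> h0 * (2 * e)" using t curv_bounds by (intro mult_left_mono) auto
        moreover have UW: "U = - 1 - 11/10 * m" "W = sqrt 3 + sqrt 3 * m / 30"
          using f0 by (simp_all add: U_def W_def field_u_def field_w_def outer_u_def outer_w_def cl
            arc_u_q_tan curv_q_tan m_def)
        have "U / 2 + sqrt 3 / 2 * W = 1 - m / 2"
          unfolding UW by (simp add: field_simps)
        ultimately have "1 - 2 * h0 * e \<le> U / 2 + sqrt 3 / 2 * W" by simp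
        then show ?thesis by (rule goal)
      qed
    qed
  next
    case False
    then have a: "a > 0" by simp
    \<comment> \<open>\<open>X\<close> and \<open>q / 2\<close> are the coordinates along and across
      the tip axis, measured from the centre of the arc, and \<open>N\<close> is the distance from
      it. The field has components \<open>c\<close> and q / (2 r0): the normal of the arc of radius
      \<open>r0\<close> at the same distance from the axis.\<close>
    define X where "X = sqrt 3 / 2 * a + b / 2"
    have qy: "sqrt 3 * b - a = q"
      unfolding a_def b_def arc_a_def arc_b_def z_tan_def q_tan_def by (simp add: field_simps)
    have b0: "b > 0"
    proof (rule ccontr)
      assume "\<not> b > 0"
      then have "sqrt 3 * b \<le> 0" by (simp add: mult_nonneg_nonpos)
      then show False using qy a q by simp
    qed
    have N2': "N\<^sup>2 = a\<^sup>2 + b\<^sup>2" using N2 a b0 by simp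
    have XN: "X\<^sup>2 + (q / 2)\<^sup>2 = N\<^sup>2"
      unfolding N2' X_def qy[symmetric] by (simp add: power2_eq_square field_simps)
    have "sqrt 3 * b < sqrt 3 * r0" using b e by simp
    then have qt: "q \<le> q_tan" using qy a unfolding q_tan_def by linarith
    have "N \<le> a + b"
    proof (rule power2_le_imp_le)
      show "N\<^sup>2 \<le> (a + b)\<^sup>2" unfolding N2' using a b0 by (simp add: power2_sum)
    qed (use a b0 in auto)
    moreover have "1 * a \<le> sqrt 3 * a" using sqrt3_bounds a by (intro mult_right_mono) auto
    ultimately have XN2: "N / 2 \<le> X" unfolding X_def by simp
    then have X0: "X > 0" using N0 by simp
    have "X = p - sqrt 3 / 2 * (1 - q) - sqrt 3 / 2 + 2 * r0"
      unfolding X_def a_def b_def arc_a_def arc_b_def z_tan_def q_tan_def by (simp add: field_simps sqrt3_mult)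
    then have "sqrt 3 / 2 * (1 - q) \<le> p" using XN2 N radius_bounds sqrt3_bounds e by linarith
    then have "2 * sqrt 3 / 3 * (sqrt 3 / 2 * (1 - q)) \<le> 2 * sqrt 3 / 3 * p" by (intro mult_left_mono) auto
    then have "1 - q \<le> 2 * sqrt 3 / 3 * p" by (simp add: sqrt3_mult)
    then have f0: "fade p q = 0" using z by (simp add: fade_def field_simps)
    define S where "S = h0 * q / 2"
    define c where "c = sqrt (1 - S\<^sup>2)"
    have S: "0 \<le> S" "S \<le> sqrt 3 / 2" using q_tan_half[OF q qt] unfolding S_def by auto
    have rS: "r0 * S = q / 2" unfolding S_def using curv_radius(3) by simp
    have "X / r0 \<le> c" unfolding c_def
    proof (rule real_le_rsqrt)
      have "N\<^sup>2 \<le> r0\<^sup>2" using N N0 e by (intro power_mono) auto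
      then have "X\<^sup>2 \<le> r0\<^sup>2 * (1 - S\<^sup>2)" using XN rS[symmetric] by (simp add: power_mult_distrib algebra_simps)
      then show "(X / r0)\<^sup>2 \<le> 1 - S\<^sup>2" using radius_bounds by (simp add: power_divide divide_le_eq mult.commute)
    qed
    then have "X * (X / r0) \<le> X * c" using X0 by (intro mult_left_mono) auto
    moreover have "S * (q / 2) = (q / 2)\<^sup>2 / r0" unfolding rS[symmetric]
      using radius_bounds by (simp add: power2_eq_square)
    ultimately have "(X\<^sup>2 + (q / 2)\<^sup>2) / r0 \<le> X * c + S * (q / 2)"
      by (simp add: power2_eq_square add_divide_distrib)
    then have "N\<^sup>2 / r0 \<le> X * c + S * (q / 2)" unfolding XN .
    moreover have "a * (sqrt 3 / 2 * U + W / 2) + b * (U / 2 + sqrt 3 / 2 * W) = X * c + S * (q / 2)"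
    proof -
      have UW: "U = c - sqrt 3 * S" "W = 2 * S" unfolding arc_case[OF qt f0] c_def S_def by simp_all
      show ?thesis unfolding UW X_def qy[symmetric] by (simp add: field_simps sqrt3_mult)
    qed
    moreover have "N - N\<^sup>2 / r0 \<le> 2 * e"
    proof -
      have "N - N\<^sup>2 / r0 = (N / r0) * (r0 - N)" using radius_bounds by (simp add: field_simps power2_eq_square)
      also have "\<dots> \<le> 1 * (2 * e)" using N N0 e radius_bounds by (intro mult_mono) (auto simp: divide_le_eq)
      finally show ?thesis by simp
    qed
    ultimately have "N - (a * (sqrt 3 / 2 * U + W / 2) + b * (U / 2 + sqrt 3 / 2 * W)) \<le> 2 * e" by linarith
    then show ?thesis using a b0
      unfolding N_def[symmetric] a_def[symmetric] b_def[symmetric] by simp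
  qed
qed

section \<open>The perimeter of the rounded hexagram\<close>

text \<open>The cut-off below is differentiable only almost everywhere. Limits of difference
  quotients give a gradient that is measurable whatever value \<open>lim\<close> takes where they
  diverge.\<close>

lemma measurable_gradient:
  fixes f :: "'a::euclidean_space \<Rightarrow> real"
  assumes f[measurable]: "f \<in> borel_measurable borel"
  obtains g where "g \<in> borel_measurable lebesgue" "\<And>x v. (f has_derivative (\<lambda>h. v \<bullet> h)) (at x) \<Longrightarrow> g x = v"
proof -
  define a where "a n = inverse (real (Suc n))" for n
  define g where "g x = (\<Sum>i\<in>Basis. lim (\<lambda>n. (f (x + a n *\<^sub>R i) - f x) / a n) *\<^sub>R i)" for x
  have al: "filterlim a (at 0) sequentially"
    unfolding a_def filterlim_at using LIMSEQ_inverse_real_of_nat by (auto intro!: always_eventually)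
  have "g \<in> borel_measurable borel" unfolding g_def
    by (intro borel_measurable_sum borel_measurable_scaleR borel_measurable_lim_metric) auto
  then have "g \<in> borel_measurable lebesgue" by (intro measurable_completion) auto
  moreover have "g x = v" if d: "(f has_derivative (\<lambda>h. v \<bullet> h)) (at x)" for x v
  proof -
    have "lim (\<lambda>n. (f (x + a n *\<^sub>R i) - f x) / a n) = v \<bullet> i" for i
    proof (rule limI)
      have l: "((\<lambda>t. x + t *\<^sub>R i) has_derivative (\<lambda>t. t *\<^sub>R i)) (at 0)"
        by (auto intro!: derivative_eq_intros)
      have "(f has_derivative (\<lambda>h. v \<bullet> h)) (at (x + 0 *\<^sub>R i))" using d by simp
      from diff_chain_at[OF l this] have "((\<lambda>t. f (x + t *\<^sub>R i)) has_real_derivative v \<bullet> i) (at 0)"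
        by (intro has_derivative_imp_has_field_derivative[where D = "\<lambda>t. t * (v \<bullet> i)"]) (simp_all add: o_def)
      from filterlim_compose[OF DERIV_D[OF this] al]
      show "(\<lambda>n. (f (x + a n *\<^sub>R i) - f x) / a n) \<longlonglongrightarrow> v \<bullet> i" by simp
    qed
    then show ?thesis unfolding g_def by (simp add: euclidean_representation)
  qed
  ultimately show ?thesis using that by blast
qed

lemma test_field_loc_lip:
  assumes "\<psi> \<in> perimeter_test_fields"
  shows "loc_lip \<psi> (x :: 'a::euclidean_space)"
proof -
  define D where "D y = frechet_derivative \<psi> (at y)" for y
  have D: "(\<psi> has_derivative D y) (at y)" for y
    using assms unfolding perimeter_test_fields_def D_def by (auto simp: frechet_derivative_works[symmetric])
  have cont: "continuous_on UNIV (\<lambda>y. D y v)" for v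
    using assms unfolding perimeter_test_fields_def D_def by auto
  have "continuous_on (cball x 1) (\<lambda>y. \<Sum>b\<in>Basis. norm (D y b))"
    by (intro continuous_intros continuous_on_subset[OF cont]) auto
  then have "bounded ((\<lambda>y. \<Sum>b\<in>Basis. norm (D y b)) ` cball x 1)"
    by (intro compact_imp_bounded compact_continuous_image compact_cball)
  then obtain B where B: "\<And>y. y \<in> cball x 1 \<Longrightarrow> \<bar>\<Sum>b\<in>Basis. norm (D y b)\<bar> \<le> B"
    unfolding bounded_iff by (metis imageI real_norm_def)
  have on: "onorm (D y) \<le> B" if y: "y \<in> cball x 1" for y
  proof (rule onorm_le)
    fix v
    interpret bounded_linear "D y" using D by (rule has_derivative_bounded_linear)
    have "D y v = D y (\<Sum>b\<in>Basis. (v \<bullet> b) *\<^sub>R b)" by (simp add: euclidean_representation)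
    also have "\<dots> = (\<Sum>b\<in>Basis. (v \<bullet> b) *\<^sub>R D y b)" by (simp add: sum scaleR)
    also have "norm \<dots> \<le> (\<Sum>b\<in>Basis. norm v * norm (D y b))"
      by (rule sum_norm_le) (auto intro!: mult_right_mono Basis_le_norm)
    also have "\<dots> = norm v * (\<Sum>b\<in>Basis. norm (D y b))" by (simp add: sum_distrib_left)
    also have "\<dots> \<le> norm v * B" using B[OF y] by (intro mult_left_mono) auto
    finally show "norm (D y v) \<le> B * norm v" by (simp add: mult.commute)
  qed
  have "0 \<le> B" using B[of x] by force
  have "B-lipschitz_on (ball x 1) \<psi>"
  proof (rule lipschitz_onI[OF _ \<open>0 \<le> B\<close>])
    fix y y' assume "y \<in> ball x 1" "y' \<in> ball x 1"
    then have "norm (\<psi> y - \<psi> y') \<le> B * norm (y - y')"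
      by (intro differentiable_bound[of "cball x 1" \<psi> D]) (auto intro!: on has_derivative_at_withinI D)
    then show "dist (\<psi> y) (\<psi> y') \<le> B * dist y y'" by (simp add: dist_norm)
  qed
  then show ?thesis by (intro loc_lipI[of 1]) auto
qed

lemma integral_by_parts_test_field:
  fixes f :: "'a::euclidean_space \<Rightarrow> real"
  assumes \<psi>: "\<psi> \<in> perimeter_test_fields" and f: "\<And>x. loc_lip f x" and supp: "\<And>x. norm x > R \<Longrightarrow> f x = 0"
    and d: "AE x in lebesgue. (f has_derivative (\<lambda>v. g x \<bullet> v)) (at x)" and m: "g \<in> borel_measurable lebesgue"
  shows "integrable lebesgue (\<lambda>x. f x * divergence \<psi> x + g x \<bullet> \<psi> x)"
    "(LINT x|lebesgue. f x * divergence \<psi> x + g x \<bullet> \<psi> x) = 0"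
proof -
  define D where "D y = frechet_derivative \<psi> (at y)" for y
  have D: "(\<psi> has_derivative D y) (at y)" for y
    using \<psi> unfolding perimeter_test_fields_def D_def by (auto simp: frechet_derivative_works[symmetric])
  have cont: "continuous_on UNIV (\<lambda>y. D y v)" for v
    using \<psi> unfolding perimeter_test_fields_def D_def by auto
  have divD: "divergence \<psi> x = (\<Sum>i\<in>Basis. D x i \<bullet> i)" for x by (simp add: divergence_def D_def)
  have "continuous_on UNIV (divergence \<psi>)" unfolding divD by (intro continuous_intros cont)
  then have dm: "divergence \<psi> \<in> borel_measurable lebesgue"
    by (intro measurable_completion) (auto intro: borel_measurable_continuous_onI)
  have "continuous_on UNIV \<psi>" by (intro continuous_at_imp_continuous_on ballI loc_lip_isCont test_field_loc_lip \<psi>)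
  then have pm: "\<psi> \<in> borel_measurable lebesgue"
    by (intro measurable_completion) (auto intro: borel_measurable_continuous_onI)
  have "continuous_on UNIV f" by (intro continuous_at_imp_continuous_on ballI loc_lip_isCont f)
  then have fm: "f \<in> borel_measurable lebesgue"
    by (intro measurable_completion) (auto intro: borel_measurable_continuous_onI)
  have lm: "(\<lambda>x. f x * divergence \<psi> x + g x \<bullet> \<psi> x) \<in> borel_measurable lebesgue"
    using dm pm fm m by measurable
  have GL: "loc_lip (\<lambda>x. f x * (\<psi> x \<bullet> i)) x" for i x
    by (intro loc_lip_mult f loc_lip_compose[OF test_field_loc_lip[OF \<psi>]] loc_lip_bounded_linear bounded_linear_inner_left)
  have ae: "AE x in lebesgue. \<exists>E. (\<forall>i\<in>Basis. ((\<lambda>t. f (x + t *\<^sub>R i) * (\<psi> (x + t *\<^sub>R i) \<bullet> i)) has_real_derivative E i) (at 0))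
      \<and> f x * divergence \<psi> x + g x \<bullet> \<psi> x = (\<Sum>i\<in>Basis. E i)"
    using d
  proof eventually_elim
    case (elim x)
    have "((\<lambda>t. f (x + t *\<^sub>R i) * (\<psi> (x + t *\<^sub>R i) \<bullet> i)) has_real_derivative
        (g x \<bullet> i) * (\<psi> x \<bullet> i) + (D x i \<bullet> i) * f x) (at 0)" for i
    proof -
      have l: "((\<lambda>t. x + t *\<^sub>R i) has_derivative (\<lambda>t. t *\<^sub>R i)) (at 0)"
        by (auto intro!: derivative_eq_intros)
      have "(f has_derivative (\<lambda>v. g x \<bullet> v)) (at (x + 0 *\<^sub>R i))" using elim by simp
      from diff_chain_at[OF l this] have 1: "((\<lambda>t. f (x + t *\<^sub>R i)) has_real_derivative g x \<bullet> i) (at 0)"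
        by (intro has_derivative_imp_has_field_derivative[where D = "\<lambda>t. t * (g x \<bullet> i)"]) (simp_all add: o_def)
      have "linear (D x)" using D has_derivative_linear by blast
      have "((\<lambda>y. \<psi> y \<bullet> i) has_derivative (\<lambda>v. D x v \<bullet> i)) (at (x + 0 *\<^sub>R i))"
        using has_derivative_inner_left[OF D[of x]] by simp
      from diff_chain_at[OF l this] have 2: "((\<lambda>t. \<psi> (x + t *\<^sub>R i) \<bullet> i) has_real_derivative D x i \<bullet> i) (at 0)"
        by (intro has_derivative_imp_has_field_derivative[where D = "\<lambda>t. t * (D x i \<bullet> i)"])
          (simp_all add: o_def linear_cmul[OF \<open>linear (D x)\<close>])
      show ?thesis using DERIV_mult[OF 1 2] by simp
    qed
    moreover have "f x * divergence \<psi> x + g x \<bullet> \<psi> x = (\<Sum>i\<in>Basis. (g x \<bullet> i) * (\<psi> x \<bullet> i) + (D x i \<bullet> i) * f x)"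
      unfolding divD by (simp add: sum.distrib euclidean_inner[of "g x" "\<psi> x"] sum_distrib_left mult.commute)
    ultimately show ?case by (intro exI[of _ "\<lambda>i. (g x \<bullet> i) * (\<psi> x \<bullet> i) + (D x i \<bullet> i) * f x"]) auto
  qed
  have Gs: "f x * (\<psi> x \<bullet> i) = 0" if "norm x > R" for i x using supp that by simp
  show "integrable lebesgue (\<lambda>x. f x * divergence \<psi> x + g x \<bullet> \<psi> x)"
    "(LINT x|lebesgue. f x * divergence \<psi> x + g x \<bullet> \<psi> x) = 0"
    using integral_sum_directional_derivatives[where I = "Basis :: 'a set" and g = "\<lambda>i x. f x * (\<psi> x \<bullet> i)"
        and v = "\<lambda>i. i" and R = R, OF _ GL Gs lm ae] by auto
qed

lemma DERIV_pos_sq: "((\<lambda>t::real. (max 0 t)\<^sup>2) has_real_derivative 2 * max 0 t) (at t)"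
proof -
  consider "t > 0" | "t < 0" | "t = 0" by linarith
  then show ?thesis
  proof cases
    case 1
    have "((\<lambda>t::real. t\<^sup>2) has_real_derivative 2 * max 0 t) (at t)"
      using 1 by (auto intro!: derivative_eq_intros)
    then show ?thesis
      by (rule has_field_derivative_transform_within_open[of _ _ _ "{0<..}"]) (use 1 in auto)
  next
    case 2
    have "((\<lambda>t::real. 0) has_real_derivative 2 * max 0 t) (at t)" using 2 by simp
    then show ?thesis
      by (rule has_field_derivative_transform_within_open[of _ _ _ "{..<0}"]) (use 2 in auto)
  next
    case 3
    have "((\<lambda>h::real. (max 0 h)\<^sup>2 / h) \<longlongrightarrow> 0) (at 0)"
    proof (rule Lim_null_comparison)
      show "eventually (\<lambda>h::real. norm ((max 0 h)\<^sup>2 / h) \<le> \<bar>h\<bar>) (at 0)"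
        by (intro always_eventually allI) (auto simp: max_def power2_eq_square)
      show "((\<lambda>h::real. \<bar>h\<bar>) \<longlongrightarrow> 0) (at 0)" by (auto intro!: tendsto_eq_intros)
    qed
    then show ?thesis using 3 by (simp add: DERIV_def)
  qed
qed

text \<open>A C^1 step from 0 to 1 over [0, 1] whose derivative is a tent of height 2, so that the
  cut-off is differentiable wherever \<open>cap_sq\<close> is.\<close>

definition ramp :: "real \<Rightarrow> real" where
  "ramp t = 2 * ((max 0 t)\<^sup>2 - 2 * (max 0 (t - 1/2))\<^sup>2 + (max 0 (t - 1))\<^sup>2)"

definition ramp' :: "real \<Rightarrow> real" where
  "ramp' t = 4 * (max 0 t - 2 * max 0 (t - 1/2) + max 0 (t - 1))"

lemma DERIV_ramp: "(ramp has_real_derivative ramp' t) (at t)"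
proof -
  have d: "((\<lambda>t::real. (max 0 (t - c))\<^sup>2) has_real_derivative 2 * max 0 (t - c)) (at t)" for c
  proof -
    have "((\<lambda>t. t - c) has_real_derivative 1) (at t)" by (auto intro!: derivative_eq_intros)
    then show ?thesis
      using DERIV_chain2[where f = "\<lambda>t. (max 0 t)\<^sup>2" and g = "\<lambda>t. t - c" and Db = 1, OF DERIV_pos_sq] by simp
  qed
  have "((\<lambda>t. 2 * ((max 0 (t - 0))\<^sup>2 - 2 * (max 0 (t - 1/2))\<^sup>2 + (max 0 (t - 1))\<^sup>2)) has_real_derivative
      2 * (2 * max 0 (t - 0) - 2 * (2 * max 0 (t - 1/2)) + 2 * max 0 (t - 1))) (at t)"
    by (intro DERIV_cmult DERIV_add DERIV_diff d)
  then show ?thesis unfolding ramp_def ramp'_def by (simp add: algebra_simps)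
qed

lemma ramp_values: "t \<le> 0 \<Longrightarrow> ramp t = 0" "1 \<le> t \<Longrightarrow> ramp t = 1" "t \<le> 0 \<Longrightarrow> ramp' t = 0" "1 \<le> t \<Longrightarrow> ramp' t = 0"
  "0 \<le> ramp' t" "ramp' t \<le> 2"
  by (auto simp: ramp_def ramp'_def max_def power2_eq_square field_simps)

lemma ramp_bounds: "0 \<le> ramp t" "ramp t \<le> 1"
proof -
  have mono: "ramp s \<le> ramp t" if "s \<le> t" for s t
    by (rule DERIV_nonneg_imp_nondecreasing[OF that]) (use DERIV_ramp ramp_values(5) in blast)
  show "0 \<le> ramp t" using mono[of "min t 0" t] by (simp add: ramp_values)
  show "ramp t \<le> 1" using mono[of t "max t 1"] by (simp add: ramp_values)
qed

lemma loc_lip_ramp: "loc_lip f x \<Longrightarrow> loc_lip (\<lambda>y. ramp (f y)) x"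
  unfolding ramp_def by (intro loc_lip_mult loc_lip_add loc_lip_diff loc_lip_power loc_lip_max loc_lip_const)

section \<open>The rounded hexagram and its cut-off\<close>

context hex_frame
begin

definition cap_sq :: "'a \<Rightarrow> real" where
  "cap_sq y = arc_sq (tip_part y) (reent_part y)"

definition cheeger_set :: "'a \<Rightarrow> 'a set" where
  "cheeger_set z = {x. cap_sq (x - z) < r0\<^sup>2}"

definition cutoff :: "real \<Rightarrow> 'a \<Rightarrow> 'a \<Rightarrow> real" where
  "cutoff e z x = ramp (((r0 - e)\<^sup>2 - cap_sq (x - z)) / ((r0 - e)\<^sup>2 - (r0 - 2 * e)\<^sup>2))"

lemma loc_lip_cap_sq: "loc_lip (\<lambda>x. cap_sq (x - z)) x"
proof (rule loc_lip_compose[of "\<lambda>x. x - z" x cap_sq])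
  show "loc_lip cap_sq (x - z)"
    unfolding cap_sq_def arc_sq_def arc_a_def arc_b_def
    by (intro loc_lip_add loc_lip_power loc_lip_max loc_lip_diff loc_lip_mult loc_lip_divide loc_lip_parts loc_lip_const) auto
qed (intro loc_lip_diff loc_lip_ident loc_lip_const)

lemma continuous_cap_sq: "continuous_on UNIV (\<lambda>x. cap_sq (x - z))"
  by (intro continuous_at_imp_continuous_on ballI loc_lip_isCont loc_lip_cap_sq)

lemma open_cheeger_set: "open (cheeger_set z)"
  unfolding cheeger_set_def by (intro open_Collect_less continuous_cap_sq continuous_on_const)

lemma cheeger_set_hexagram:
  assumes "x \<in> cheeger_set z"
  shows "tip_part (x - z) < sqrt 3 * (1 - reent_part (x - z))"
  using assms arc_b_inside arc_b_le[of _ _ r0] radius_bounds unfolding cheeger_set_def cap_sq_def by auto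

lemma cheeger_set_dom:
  assumes "x \<in> cheeger_set z"
  shows "dom (x - z)"
proof -
  have "0 < sqrt 3 * (1 - reent_part (x - z))"
    using cheeger_set_hexagram[OF assms] parts_nonneg(1)[of "x - z"] by linarith
  then have "reent_part (x - z) < 1" by (simp add: zero_less_mult_iff)
  then show ?thesis unfolding dom_def field_dom_def
    using cheeger_set_hexagram[OF assms] parts_nonneg[of "x - z"] by auto
qed

lemma cheeger_set_subset_cball: "cheeger_set z \<subseteq> cball z 4"
  using cheeger_set_dom dom_norm by (auto simp: dist_norm norm_minus_commute)

lemma cheeger_set_lmeasurable: "cheeger_set z \<in> lmeasurable"
  by (metis bounded_cball bounded_subset cheeger_set_subset_cball lmeasurable_open open_cheeger_set)

lemma center_in_cheeger_set: "z \<in> cheeger_set z"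
proof -
  have 0: "tip_part 0 = 0" "reent_part 0 = 0" using parts_scale[of 0 0] by simp_all
  have "arc_a 0 0 \<le> 0" "arc_b 0 0 \<le> 0"
    unfolding arc_a_def arc_b_def using z_tan_bounds radius_bounds sqrt3_bounds by simp_all
  then show ?thesis unfolding cheeger_set_def cap_sq_def arc_sq_def using radius_bounds by (simp add: 0)
qed

lemma measure_cheeger_set_pos: "0 < measure lebesgue (cheeger_set z)"
proof -
  obtain e where e: "e > 0" "ball z e \<subseteq> cheeger_set z"
    using open_cheeger_set center_in_cheeger_set open_contains_ball by metis
  have "0 < measure lebesgue (ball z e)" using e(1) by simp
  also have "\<dots> \<le> measure lebesgue (cheeger_set z)"
    by (rule measure_mono_fmeasurable[OF e(2) _ cheeger_set_lmeasurable]) auto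
  finally show ?thesis .
qed

text \<open>The unit vector along a side towards the tip; \<open>arc_nu\<close> is its outward unit
  normal. They are the gradients of \<open>arc_a\<close> and \<open>arc_b\<close>.\<close>

definition arc_tau :: "nat \<Rightarrow> nat \<Rightarrow> real \<Rightarrow> 'a" where
  "arc_tau k j s = (sqrt 3 / 2) *\<^sub>R dual_tip j s + (1/2) *\<^sub>R dual_reent k s"

definition arc_nu :: "nat \<Rightarrow> nat \<Rightarrow> real \<Rightarrow> 'a" where
  "arc_nu k j s = (1/2) *\<^sub>R dual_tip j s + (sqrt 3 / 2) *\<^sub>R dual_reent k s"

lemma arc_frame:
  assumes c: "(k, j, s) \<in> set hex_cones"
  shows "arc_tau k j s \<bullet> arc_tau k j s = 1" "arc_nu k j s \<bullet> arc_nu k j s = 1"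
    "arc_tau k j s \<bullet> arc_nu k j s = 0" "arc_nu k j s \<bullet> arc_tau k j s = 0"
proof -
  note cc = hex_cones_cases[OF c]
  have s: "s * s = 1" using cc(6) by auto
  have du: "dual_tip j s \<bullet> u = 2 * s * hex_sin j" "dual_tip j s \<bullet> w = - 2 * s * hex_cos j"
    "dual_reent k s \<bullet> u = - 2 * s * hex_sin k" "dual_reent k s \<bullet> w = 2 * s * hex_cos k"
    by (simp_all add: dual_tip_def dual_reent_def inner_diff_left uu ww uw wu)
  have "dual_tip j s \<bullet> dual_tip j s = 4 * (s * s) * ((hex_cos j)\<^sup>2 + (hex_sin j)\<^sup>2)"
    unfolding inner_dual_tip du by (simp only: power2_eq_square) (simp add: ring_distribs)
  then have T: "dual_tip j s \<bullet> dual_tip j s = 4" unfolding cc(8) s by simp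
  have "dual_reent k s \<bullet> dual_reent k s = 4 * (s * s) * ((hex_cos k)\<^sup>2 + (hex_sin k)\<^sup>2)"
    unfolding inner_dual_reent du by (simp only: power2_eq_square) (simp add: ring_distribs)
  then have R: "dual_reent k s \<bullet> dual_reent k s = 4" unfolding cc(7) s by simp
  have "dual_tip j s \<bullet> dual_reent k s = - (4 * (s * s) * (hex_cos k * hex_cos j + hex_sin k * hex_sin j))"
    unfolding inner_dual_reent du by (simp add: ring_distribs)
  then have TR: "dual_tip j s \<bullet> dual_reent k s = - 2 * sqrt 3" unfolding cc(9) s by simp
  then have RT: "dual_reent k s \<bullet> dual_tip j s = - 2 * sqrt 3" by (simp add: inner_commute)
  show "arc_tau k j s \<bullet> arc_tau k j s = 1" "arc_nu k j s \<bullet> arc_nu k j s = 1"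
    "arc_tau k j s \<bullet> arc_nu k j s = 0" "arc_nu k j s \<bullet> arc_tau k j s = 0"
    unfolding arc_tau_def arc_nu_def
    by (simp_all add: inner_add_left inner_add_right T R TR RT)
qed

lemma arc_frame_dir:
  assumes c: "(k, j, s) \<in> set hex_cones"
  shows "dir k \<bullet> arc_tau k j s = sqrt 3 / 2" "dir j \<bullet> arc_tau k j s = 1 / 2"
    "dir k \<bullet> arc_nu k j s = 1 / 2" "dir j \<bullet> arc_nu k j s = sqrt 3 / 2"
  unfolding arc_tau_def arc_nu_def by (simp_all add: inner_add_right dual_dir[OF c])

lemma cap_sq_derivative:
  assumes c: "in_cone k j s (x - z)" and pos: "(x - z) \<bullet> dual_tip j s \<noteq> 0" "(x - z) \<bullet> dual_reent k s \<noteq> 0"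
  defines "a \<equiv> arc_a (tip_part (x - z)) (reent_part (x - z))" and "b \<equiv> arc_b (tip_part (x - z)) (reent_part (x - z))"
  shows "((\<lambda>x. cap_sq (x - z)) has_derivative
    (\<lambda>v. (2 * max 0 a) *\<^sub>R arc_tau k j s \<bullet> v + (2 * max 0 b) *\<^sub>R arc_nu k j s \<bullet> v)) (at x)"
proof -
  have c': "(k, j, s) \<in> set hex_cones" using c unfolding in_cone_def by simp
  let ?p = "\<lambda>x. (x - z) \<bullet> dual_tip j s" and ?q = "\<lambda>x. (x - z) \<bullet> dual_reent k s"
  define S where "S = {x. 0 < ?p x \<and> 0 < ?q x}"
  have S: "open S" unfolding S_def by (intro open_Collect_conj open_Collect_less continuous_intros)
  have xS: "x \<in> S" using c pos unfolding in_cone_def S_def by auto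
  have ab: "a = arc_a (?p x) (?q x)" "b = arc_b (?p x) (?q x)" unfolding a_def b_def cone_parts[OF c] by simp_all
  have da: "((\<lambda>x. arc_a (?p x) (?q x)) has_derivative (\<lambda>v. arc_tau k j s \<bullet> v)) (at x)"
    unfolding arc_a_def arc_tau_def
    by (auto intro!: derivative_eq_intros simp: inner_add_left inner_add_right inner_commute)
  have db: "((\<lambda>x. arc_b (?p x) (?q x)) has_derivative (\<lambda>v. arc_nu k j s \<bullet> v)) (at x)"
    unfolding arc_b_def arc_nu_def
    by (auto intro!: derivative_eq_intros simp: inner_add_left inner_add_right inner_commute)
  have chain: "((\<lambda>x. (max 0 (F x))\<^sup>2) has_derivative (\<lambda>v. 2 * max 0 (F x) * G v)) (at x)"
    if "(F has_derivative G) (at x)" for F :: "'a \<Rightarrow> real" and G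
    using diff_chain_at[OF that DERIV_pos_sq[of "F x", unfolded has_field_derivative_def]]
    by (simp add: o_def)
  have "((\<lambda>x. (max 0 (arc_a (?p x) (?q x)))\<^sup>2 + (max 0 (arc_b (?p x) (?q x)))\<^sup>2) has_derivative
    (\<lambda>v. (2 * max 0 a) *\<^sub>R arc_tau k j s \<bullet> v + (2 * max 0 b) *\<^sub>R arc_nu k j s \<bullet> v)) (at x)"
    using has_derivative_add[OF chain[OF da] chain[OF db]] by (simp add: ab)
  then show ?thesis
  proof (rule has_derivative_transform_within_open[OF _ S xS])
    fix y assume "y \<in> S"
    then have "in_cone k j s (y - z)" using c' unfolding in_cone_def S_def by auto
    then show "(max 0 (arc_a (?p y) (?q y)))\<^sup>2 + (max 0 (arc_b (?p y) (?q y)))\<^sup>2 = cap_sq (y - z)"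
      unfolding cap_sq_def arc_sq_def by (simp add: cone_parts)
  qed
qed

definition strip :: "real \<Rightarrow> 'a \<Rightarrow> 'a set" where
  "strip e z = {x. (r0 - 2 * e)\<^sup>2 < cap_sq (x - z) \<and> cap_sq (x - z) < r0\<^sup>2}"

text \<open>It contains the points that \<open>strip_estimate\<close> leaves out. Its measure is of
  order e^2, against a gradient of order 1/e.\<close>

definition corners :: "real \<Rightarrow> 'a \<Rightarrow> 'a set" where
  "corners e z = (\<Union>i<12. cball (z + dir i) (10 * e))"

context
  fixes e :: real and z :: 'a
  assumes e: "0 < e" "e \<le> 1/1000"
begin

lemma gap: "e \<le> (r0 - e)\<^sup>2 - (r0 - 2 * e)\<^sup>2"
proof -
  have "(r0 - e)\<^sup>2 - (r0 - 2 * e)\<^sup>2 = e * (2 * r0 - 3 * e)" by (simp add: power2_eq_square algebra_simps)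
  moreover have "e * 1 \<le> e * (2 * r0 - 3 * e)" using e radius_bounds by (intro mult_left_mono) auto
  ultimately show ?thesis by simp
qed

lemma cutoff_zero: "(r0 - e)\<^sup>2 \<le> cap_sq (x - z) \<Longrightarrow> cutoff e z x = 0"
  unfolding cutoff_def using gap e by (intro ramp_values(1) divide_nonpos_pos) auto

lemma cutoff_one: "cap_sq (x - z) \<le> (r0 - 2 * e)\<^sup>2 \<Longrightarrow> cutoff e z x = 1"
  unfolding cutoff_def using gap e by (intro ramp_values(2)) (simp add: le_divide_eq)

lemma cutoff_bounds: "0 \<le> cutoff e z x" "cutoff e z x \<le> 1"
  unfolding cutoff_def by (rule ramp_bounds)+

lemma loc_lip_cutoff: "loc_lip (cutoff e z) x"
  unfolding cutoff_def
  by (intro loc_lip_ramp loc_lip_divide loc_lip_diff loc_lip_const loc_lip_cap_sq) (use gap e in auto)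

lemma cutoff_nonzero_in_set:
  assumes "cutoff e z x \<noteq> 0"
  shows "x \<in> cheeger_set z"
proof -
  have "cap_sq (x - z) < (r0 - e)\<^sup>2" using assms cutoff_zero[of x] by force
  also have "\<dots> \<le> r0\<^sup>2" using e radius_bounds by (intro power_mono) auto
  finally show ?thesis unfolding cheeger_set_def by simp
qed

lemma cutoff_supp: "norm x > 4 + norm z \<Longrightarrow> cutoff e z x = 0"
proof (rule ccontr)
  assume x: "norm x > 4 + norm z" "cutoff e z x \<noteq> 0"
  then have "dist z x \<le> 4" using cutoff_nonzero_in_set cheeger_set_subset_cball by fastforce
  then show False using x norm_triangle_ineq2[of x z] by (simp add: dist_norm norm_minus_commute)
qed

lemma cutoff_dom: "dom (x - z) \<or> eventually (\<lambda>y. cutoff e z y = 0) (nhds x)"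
proof (cases "x \<in> cheeger_set z")
  case True
  then show ?thesis using cheeger_set_dom by blast
next
  case False
  have "(r0 - e)\<^sup>2 < r0\<^sup>2" using e radius_bounds by (intro power_strict_mono) auto
  then have "x \<in> {y. (r0 - e)\<^sup>2 < cap_sq (y - z)}" using False unfolding cheeger_set_def by simp
  moreover have "open {y. (r0 - e)\<^sup>2 < cap_sq (y - z)}"
    by (intro open_Collect_less continuous_cap_sq continuous_on_const)
  ultimately have "eventually (\<lambda>y. y \<in> {y. (r0 - e)\<^sup>2 < cap_sq (y - z)}) (nhds x)"
    by (intro eventually_nhds_in_open)
  then have "eventually (\<lambda>y. cutoff e z y = 0) (nhds x)"
    by eventually_elim (auto intro: cutoff_zero)
  then show ?thesis by simp
qed

text \<open>The gradient is -\<kappa> g, where 2 g is the gradient of \<open>cap_sq\<close>, so the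
  left side is \<kappa> times norm g minus the inner product of g and the field. Since \<kappa> is
  at most 4/e, the bound 2 e of \<open>strip_estimate\<close> costs a constant, and the trivial
  bound near the corners costs 8/e.\<close>

lemma cutoff_gradient:
  assumes c: "in_cone k j s (x - z)" and pos: "(x - z) \<bullet> dual_tip j s \<noteq> 0" "(x - z) \<bullet> dual_reent k s \<noteq> 0"
  obtains v where "(cutoff e z has_derivative (\<lambda>h. v \<bullet> h)) (at x)"
    "norm v + calib_at 1 z x \<bullet> v \<le> 16 * indicator (strip e z) x + 8 / e * indicator (corners e z) x"
proof -
  have c': "(k, j, s) \<in> set hex_cones" using c unfolding in_cone_def by simp
  note cc = hex_cones_cases[OF c']
  define p where "p = tip_part (x - z)"
  define q where "q = reent_part (x - z)"
  define a where "a = max 0 (arc_a p q)"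
  define b where "b = max 0 (arc_b p q)"
  define d where "d = (r0 - e)\<^sup>2 - (r0 - 2 * e)\<^sup>2"
  define t where "t = ((r0 - e)\<^sup>2 - cap_sq (x - z)) / d"
  define \<kappa> where "\<kappa> = 2 * ramp' t / d"
  define g where "g = a *\<^sub>R arc_tau k j s + b *\<^sub>R arc_nu k j s"
  have d: "e \<le> d" unfolding d_def by (rule gap)
  have k0: "0 \<le> \<kappa>" unfolding \<kappa>_def using d e ramp_values(5)[of t] by simp
  have "\<kappa> \<le> 4 / e"
  proof -
    have "2 * ramp' t / d \<le> 4 / d" using ramp_values(6)[of t] d e by (intro divide_right_mono) auto
    also have "\<dots> \<le> 4 / e" using d e by (intro divide_left_mono) auto
    finally show ?thesis unfolding \<kappa>_def .
  qed
  note \<kappa> = k0 this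
  have N: "norm g = sqrt (cap_sq (x - z))"
    unfolding norm_eq_sqrt_inner g_def cap_sq_def arc_sq_def a_def b_def p_def q_def
    by (simp add: inner_add_left inner_add_right arc_frame[OF c'] power2_eq_square)
  have "((\<lambda>x. ((r0 - e)\<^sup>2 - cap_sq (x - z)) / d) has_derivative
      (\<lambda>v. (- 2 / d) * (g \<bullet> v))) (at x)"
    by (rule derivative_eq_intros cap_sq_derivative[OF c pos] refl)+
      (use d e in \<open>auto simp: fun_eq_iff g_def a_def b_def p_def q_def inner_add_left field_simps\<close>)
  from diff_chain_at[OF this DERIV_ramp[of "((r0 - e)\<^sup>2 - cap_sq (x - z)) / d", unfolded has_field_derivative_def]]
  have "(cutoff e z has_derivative (\<lambda>v. ramp' t * ((- 2 / d) * (g \<bullet> v)))) (at x)"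
    unfolding cutoff_def[abs_def] d_def[symmetric] t_def o_def .
  then have deriv: "(cutoff e z has_derivative (\<lambda>v. (- \<kappa>) *\<^sub>R g \<bullet> v)) (at x)"
    unfolding \<kappa>_def by (simp add: mult_ac)
  have ind: "0 \<le> 16 * (indicator (strip e z) x :: real)" "0 \<le> 8 / e * indicator (corners e z) x" using e by (auto simp: indicator_def)
  have "norm ((- \<kappa>) *\<^sub>R g) + calib_at 1 z x \<bullet> ((- \<kappa>) *\<^sub>R g) \<le> 16 * indicator (strip e z) x + 8 / e * indicator (corners e z) x"
  proof (cases "0 < t \<and> t < 1")
    case False
    then have "\<kappa> = 0" unfolding \<kappa>_def using ramp_values(3)[of t] ramp_values(4)[of t] by auto
    then show ?thesis using ind by simp
  next
    case True
    have n1: "cap_sq (x - z) < (r0 - e)\<^sup>2" and n2: "(r0 - 2 * e)\<^sup>2 < cap_sq (x - z)"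
      using True d e unfolding t_def d_def by (auto simp: zero_less_divide_iff divide_less_eq)
    have "(r0 - e)\<^sup>2 \<le> r0\<^sup>2" using e radius_bounds by (intro power_mono) auto
    then have xE: "x \<in> cheeger_set z" and xS: "x \<in> strip e z" using n1 n2 unfolding cheeger_set_def strip_def by auto
    have dm: "dom (x - z)" using cheeger_set_dom[OF xE] .
    then have q1: "reent_part (x - z) < 1" unfolding dom_def field_dom_def by simp
    let ?U = "field_u p q" and ?W = "field_w p q"
    have cal: "calib_at 1 z x = ?U *\<^sub>R dir k + ?W *\<^sub>R dir j"
      using dm cone_calib[OF c q1] unfolding calib_at_def p_def q_def by simp
    have inner: "calib_at 1 z x \<bullet> g = a * (sqrt 3 / 2 * ?U + ?W / 2) + b * (?U / 2 + sqrt 3 / 2 * ?W)"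
      unfolding cal g_def by (simp add: inner_add_left inner_add_right arc_frame_dir[OF c'] algebra_simps)
    have ng: "norm g \<le> r0"
      unfolding N using n1 \<open>(r0 - e)\<^sup>2 \<le> r0\<^sup>2\<close> radius_bounds by (intro real_le_lsqrt) auto
    have val: "norm ((- \<kappa>) *\<^sub>R g) + calib_at 1 z x \<bullet> ((- \<kappa>) *\<^sub>R g) = \<kappa> * (norm g - calib_at 1 z x \<bullet> g)"
      using \<kappa> by (simp add: algebra_simps)
    from strip_estimate[of p q e] have
      "(p \<le> 5 * e \<and> 0 \<le> 1 - q \<and> 1 - q \<le> 5 * e) \<or> norm g - calib_at 1 z x \<bullet> g \<le> 2 * e"
      using parts_nonneg[of "x - z"] e n1 n2 unfolding N inner a_def b_def p_def q_def cap_sq_def by auto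
    then show ?thesis
    proof
      assume g2: "norm g - calib_at 1 z x \<bullet> g \<le> 2 * e"
      have "\<kappa> * (norm g - calib_at 1 z x \<bullet> g) \<le> \<kappa> * (2 * e)" using g2 \<kappa> by (intro mult_left_mono) auto
      also have "\<dots> \<le> 4 / e * (2 * e)" using \<kappa> e by (intro mult_right_mono) auto
      also have "\<dots> = 8" using e by simp
      finally show ?thesis unfolding val using xS ind(2) by simp
    next
      assume bad: "p \<le> 5 * e \<and> 0 \<le> 1 - q \<and> 1 - q \<le> 5 * e"
      have "x - (z + dir j) = p *\<^sub>R dir k + (q - 1) *\<^sub>R dir j"
        using cone_decomp[OF c', of "x - z"] unfolding p_def q_def cone_parts[OF c]
        by (simp add: algebra_simps)
      then have "dist (z + dir j) x \<le> norm (p *\<^sub>R dir k) + norm ((q - 1) *\<^sub>R dir j)"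
        by (metis dist_commute dist_norm norm_triangle_ineq)
      also have "\<dots> = p + (1 - q)"
        using bad parts_nonneg[of "x - z"] dual_dir[OF c'] unfolding p_def q_def by (simp add: norm_eq_sqrt_inner)
      finally have xc: "x \<in> corners e z" unfolding corners_def using bad cc(2) by (intro UN_I[of j]) auto
      have "\<bar>calib_at 1 z x \<bullet> g\<bar> \<le> 1 * norm g"
        by (rule order_trans[OF Cauchy_Schwarz_ineq2 mult_right_mono[OF norm_calib_at_le norm_ge_zero]])
      then have "\<kappa> * (norm g - calib_at 1 z x \<bullet> g) \<le> 4 / e * (2 * r0)"
        using \<kappa> ng radius_bounds e by (intro mult_mono) auto
      also have "\<dots> \<le> 4 / e * 2" using radius_bounds e by (intro mult_left_mono) auto
      finally show ?thesis unfolding val using xc xS by simp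
    qed
  qed
  then show ?thesis using that[of "(- \<kappa>) *\<^sub>R g"] deriv by simp
qed

end

end

section \<open>The upper bound for the perimeter\<close>

context hex_frame
begin

lemma corners_measure:
  assumes "DIM('a) = 2" "0 < e"
  shows "corners e z \<in> lmeasurable" "measure lebesgue (corners e z) \<le> 1200 * pi * e\<^sup>2"
proof -
  show "corners e z \<in> lmeasurable" unfolding corners_def by (intro fmeasurable.finite_UN) auto
  have "measure lebesgue (corners e z) \<le> (\<Sum>i<12. measure lebesgue (cball (z + dir i) (10 * e)))"
    unfolding corners_def by (intro measure_UNION_le) auto
  also have "\<dots> = (\<Sum>i<(12::nat). 100 * pi * e\<^sup>2)"
    by (intro sum.cong) (use assms in \<open>auto simp: content_cball unit_ball_vol_2 power_mult_distrib\<close>)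
  finally show "measure lebesgue (corners e z) \<le> 1200 * pi * e\<^sup>2" by simp
qed

lemma strip_subset: "strip e z \<subseteq> cheeger_set z"
  unfolding strip_def cheeger_set_def by auto

lemma strip_lmeasurable: "strip e z \<in> lmeasurable"
proof (rule lmeasurable_open)
  show "open (strip e z)" unfolding strip_def
    by (intro open_Collect_conj open_Collect_less continuous_cap_sq continuous_on_const)
  show "bounded (strip e z)"
    by (meson bounded_cball bounded_subset cheeger_set_subset_cball strip_subset)
qed

text \<open>Write f for the cut-off and V for the field. Integrating by parts, the integral of f div
  \<psi> is at most that of the norm of grad f. By \<open>cutoff_gradient\<close> this norm is at
  most - V . grad f up to the errors on the strip and at the corners, and by
  \<open>weak_divergence\<close> - V . grad f integrates to \<open>h0\<close> times the integral of
  f.\<close>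

lemma cutoff_divergence_le:
  assumes dim: "DIM('a) = 2" and e: "0 < e" "e \<le> 1/1000" and \<psi>: "\<psi> \<in> perimeter_test_fields"
  shows "(LINT x|lebesgue. cutoff e z x * divergence \<psi> x)
    \<le> h0 * measure lebesgue (cheeger_set z) + 16 * measure lebesgue (strip e z) + 9600 * pi * e"
proof -
  let ?f = "cutoff e z"
  have fc: "continuous_on UNIV ?f"
    by (intro continuous_at_imp_continuous_on ballI loc_lip_isCont loc_lip_cutoff e)
  then have fm: "?f \<in> borel_measurable borel" by (rule borel_measurable_continuous_onI)
  obtain g where g: "g \<in> borel_measurable lebesgue" "\<And>x v. (?f has_derivative (\<lambda>h. v \<bullet> h)) (at x) \<Longrightarrow> g x = v"
    by (rule measurable_gradient[OF fm]) blast
  have ae: "AE x in lebesgue. (?f has_derivative (\<lambda>v. g x \<bullet> v)) (at x)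
      \<and> norm (g x) + calib_at 1 z x \<bullet> g x \<le> 16 * indicator (strip e z) x + 8 / e * indicator (corners e z) x"
    using AE_generic[of 1 z, simplified]
  proof eventually_elim
    case (elim x)
    obtain k j s where c: "in_cone k j s (x - z)" by (rule cone_exists)
    then have gen: "(x - z) \<bullet> dual_tip j s \<noteq> 0" "(x - z) \<bullet> dual_reent k s \<noteq> 0"
      using elim unfolding generic_def by auto
    obtain v where v: "(?f has_derivative (\<lambda>h. v \<bullet> h)) (at x)"
      "norm v + calib_at 1 z x \<bullet> v \<le> 16 * indicator (strip e z) x + 8 / e * indicator (corners e z) x"
      by (rule cutoff_gradient[OF e c gen]) blast
    then show ?case using g(2)[OF v(1)] by simp
  qed
  then have ae1: "AE x in lebesgue. (?f has_derivative (\<lambda>v. g x \<bullet> v)) (at x)"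
    and ae2: "AE x in lebesgue. norm (g x) + calib_at 1 z x \<bullet> g x
      \<le> 16 * indicator (strip e z) x + 8 / e * indicator (corners e z) x"
    by (auto elim: eventually_mono)
  have dom1: "dom ((1 / 1) *\<^sub>R (x - z)) \<or> eventually (\<lambda>y. ?f y = 0) (nhds x)" for x
    using cutoff_dom[OF e, of x z] by simp
  note T = integral_by_parts_test_field[where R = "4 + norm z", OF \<psi> loc_lip_cutoff[OF e] cutoff_supp[OF e] ae1 g(1)]
  note W = weak_divergence[where l = 1 and R = "4 + norm z", OF zero_less_one loc_lip_cutoff[OF e] cutoff_supp[OF e] dom1 ae1 g(1)]
  have fi: "integrable lebesgue ?f"
    by (rule integrable_lebesgue_continuous_bounded_support[OF fc cutoff_supp[OF e]])
  have "continuous_on UNIV (divergence \<psi>)"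
    using \<psi> unfolding divergence_def perimeter_test_fields_def by (auto intro!: continuous_intros)
  then have di: "integrable lebesgue (\<lambda>x. ?f x * divergence \<psi> x)"
    by (intro integrable_lebesgue_continuous_bounded_support[of _ "4 + norm z"] continuous_intros fc)
      (auto simp: cutoff_supp[OF e])
  have ci: "integrable lebesgue (\<lambda>x. indicator (corners e z) x :: real)"
    using corners_measure(1)[OF dim e(1)] by (simp add: lmeasurable_iff_integrable)
  have si: "integrable lebesgue (\<lambda>x. indicator (strip e z) x :: real)"
    using strip_lmeasurable by (simp add: lmeasurable_iff_integrable)
  have Ei: "integrable lebesgue (\<lambda>x. indicator (cheeger_set z) x :: real)"
    using cheeger_set_lmeasurable by (simp add: lmeasurable_iff_integrable)
  have gp: "integrable lebesgue (\<lambda>x. g x \<bullet> \<psi> x)" "(LINT x|lebesgue. g x \<bullet> \<psi> x) = - (LINT x|lebesgue. ?f x * divergence \<psi> x)"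
  proof -
    have "integrable lebesgue (\<lambda>x. (?f x * divergence \<psi> x + g x \<bullet> \<psi> x) - ?f x * divergence \<psi> x)"
      by (intro Bochner_Integration.integrable_diff T(1) di)
    then show "integrable lebesgue (\<lambda>x. g x \<bullet> \<psi> x)" by simp
    then show "(LINT x|lebesgue. g x \<bullet> \<psi> x) = - (LINT x|lebesgue. ?f x * divergence \<psi> x)"
      using T(2) di by simp
  qed
  have gc: "integrable lebesgue (\<lambda>x. calib_at 1 z x \<bullet> g x)" "(LINT x|lebesgue. calib_at 1 z x \<bullet> g x) = - h0 * (LINT x|lebesgue. ?f x)"
  proof -
    have "integrable lebesgue (\<lambda>x. (calib_at 1 z x \<bullet> g x + h0 / 1 * ?f x) - h0 * ?f x)"
      using W(1) fi by (intro Bochner_Integration.integrable_diff integrable_mult_right) auto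
    then show "integrable lebesgue (\<lambda>x. calib_at 1 z x \<bullet> g x)" by simp
    then show "(LINT x|lebesgue. calib_at 1 z x \<bullet> g x) = - h0 * (LINT x|lebesgue. ?f x)"
      using W(2) fi by simp
  qed
  have "(LINT x|lebesgue. calib_at 1 z x \<bullet> g x - g x \<bullet> \<psi> x)
      \<le> (LINT x|lebesgue. 16 * indicator (strip e z) x + 8 / e * indicator (corners e z) x)"
  proof (rule integral_mono_AE)
    show "integrable lebesgue (\<lambda>x. calib_at 1 z x \<bullet> g x - g x \<bullet> \<psi> x)"
      by (intro Bochner_Integration.integrable_diff gc gp)
    show "integrable lebesgue (\<lambda>x. 16 * indicator (strip e z) x + 8 / e * indicator (corners e z) x :: real)"
      by (intro Bochner_Integration.integrable_add integrable_mult_right si ci)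
    show "AE x in lebesgue. calib_at 1 z x \<bullet> g x - g x \<bullet> \<psi> x
      \<le> 16 * indicator (strip e z) x + 8 / e * indicator (corners e z) x"
      using ae2
    proof eventually_elim
      case (elim x)
      have "norm (\<psi> x) \<le> 1" using \<psi> unfolding perimeter_test_fields_def by auto
      then have "\<bar>g x \<bullet> \<psi> x\<bar> \<le> norm (g x) * 1"
        by (intro order_trans[OF Cauchy_Schwarz_ineq2] mult_left_mono) auto
      then show ?case using elim by linarith
    qed
  qed
  also have "\<dots> = 16 * measure lebesgue (strip e z) + 8 / e * measure lebesgue (corners e z)"
    using si ci by simp
  also have "8 / e * measure lebesgue (corners e z) \<le> 8 / e * (1200 * pi * e\<^sup>2)"
    using corners_measure(2)[OF dim e(1)] e by (intro mult_left_mono) auto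
  also have "8 / e * (1200 * pi * e\<^sup>2) = 9600 * pi * e" using e by (simp add: power2_eq_square)
  finally have "(LINT x|lebesgue. ?f x * divergence \<psi> x) \<le> h0 * (LINT x|lebesgue. ?f x)
      + 16 * measure lebesgue (strip e z) + 9600 * pi * e"
    using gc gp by simp
  moreover have "(LINT x|lebesgue. ?f x) \<le> (LINT x|lebesgue. indicator (cheeger_set z) x)"
  proof (rule integral_mono[OF fi Ei])
    fix x show "?f x \<le> indicator (cheeger_set z) x"
      using cutoff_bounds(2)[OF e, of z x] cutoff_nonzero_in_set[OF e, of z x]
      by (cases "cutoff e z x = 0") (simp_all add: indicator_def)
  qed
  then have "h0 * (LINT x|lebesgue. ?f x) \<le> h0 * measure lebesgue (cheeger_set z)"
    using curv_bounds by (intro mult_left_mono) auto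
  ultimately show ?thesis by linarith
qed

text \<open>As \<open>e\<close> tends to 0 the cut-offs converge to the indicator of the set. A
  point with \<open>cap_sq\<close> below \<open>r0\<close> squared eventually leaves the strips, so
  their measure tends to 0 as well.\<close>

lemma perimeter_cheeger_set_le:
  assumes dim: "DIM('a) = 2"
  shows "perimeter (cheeger_set z) \<le> ereal (h0 * measure lebesgue (cheeger_set z))"
  unfolding perimeter_def
proof (rule SUP_least)
  fix \<psi> :: "'a \<Rightarrow> 'a" assume \<psi>: "\<psi> \<in> perimeter_test_fields"
  let ?E = "cheeger_set z"
  define e where "e n = inverse (real (Suc (n + 1000)))" for n
  have e: "0 < e n" "e n \<le> 1/1000" for n unfolding e_def by (auto simp: field_simps)
  have e0: "e \<longlonglongrightarrow> 0" unfolding e_def by (rule LIMSEQ_ignore_initial_segment[OF LIMSEQ_inverse_real_of_nat])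
  have divc: "continuous_on UNIV (divergence \<psi>)"
    using \<psi> unfolding divergence_def perimeter_test_fields_def by (auto intro!: continuous_intros)
  have "bounded (divergence \<psi> ` cball z 4)"
    by (intro compact_imp_bounded compact_continuous_image continuous_on_subset[OF divc]) auto
  then obtain B where B: "\<And>x. x \<in> cball z 4 \<Longrightarrow> \<bar>divergence \<psi> x\<bar> \<le> B"
    unfolding bounded_iff by (metis imageI real_norm_def)
  have Em: "?E \<in> sets lebesgue" using cheeger_set_lmeasurable by (rule fmeasurableD)
  have dm: "divergence \<psi> \<in> borel_measurable lebesgue"
    using divc by (intro measurable_completion) (auto intro: borel_measurable_continuous_onI)
  have ci: "integrable lebesgue (\<lambda>x. c * indicator (cball z 4) x)" for c :: real
    using lmeasurable_cball[of z 4] by (intro integrable_mult_right) (simp add: lmeasurable_iff_integrable)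
  have fm: "cutoff (e n) z \<in> borel_measurable lebesgue" for n
    by (intro measurable_completion) (auto intro!: borel_measurable_continuous_onI continuous_at_imp_continuous_on
      loc_lip_isCont loc_lip_cutoff e)
  have inE: "eventually (\<lambda>n. cap_sq (x - z) \<le> (r0 - 2 * e n)\<^sup>2) sequentially" if "x \<in> ?E" for x
  proof -
    have "(\<lambda>n. (r0 - 2 * e n)\<^sup>2) \<longlonglongrightarrow> (r0 - 2 * 0)\<^sup>2" by (intro tendsto_intros e0)
    moreover have "cap_sq (x - z) < (r0 - 2 * 0)\<^sup>2" using that unfolding cheeger_set_def by simp
    ultimately have "eventually (\<lambda>n. cap_sq (x - z) < (r0 - 2 * e n)\<^sup>2) sequentially" by (rule order_tendstoD)
    then show ?thesis by eventually_elim simp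
  qed
  have L: "(\<lambda>n. (LINT x|lebesgue. cutoff (e n) z x * divergence \<psi> x))
      \<longlonglongrightarrow> (LINT x|lebesgue. indicator ?E x * divergence \<psi> x)"
  proof (rule integral_dominated_convergence[OF _ _ ci[of B]])
    show "(\<lambda>x. indicator ?E x * divergence \<psi> x) \<in> borel_measurable lebesgue"
      using dm Em by measurable
    show "(\<lambda>x. cutoff (e n) z x * divergence \<psi> x) \<in> borel_measurable lebesgue" for n
      using dm fm by measurable
    show "AE x in lebesgue. norm (cutoff (e n) z x * divergence \<psi> x) \<le> B * indicator (cball z 4) x" for n
    proof (intro AE_I2)
      fix x
      show "norm (cutoff (e n) z x * divergence \<psi> x) \<le> B * indicator (cball z 4) x"
      proof (cases "cutoff (e n) z x = 0")
        case True
        have "x \<in> cball z 4 \<Longrightarrow> 0 \<le> B" using B[of x] by simp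
        then show ?thesis using True by (auto simp: indicator_def)
      next
        case False
        then have x: "x \<in> cball z 4" using cutoff_nonzero_in_set[OF e] cheeger_set_subset_cball by blast
        have "\<bar>cutoff (e n) z x\<bar> * \<bar>divergence \<psi> x\<bar> \<le> 1 * B"
          using B[OF x] cutoff_bounds[OF e, of n z x] by (intro mult_mono) auto
        then show ?thesis using x by (simp add: abs_mult)
      qed
    qed
    show "AE x in lebesgue. (\<lambda>n. cutoff (e n) z x * divergence \<psi> x) \<longlonglongrightarrow> indicator ?E x * divergence \<psi> x"
    proof (intro AE_I2 tendsto_mult tendsto_const)
      fix x
      show "(\<lambda>n. cutoff (e n) z x) \<longlonglongrightarrow> indicator ?E x"
      proof (cases "x \<in> ?E")
        case True
        from inE[OF True] have "eventually (\<lambda>n. cutoff (e n) z x = indicator ?E x) sequentially"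
          by eventually_elim (use True cutoff_one[OF e] in auto)
        then show ?thesis by (rule tendsto_eventually)
      next
        case False
        then have "cutoff (e n) z x = 0" for n using cutoff_nonzero_in_set[OF e] by blast
        then show ?thesis using False by simp
      qed
    qed
  qed
  have "(\<lambda>n. (LINT x|lebesgue. indicator (strip (e n) z) x :: real)) \<longlonglongrightarrow> (LINT x::'a|lebesgue. (0::real))"
  proof (rule integral_dominated_convergence[OF _ _ ci[of 1]])
    show "(\<lambda>x. indicator (strip (e n) z) x :: real) \<in> borel_measurable lebesgue" for n
      using fmeasurableD[OF strip_lmeasurable[of "e n" z]] by measurable
    show "AE x in lebesgue. norm (indicator (strip (e n) z) x :: real) \<le> 1 * indicator (cball z 4) x" for n
      using strip_subset[of "e n" z] cheeger_set_subset_cball[of z] by (intro AE_I2) (auto simp: indicator_def)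
    show "AE x in lebesgue. (\<lambda>n. indicator (strip (e n) z) x :: real) \<longlonglongrightarrow> 0"
    proof (intro AE_I2)
      fix x
      show "(\<lambda>n. indicator (strip (e n) z) x :: real) \<longlonglongrightarrow> 0"
      proof (cases "x \<in> ?E")
        case True
        from inE[OF True] have "eventually (\<lambda>n. (indicator (strip (e n) z) x :: real) = 0) sequentially"
          by eventually_elim (auto simp: strip_def)
        then show ?thesis by (rule tendsto_eventually)
      next
        case False
        then have "x \<notin> strip (e n) z" for n using strip_subset by blast
        then show ?thesis by simp
      qed
    qed
  qed auto
  then have S: "(\<lambda>n. measure lebesgue (strip (e n) z)) \<longlonglongrightarrow> 0"
    using strip_lmeasurable by (simp add: fmeasurableD)
  have "(\<lambda>n. h0 * measure lebesgue ?E + 16 * measure lebesgue (strip (e n) z) + 9600 * pi * e n)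
      \<longlonglongrightarrow> h0 * measure lebesgue ?E + 16 * 0 + 9600 * pi * 0"
    by (intro tendsto_intros S e0)
  from LIMSEQ_le[OF L this] have "(LINT x|lebesgue. indicator ?E x * divergence \<psi> x) \<le> h0 * measure lebesgue ?E"
    using cutoff_divergence_le[OF dim e \<psi>] by auto
  then show "ereal (LINT x:?E|lebesgue. divergence \<psi> x) \<le> ereal (h0 * measure lebesgue ?E)"
    by (simp add: set_lebesgue_integral_def)
qed

end

section \<open>Orthonormal coordinates about a tip axis, and convex regions\<close>

context hex_frame
begin

definition perp :: "nat \<Rightarrow> nat" where
  "perp k = (k + 3) mod 12"

lemma perp_values: "hex_cos (perp k) = - hex_sin k" "hex_sin (perp k) = hex_cos k" if "k < 12"
  using less_12_cases[OF that] by (auto simp: perp_def)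

lemma cone_dual:
  assumes c: "(k, j, s) \<in> set hex_cones"
  shows "x \<bullet> dual_reent k s = 2 * s * (x \<bullet> dir (perp k))"
    "x \<bullet> dual_tip j s = x \<bullet> dir k - sqrt 3 * s * (x \<bullet> dir (perp k))"
proof -
  show r: "x \<bullet> dual_reent k s = 2 * s * (x \<bullet> dir (perp k))"
    unfolding inner_dual_reent inner_dir using perp_values[of k] hex_cones_cases[OF c] by simp
  have "x \<bullet> dir k = ((x \<bullet> dual_tip j s) *\<^sub>R dir k + (x \<bullet> dual_reent k s) *\<^sub>R dir j) \<bullet> dir k"
    by (rule arg_cong[OF cone_decomp[OF c]])
  also have "\<dots> = (x \<bullet> dual_tip j s) + (x \<bullet> dual_reent k s) * (sqrt 3 / 2)"
    by (simp add: inner_add_left dual_dir[OF c])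
  finally have "x \<bullet> dir k = (x \<bullet> dual_tip j s) + (x \<bullet> dual_reent k s) * (sqrt 3 / 2)" .
  then show "x \<bullet> dual_tip j s = x \<bullet> dir k - sqrt 3 * s * (x \<bullet> dir (perp k))"
    unfolding r by simp
qed

text \<open>The two mirror cones at a tip axis form a sector of 60 degrees; there the skew
  coordinates depend only on the position along the axis and the distance from it.\<close>

lemma sector_parts:
  assumes k: "k < 12" "even k" and y: "sqrt 3 * \<bar>y \<bullet> dir (perp k)\<bar> \<le> y \<bullet> dir k"
  shows "tip_part y = y \<bullet> dir k - sqrt 3 * \<bar>y \<bullet> dir (perp k)\<bar>" "reent_part y = 2 * \<bar>y \<bullet> dir (perp k)\<bar>"
proof -
  define s :: real where "s = (if 0 \<le> y \<bullet> dir (perp k) then 1 else -1)"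
  have "k \<in> {0, 2, 4, 6, 8, 10}" using less_12_cases[OF k(1)] k(2) by auto
  then have "(\<exists>j. (k, j, 1) \<in> set hex_cones) \<and> (\<exists>j. (k, j, -1) \<in> set hex_cones)"
    unfolding hex_cones_def by (elim insertE emptyE) simp_all
  then obtain j where c: "(k, j, s) \<in> set hex_cones" unfolding s_def by metis
  have s: "s * (y \<bullet> dir (perp k)) = \<bar>y \<bullet> dir (perp k)\<bar>" unfolding s_def by auto
  have r: "y \<bullet> dual_reent k s = 2 * \<bar>y \<bullet> dir (perp k)\<bar>"
    unfolding cone_dual[OF c] s[symmetric] by simp
  have t: "y \<bullet> dual_tip j s = y \<bullet> dir k - sqrt 3 * \<bar>y \<bullet> dir (perp k)\<bar>"
    unfolding cone_dual[OF c] s[symmetric] by simp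
  have "in_cone k j s y" unfolding in_cone_def r t using c y by auto
  then show "tip_part y = y \<bullet> dir k - sqrt 3 * \<bar>y \<bullet> dir (perp k)\<bar>" "reent_part y = 2 * \<bar>y \<bullet> dir (perp k)\<bar>"
    using cone_parts r t by auto
qed

text \<open>The regions that are to contain triangles are intersections of half-planes: they are
  convex, so only the three vertices need checking.\<close>

definition half_plane :: "'a \<Rightarrow> 'a \<Rightarrow> real \<Rightarrow> 'a set" where
  "half_plane z v c = {x. v \<bullet> (x - z) \<le> c}"

lemma convex_half_plane: "convex (half_plane z v c)"
proof -
  have "half_plane z v c = {x. v \<bullet> x \<le> c + v \<bullet> z}" unfolding half_plane_def by (auto simp: inner_diff_right)
  then show ?thesis by (simp add: convex_halfspace_le)
qed

text \<open>The rhombus spanned by the centre, a tip and the two adjacent reentrant corners.\<close>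

definition tip_rhombus :: "'a \<Rightarrow> nat \<Rightarrow> 'a set" where
  "tip_rhombus z k = half_plane z (sqrt 3 *\<^sub>R dir (perp k) - dir k) 0 \<inter> half_plane z (- sqrt 3 *\<^sub>R dir (perp k) - dir k) 0
    \<inter> half_plane z (dir k + sqrt 3 *\<^sub>R dir (perp k)) (sqrt 3) \<inter> half_plane z (dir k - sqrt 3 *\<^sub>R dir (perp k)) (sqrt 3)"

text \<open>A convex region around a tip that contains the triangles attached at all later steps.\<close>

definition tip_strip :: "'a \<Rightarrow> nat \<Rightarrow> 'a set" where
  "tip_strip z k = half_plane z (sqrt 3 *\<^sub>R dir (perp k) - dir k) (- (sqrt 3 / 9))
    \<inter> half_plane z (- sqrt 3 *\<^sub>R dir (perp k) - dir k) (- (sqrt 3 / 9))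
    \<inter> half_plane z (dir (perp k)) (1/2) \<inter> half_plane z (- dir (perp k)) (1/2) \<inter> half_plane z (dir k) (sqrt 3)"

lemma convex_tip_rhombus: "convex (tip_rhombus z k)"
  unfolding tip_rhombus_def by (intro convex_Int convex_half_plane)

lemma convex_tip_strip: "convex (tip_strip z k)"
  unfolding tip_strip_def by (intro convex_Int convex_half_plane)

lemma tip_rhombus_iff: "x \<in> tip_rhombus z k \<longleftrightarrow>
    sqrt 3 * \<bar>(x - z) \<bullet> dir (perp k)\<bar> \<le> (x - z) \<bullet> dir k \<and> (x - z) \<bullet> dir k + sqrt 3 * \<bar>(x - z) \<bullet> dir (perp k)\<bar> \<le> sqrt 3"
proof -
  define y where "y = x - z"
  define A where "A = y \<bullet> dir k"
  define B where "B = y \<bullet> dir (perp k)"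
  have "(sqrt 3 *\<^sub>R dir (perp k) - dir k) \<bullet> y = sqrt 3 * B - A"
    "(- sqrt 3 *\<^sub>R dir (perp k) - dir k) \<bullet> y = - (sqrt 3 * B) - A"
    "(dir k + sqrt 3 *\<^sub>R dir (perp k)) \<bullet> y = A + sqrt 3 * B"
    "(dir k - sqrt 3 *\<^sub>R dir (perp k)) \<bullet> y = A - sqrt 3 * B"
    unfolding A_def B_def
    by (simp_all add: inner_commute[of _ y] inner_add_right inner_diff_right)
  moreover have "sqrt 3 * \<bar>B\<bar> = \<bar>sqrt 3 * B\<bar>" by (simp add: abs_mult)
  ultimately show ?thesis
    unfolding tip_rhombus_def half_plane_def Int_iff mem_Collect_eq y_def[symmetric] A_def[symmetric] B_def[symmetric] by auto
qed

lemma tip_strip_iff: "x \<in> tip_strip z k \<longleftrightarrow>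
    sqrt 3 / 9 + sqrt 3 * \<bar>(x - z) \<bullet> dir (perp k)\<bar> \<le> (x - z) \<bullet> dir k \<and> \<bar>(x - z) \<bullet> dir (perp k)\<bar> \<le> 1/2
    \<and> (x - z) \<bullet> dir k \<le> sqrt 3"
proof -
  define y where "y = x - z"
  define A where "A = y \<bullet> dir k"
  define B where "B = y \<bullet> dir (perp k)"
  have "(sqrt 3 *\<^sub>R dir (perp k) - dir k) \<bullet> y = sqrt 3 * B - A"
    "(- sqrt 3 *\<^sub>R dir (perp k) - dir k) \<bullet> y = - (sqrt 3 * B) - A"
    "dir (perp k) \<bullet> y = B" "- dir (perp k) \<bullet> y = - B" "dir k \<bullet> y = A"
    unfolding A_def B_def
    by (simp_all add: inner_commute[of _ y] inner_add_right inner_diff_right)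
  moreover have "sqrt 3 * \<bar>B\<bar> = \<bar>sqrt 3 * B\<bar>" by (simp add: abs_mult)
  ultimately show ?thesis
    unfolding tip_strip_def half_plane_def Int_iff mem_Collect_eq y_def[symmetric] A_def[symmetric] B_def[symmetric] by auto
qed

lemma tip_rhombus_hull_dom:
  assumes k: "k < 12" "even k" and x: "x \<in> tip_rhombus z k"
  shows "hull_dom (x - z)"
proof -
  define X where "X = (x - z) \<bullet> dir k"
  define Y where "Y = \<bar>(x - z) \<bullet> dir (perp k)\<bar>"
  have h: "sqrt 3 * Y \<le> X" "X + sqrt 3 * Y \<le> sqrt 3" using x unfolding tip_rhombus_iff X_def Y_def by auto
  have parts: "tip_part (x - z) = X - sqrt 3 * Y" "reent_part (x - z) = 2 * Y"
    using sector_parts[OF k] h(1) unfolding X_def Y_def by auto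
  have "sqrt 3 / 3 * (X + sqrt 3 * Y) \<le> sqrt 3 / 3 * sqrt 3" using h(2) by (intro mult_left_mono) auto
  moreover have "sqrt 3 / 3 * (X + sqrt 3 * Y) = sqrt 3 / 3 * (X - sqrt 3 * Y) + 2 * Y"
    by (simp add: right_diff_distrib distrib_left sqrt3_mult)
  ultimately show ?thesis unfolding hull_dom_def parts by simp
qed

lemma tip_strip_hull_dom:
  assumes k: "k < 12" "even k" and x: "x \<in> tip_strip z k"
  shows "hull_dom (x - z)"
proof -
  define X where "X = (x - z) \<bullet> dir k"
  define Y where "Y = \<bar>(x - z) \<bullet> dir (perp k)\<bar>"
  have h: "sqrt 3 / 9 + sqrt 3 * Y \<le> X" "Y \<le> 1/2" "X \<le> sqrt 3" using x unfolding tip_strip_iff X_def Y_def by auto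
  have Y0: "0 \<le> sqrt 3 * Y" unfolding Y_def by simp
  have s: "sqrt 3 * Y \<le> X" using h(1) real_sqrt_ge_zero[of 3] by linarith
  have parts: "tip_part (x - z) = X - sqrt 3 * Y" "reent_part (x - z) = 2 * Y"
    using sector_parts[OF k] s unfolding X_def Y_def by auto
  show ?thesis unfolding hull_dom_def parts using h Y0 by auto
qed

text \<open>The lines with normals \<open>dir 2\<close>, \<open>dir 6\<close> and
  \<open>dir 10\<close> at distance sqrt 3 / 2 from the centre carry the sides of the base triangle.
  In each cone one of them suffices: it carries a side of the hexagram if \<open>k\<close> is a
  vertex direction of the triangle, and otherwise it gives the stronger bound 2 p + sqrt 3 q at most
  sqrt 3.\<close>

lemma triangle_hull_dom:
  assumes "\<And>m. m \<in> {2, 6, 10} \<Longrightarrow> (x - z) \<bullet> dir m \<le> sqrt 3 / 2"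
  shows "hull_dom (x - z)"
proof -
  obtain k j s where c: "in_cone k j s (x - z)" by (rule cone_exists)
  then have c': "(k, j, s) \<in> set hex_cones" unfolding in_cone_def by simp
  define p where "p = tip_part (x - z)"
  define q where "q = reent_part (x - z)"
  have pq: "0 \<le> p" "0 \<le> q" unfolding p_def q_def by (rule parts_nonneg)+
  have y: "x - z = p *\<^sub>R dir k + q *\<^sub>R dir j"
    using cone_decomp[OF c', of "x - z"] unfolding p_def q_def cone_parts[OF c] .
  have d: "(x - z) \<bullet> dir m = p * (hex_cos k * hex_cos m + hex_sin k * hex_sin m)
      + q * (hex_cos j * hex_cos m + hex_sin j * hex_sin m)" for m
    unfolding y inner_dir by (simp add: inner_add_left dir_u dir_w algebra_simps)
  have "p + sqrt 3 * q \<le> sqrt 3 \<or> 2 * p + sqrt 3 * q \<le> sqrt 3"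
  proof -
    have d2: "p * (hex_cos k * hex_cos 2 + hex_sin k * hex_sin 2) + q * (hex_cos j * hex_cos 2 + hex_sin j * hex_sin 2) \<le> sqrt 3 / 2"
      using assms[of 2] d[of 2] by simp
    have d6: "p * (hex_cos k * hex_cos 6 + hex_sin k * hex_sin 6) + q * (hex_cos j * hex_cos 6 + hex_sin j * hex_sin 6) \<le> sqrt 3 / 2"
      using assms[of 6] d[of 6] by simp
    have d10: "p * (hex_cos k * hex_cos 10 + hex_sin k * hex_sin 10) + q * (hex_cos j * hex_cos 10 + hex_sin j * hex_sin 10) \<le> sqrt 3 / 2"
      using assms[of 10] d[of 10] by simp
    show ?thesis using c' d2 d6 d10 unfolding hex_cones_def
      by (auto simp: algebra_simps)
  qed
  then have pq3: "p + sqrt 3 * q \<le> sqrt 3" using pq by auto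
  have "sqrt 3 / 3 * (p + sqrt 3 * q) \<le> sqrt 3 / 3 * sqrt 3" using pq3 by (intro mult_left_mono) auto
  then show ?thesis unfolding hull_dom_def p_def[symmetric] q_def[symmetric] by (simp add: distrib_left sqrt3_mult)
qed

end

section \<open>Koch regions\<close>

lemma rotate_right_linear:
  "rotate_right (x + y) = rotate_right x + rotate_right y"
  "rotate_right (x - y) = rotate_right x - rotate_right y"
  "rotate_right (c *\<^sub>R x) = c *\<^sub>R rotate_right x"
  "rotate_right (- x) = - rotate_right x"
  by (simp_all add: rotate_right_def vec_eq_iff forall_2)

text \<open>The assumptions fix the orientation: \<open>w\<close> is \<open>u\<close> turned
  counterclockwise, so that \<open>outer_apex\<close> lies on the exterior side of counterclockwise
  sides.\<close>

locale hex_plane = hex_frame u w for u w :: "real^2" +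
  assumes rot_u: "rotate_right u = - w" and rot_w: "rotate_right w = u"
begin

lemma rot_dir:
  assumes "k < 12"
  shows "rotate_right (dir k) = - dir (perp k)" "rotate_right (dir (perp k)) = dir k"
  unfolding dir_def perp_values[OF assms]
  by (simp_all add: rotate_right_linear rot_u rot_w algebra_simps)

text \<open>With sqrt 3 absorbed into the first coordinate, all vertices that occur are rational,
  and thirds and apexes are computed in rational arithmetic.\<close>

definition pt :: "nat \<Rightarrow> real^2 \<Rightarrow> real \<Rightarrow> real \<Rightarrow> real^2" where
  "pt k z a b = z + (sqrt 3 * a) *\<^sub>R dir k + b *\<^sub>R dir (perp k)"

definition tip :: "real^2 \<Rightarrow> nat \<Rightarrow> real^2" where
  "tip z k = z + sqrt 3 *\<^sub>R dir k"

definition reent :: "real^2 \<Rightarrow> nat \<Rightarrow> real^2" where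
  "reent z k = z + dir k"

lemma pt_inner:
  assumes "k < 12"
  shows "(pt k z a b - z) \<bullet> dir k = sqrt 3 * a" "(pt k z a b - z) \<bullet> dir (perp k) = b"
proof -
  have n: "(hex_cos k)\<^sup>2 + (hex_sin k)\<^sup>2 = 1"
    using less_12_cases[OF assms] by (auto simp: power_divide)
  have "dir k \<bullet> dir k = 1" "dir (perp k) \<bullet> dir (perp k) = 1"
    "dir k \<bullet> dir (perp k) = 0" "dir (perp k) \<bullet> dir k = 0"
    unfolding inner_dir using n by (simp_all add: dir_u dir_w perp_values[OF assms] power2_eq_square algebra_simps)
  then show "(pt k z a b - z) \<bullet> dir k = sqrt 3 * a" "(pt k z a b - z) \<bullet> dir (perp k) = b"
    unfolding pt_def by (simp_all add: inner_add_left)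
qed

lemma pt_thirds:
  "first_third (pt k z a b, pt k z c d) = pt k z (a + (c - a) / 3) (b + (d - b) / 3)"
  "second_third (pt k z a b, pt k z c d) = pt k z (a + 2 * (c - a) / 3) (b + 2 * (d - b) / 3)"
proof -
  have d: "pt k z c d - pt k z a b = (sqrt 3 * (c - a)) *\<^sub>R dir k + (d - b) *\<^sub>R dir (perp k)"
    unfolding pt_def by (simp add: algebra_simps)
  show "first_third (pt k z a b, pt k z c d) = pt k z (a + (c - a) / 3) (b + (d - b) / 3)"
    unfolding first_third_def fst_conv snd_conv d
    by (simp add: pt_def scaleR_add_right scaleR_add_left distrib_left)
  show "second_third (pt k z a b, pt k z c d) = pt k z (a + 2 * (c - a) / 3) (b + 2 * (d - b) / 3)"
    unfolding second_third_def fst_conv snd_conv d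
    by (simp add: pt_def scaleR_add_right scaleR_add_left distrib_left)
qed

lemma pt_apex:
  assumes "k < 12"
  shows "outer_apex (pt k z a b, pt k z c d) = pt k z ((a + c) / 2 + (d - b) / 6) ((b + d) / 2 - (c - a) / 2)"
proof -
  have d: "pt k z c d - pt k z a b = (sqrt 3 * (c - a)) *\<^sub>R dir k + (d - b) *\<^sub>R dir (perp k)"
    unfolding pt_def by (simp add: algebra_simps)
  have m: "midpoint (pt k z a b) (pt k z c d) = pt k z ((a + c) / 2) ((b + d) / 2)"
  proof -
    have "2 *\<^sub>R pt k z ((a + c) / 2) ((b + d) / 2) = 2 *\<^sub>R z + (sqrt 3 * (a + c)) *\<^sub>R dir k + (b + d) *\<^sub>R dir (perp k)"
      unfolding pt_def by (simp add: scaleR_add_right)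
    also have "\<dots> = pt k z a b + pt k z c d"
      unfolding pt_def by (simp add: distrib_left scaleR_add_left scaleR_2)
    finally have "pt k z a b + pt k z c d = 2 *\<^sub>R pt k z ((a + c) / 2) ((b + d) / 2)" by simp
    then show ?thesis unfolding midpoint_def by simp
  qed
  have r: "rotate_right (pt k z c d - pt k z a b) = (d - b) *\<^sub>R dir k - (sqrt 3 * (c - a)) *\<^sub>R dir (perp k)"
    unfolding d by (simp only: rotate_right_linear rot_dir[OF assms]) (simp add: algebra_simps)
  have "sqrt 3 / 6 * (sqrt 3 * (c - a)) = (c - a) / 2" by (simp add: sqrt3_mult)
  then have "(sqrt 3 / 6) *\<^sub>R rotate_right (pt k z c d - pt k z a b)
      = (sqrt 3 * ((d - b) / 6)) *\<^sub>R dir k - ((c - a) / 2) *\<^sub>R dir (perp k)"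
    unfolding r scaleR_diff_right scaleR_scaleR by simp
  then show ?thesis unfolding outer_apex_def fst_conv snd_conv m
    by (simp only: pt_def distrib_left scaleR_add_left scaleR_diff_left) simp
qed

lemma pt_in_tip_strip:
  assumes "k < 12" "1/9 + \<bar>b\<bar> \<le> a" "\<bar>b\<bar> \<le> 1/2" "a \<le> 1"
  shows "pt k z a b \<in> tip_strip z k"
proof -
  have "sqrt 3 * (1/9 + \<bar>b\<bar>) \<le> sqrt 3 * a" using assms by (intro mult_left_mono) auto
  then show ?thesis unfolding tip_strip_iff pt_inner[OF assms(1)] using assms
    by (simp add: distrib_left)
qed

lemma hull3_subset:
  assumes "convex S" "p \<in> S" "q \<in> S" "r \<in> S"
  shows "convex hull {p, q, r} \<subseteq> S"
  using assms by (intro hull_minimal) auto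

lemma attached_triangle_pt:
  assumes "k < 12"
  shows "attached_triangle (pt k z a b, pt k z c d) = convex hull {pt k z (a + (c - a) / 3) (b + (d - b) / 3),
    pt k z ((a + c) / 2 + (d - b) / 6) ((b + d) / 2 - (c - a) / 2), pt k z (a + 2 * (c - a) / 3) (b + 2 * (d - b) / 3)}"
  unfolding attached_triangle_def pt_thirds pt_apex[OF assms] ..

lemma new_sides_pt:
  assumes "k < 12"
  shows "new_sides (pt k z a b, pt k z c d) = {(pt k z a b, pt k z (a + (c - a) / 3) (b + (d - b) / 3)),
    (pt k z (a + (c - a) / 3) (b + (d - b) / 3), pt k z ((a + c) / 2 + (d - b) / 6) ((b + d) / 2 - (c - a) / 2)),
    (pt k z ((a + c) / 2 + (d - b) / 6) ((b + d) / 2 - (c - a) / 2), pt k z (a + 2 * (c - a) / 3) (b + 2 * (d - b) / 3)),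
    (pt k z (a + 2 * (c - a) / 3) (b + 2 * (d - b) / 3), pt k z c d)}"
  unfolding new_sides_def pt_thirds pt_apex[OF assms] fst_conv snd_conv ..

lemma attached_triangle_in_tip_strip:
  assumes k: "k < 12"
    and v: "1/9 + \<bar>b + (d - b) / 3\<bar> \<le> a + (c - a) / 3" "\<bar>b + (d - b) / 3\<bar> \<le> 1/2" "a + (c - a) / 3 \<le> 1"
      "1/9 + \<bar>(b + d) / 2 - (c - a) / 2\<bar> \<le> (a + c) / 2 + (d - b) / 6" "\<bar>(b + d) / 2 - (c - a) / 2\<bar> \<le> 1/2"
      "(a + c) / 2 + (d - b) / 6 \<le> 1"
      "1/9 + \<bar>b + 2 * (d - b) / 3\<bar> \<le> a + 2 * (c - a) / 3" "\<bar>b + 2 * (d - b) / 3\<bar> \<le> 1/2" "a + 2 * (c - a) / 3 \<le> 1"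
  shows "attached_triangle (pt k z a b, pt k z c d) \<subseteq> tip_strip z k"
  unfolding attached_triangle_pt[OF k]
  by (intro hull3_subset convex_tip_strip pt_in_tip_strip k v)

text \<open>The bounds of the strip are attained: 1/9 by the step 4 triangle next to the reentrant
  corner, 1/2 by apexes, among them that of step 3.\<close>

lemma sides_in_tip_strip:
  assumes k: "k < 12" and s: "s0 = (pt k z 1 0, pt k z (1/2) (1/2)) \<or> s0 = (pt k z (1/2) (-1/2), pt k z 1 0)"
    "s \<in> insert s0 (new_sides s0)"
  shows "attached_triangle s \<subseteq> tip_strip z k"
proof -
  have "s \<in> insert (pt k z 1 0, pt k z (1/2) (1/2)) (new_sides (pt k z 1 0, pt k z (1/2) (1/2)))
      \<or> s \<in> insert (pt k z (1/2) (-1/2), pt k z 1 0) (new_sides (pt k z (1/2) (-1/2), pt k z 1 0))"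
    using s by auto
  then show ?thesis unfolding new_sides_pt[OF k]
    by (elim disjE insertE emptyE) (simp_all only:, (rule attached_triangle_in_tip_strip[OF k]; simp)+)
qed

lemma hex_next:
  assumes "k < 12"
  shows "hex_cos ((k + 1) mod 12) = sqrt 3 / 2 * hex_cos k - hex_sin k / 2"
    "hex_sin ((k + 1) mod 12) = sqrt 3 / 2 * hex_sin k + hex_cos k / 2"
    "hex_cos ((k + 11) mod 12) = sqrt 3 / 2 * hex_cos k + hex_sin k / 2"
    "hex_sin ((k + 11) mod 12) = sqrt 3 / 2 * hex_sin k - hex_cos k / 2"
  using less_12_cases[OF assms] by (auto simp: numeral_2_eq_2[symmetric])

lemma dir_next:
  assumes "k < 12"
  shows "dir ((k + 1) mod 12) = (sqrt 3 / 2) *\<^sub>R dir k + (1/2) *\<^sub>R dir (perp k)"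
    "dir ((k + 11) mod 12) = (sqrt 3 / 2) *\<^sub>R dir k - (1/2) *\<^sub>R dir (perp k)"
  unfolding dir_def hex_next[OF assms] perp_values[OF assms]
  by (simp_all add: scaleR_add_left scaleR_diff_left scaleR_add_right scaleR_diff_right)

lemma side_pt:
  assumes "k < 12"
  shows "tip z k = pt k z 1 0" "reent z ((k + 1) mod 12) = pt k z (1/2) (1/2)"
    "reent z ((k + 11) mod 12) = pt k z (1/2) (-1/2)"
  unfolding tip_def reent_def pt_def dir_next[OF assms] by simp_all

lemma base_points:
  "tip z 0 = pt 0 z 1 0" "tip z 2 = pt 0 z (1/2) (3/2)" "tip z 4 = pt 0 z (-1/2) (3/2)" "tip z 6 = pt 0 z (-1) 0"
  "tip z 8 = pt 0 z (-1/2) (-3/2)" "tip z 10 = pt 0 z (1/2) (-3/2)"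
  "reent z 1 = pt 0 z (1/2) (1/2)" "reent z 3 = pt 0 z 0 1" "reent z 5 = pt 0 z (-1/2) (1/2)"
  "reent z 7 = pt 0 z (-1/2) (-1/2)" "reent z 9 = pt 0 z 0 (-1)" "reent z 11 = pt 0 z (1/2) (-1/2)"
  unfolding tip_def reent_def pt_def dir_def perp_def
  by (simp_all add: scaleR_add_right scaleR_diff_right)

definition base_sides :: "real^2 \<Rightarrow> ((real^2) \<times> (real^2)) set" where
  "base_sides z = {(tip z 0, tip z 4), (tip z 4, tip z 8), (tip z 8, tip z 0)}"

definition star_sides :: "real^2 \<Rightarrow> ((real^2) \<times> (real^2)) set" where
  "star_sides z = {(tip z 0, reent z 1), (reent z 1, tip z 2), (tip z 2, reent z 3), (reent z 3, tip z 4),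
    (tip z 4, reent z 5), (reent z 5, tip z 6), (tip z 6, reent z 7), (reent z 7, tip z 8),
    (tip z 8, reent z 9), (reent z 9, tip z 10), (tip z 10, reent z 11), (reent z 11, tip z 0)}"

lemma base_attached:
  "attached_triangle (tip z 0, tip z 4) = convex hull {reent z 1, tip z 2, reent z 3}"
  "attached_triangle (tip z 4, tip z 8) = convex hull {reent z 5, tip z 6, reent z 7}"
  "attached_triangle (tip z 8, tip z 0) = convex hull {reent z 9, tip z 10, reent z 11}"
  unfolding attached_triangle_def base_points by (simp_all add: pt_thirds pt_apex)

lemma base_new_sides: "(\<Union>s\<in>base_sides z. new_sides s) = star_sides z"
  unfolding base_sides_def star_sides_def new_sides_def base_points by (auto simp: pt_thirds pt_apex)

lemma star_side_cases:
  assumes "s \<in> star_sides z"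
  obtains k where "k < 12" "even k" "s = (pt k z 1 0, pt k z (1/2) (1/2)) \<or> s = (pt k z (1/2) (-1/2), pt k z 1 0)"
proof -
  have "\<exists>k\<in>{0,2,4,6,8,10}. s = (tip z k, reent z ((k + 1) mod 12)) \<or> s = (reent z ((k + 11) mod 12), tip z k)"
    using assms unfolding star_sides_def by auto
  then obtain k where k: "k \<in> {0,2,4,6,8,10}" "s = (tip z k, reent z ((k + 1) mod 12)) \<or> s = (reent z ((k + 11) mod 12), tip z k)"
    by blast
  then have k12: "k < 12" "even k" by auto
  show ?thesis using that[OF k12] k(2) unfolding side_pt[OF k12(1)] by blast
qed

text \<open>The case \<open>s' = s\<close> supplies the triangles of step 3, the new sides of
  \<open>s\<close> those of step 4.\<close>

lemma star_triangles:
  assumes "s \<in> star_sides z" "s' \<in> insert s (new_sides s)"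
  shows "attached_triangle s' \<subseteq> {x. hull_dom (x - z)}"
proof -
  obtain k where k: "k < 12" "even k" "s = (pt k z 1 0, pt k z (1/2) (1/2)) \<or> s = (pt k z (1/2) (-1/2), pt k z 1 0)"
    by (rule star_side_cases[OF assms(1)]) blast
  then have "attached_triangle s' \<subseteq> tip_strip z k" using sides_in_tip_strip[OF k(1,3)] assms(2) by blast
  then show ?thesis using tip_strip_hull_dom[OF k(1,2)] by blast
qed

lemma star_tip_triangle:
  assumes k: "k < 12" "even k"
  shows "convex hull {reent z ((k + 11) mod 12), tip z k, reent z ((k + 1) mod 12)} \<subseteq> tip_rhombus z k"
  unfolding side_pt[OF k(1)]
  by (intro hull3_subset convex_tip_rhombus) (auto simp: tip_rhombus_iff pt_inner[OF k(1)])

lemma base_triangles: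
  assumes "s \<in> base_sides z"
  shows "attached_triangle s \<subseteq> {x. hull_dom (x - z)}"
proof -
  have "attached_triangle s \<subseteq> tip_rhombus z 2 \<or> attached_triangle s \<subseteq> tip_rhombus z 6 \<or> attached_triangle s \<subseteq> tip_rhombus z 10"
    using assms star_tip_triangle[of 2 z] star_tip_triangle[of 6 z] star_tip_triangle[of 10 z]
    unfolding base_sides_def by (auto simp: base_attached)
  then show ?thesis
    using tip_rhombus_hull_dom[of 2 _ z] tip_rhombus_hull_dom[of 6 _ z] tip_rhombus_hull_dom[of 10 _ z] by auto
qed

lemma base_triangle_hull_dom: "convex hull {tip z 0, tip z 4, tip z 8} \<subseteq> {x. hull_dom (x - z)}"
proof -
  have "convex hull {tip z 0, tip z 4, tip z 8} \<subseteq> half_plane z (dir m) (sqrt 3 / 2)" if "m \<in> {2, 6, 10}" for m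
    using that by (intro hull3_subset convex_half_plane)
      (auto simp: half_plane_def tip_def inner_dir dir_u dir_w)
  then show ?thesis
    by (intro subsetI CollectI triangle_hull_dom) (auto simp: half_plane_def inner_commute)
qed

lemma closed_hull_dom: "closed {x. hull_dom (x - z)}"
  using compact_hull_dom compact_imp_closed by blast

context
  fixes a b c z :: "real^2"
  assumes sides: "triangle_sides a b c = base_sides z" and abc: "{a, b, c} = {tip z 0, tip z 4, tip z 8}"
begin

lemma koch_sides_1: "koch_sides_after a b c (Suc 0) = star_sides z"
  using base_new_sides sides by simp

lemma koch_region_step:
  assumes "koch_region_after a b c m \<subseteq> {x. hull_dom (x - z)}"
    "\<And>s. s \<in> koch_sides_after a b c m \<Longrightarrow> attached_triangle s \<subseteq> {x. hull_dom (x - z)}"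
  shows "koch_region_after a b c (Suc m) \<subseteq> {x. hull_dom (x - z)}"
proof -
  have "closure (koch_region_after a b c m) \<subseteq> {x. hull_dom (x - z)}"
    using assms(1) closed_hull_dom by (rule closure_minimal)
  then have "closure (koch_region_after a b c m) \<union> (\<Union>s\<in>koch_sides_after a b c m. attached_triangle s) \<subseteq> {x. hull_dom (x - z)}"
    using assms(2) by blast
  then show ?thesis using interior_subset by (simp only: koch_region_after.simps) blast
qed

lemma koch_region_hull_dom:
  "koch_region_after a b c 1 \<subseteq> {x. hull_dom (x - z)}" "koch_region_after a b c 2 \<subseteq> {x. hull_dom (x - z)}"
  "koch_region_after a b c 3 \<subseteq> {x. hull_dom (x - z)}"
proof -
  have 0: "koch_region_after a b c 0 \<subseteq> {x. hull_dom (x - z)}"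
    using base_triangle_hull_dom[of z] interior_subset unfolding koch_region_after.simps abc by blast
  have 1: "koch_region_after a b c (Suc 0) \<subseteq> {x. hull_dom (x - z)}"
    by (rule koch_region_step[OF 0]) (use base_triangles sides in auto)
  have 2: "koch_region_after a b c (Suc (Suc 0)) \<subseteq> {x. hull_dom (x - z)}"
  proof (rule koch_region_step[OF 1])
    fix s assume "s \<in> koch_sides_after a b c (Suc 0)"
    then show "attached_triangle s \<subseteq> {x. hull_dom (x - z)}"
      unfolding koch_sides_1 by (rule star_triangles) simp
  qed
  have 3: "koch_region_after a b c (Suc (Suc (Suc 0))) \<subseteq> {x. hull_dom (x - z)}"
  proof (rule koch_region_step[OF 2])
    fix s assume "s \<in> koch_sides_after a b c (Suc (Suc 0))"
    then obtain s0 where "s0 \<in> star_sides z" "s \<in> new_sides s0"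
      unfolding koch_sides_after.simps(2)[of a b c "Suc 0"] koch_sides_1 by blast
    then show "attached_triangle s \<subseteq> {x. hull_dom (x - z)}" using star_triangles by blast
  qed
  show "koch_region_after a b c 1 \<subseteq> {x. hull_dom (x - z)}" "koch_region_after a b c 2 \<subseteq> {x. hull_dom (x - z)}"
    "koch_region_after a b c 3 \<subseteq> {x. hull_dom (x - z)}" using 1 2 3 by (simp_all add: numeral_eq_Suc)
qed

end

end

section \<open>E inside K_2, and the Cheeger constant\<close>

context hex_plane
begin

text \<open>One sandwich for all three regions: \<open>perimeter_ge\<close> bounds every competitor
  from below, and E reaches the bound.\<close>

lemma cheeger_constant_between:
  assumes "cheeger_set z \<subseteq> \<Omega>" "\<Omega> \<subseteq> {x. hull_dom (x - z)}"
  shows "cheeger_constant \<Omega> = ereal h0"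
  unfolding cheeger_constant_def
proof (rule antisym)
  let ?F = "{F. F \<subseteq> \<Omega> \<and> F \<in> lmeasurable \<and> measure lebesgue F > 0}"
  show "ereal h0 \<le> (INF F\<in>?F. perimeter F / ereal (measure lebesgue F))"
  proof (rule INF_greatest)
    fix F assume F: "F \<in> ?F"
    then have "ereal (h0 * measure lebesgue F) \<le> perimeter F"
      using assms(2) by (intro perimeter_ge[of F z]) auto
    then have "ereal (h0 * measure lebesgue F) / ereal (measure lebesgue F) \<le> perimeter F / ereal (measure lebesgue F)"
      using F by (intro ereal_divide_right_mono) auto
    then show "ereal h0 \<le> perimeter F / ereal (measure lebesgue F)" using F by simp
  qed
  have E: "cheeger_set z \<in> ?F"
    using assms(1) cheeger_set_lmeasurable measure_cheeger_set_pos by auto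
  have "perimeter (cheeger_set z) / ereal (measure lebesgue (cheeger_set z))
      \<le> ereal (h0 * measure lebesgue (cheeger_set z)) / ereal (measure lebesgue (cheeger_set z))"
    using measure_cheeger_set_pos by (intro ereal_divide_right_mono perimeter_cheeger_set_le) auto
  also have "\<dots> = ereal h0" using measure_cheeger_set_pos[of z] by simp
  finally have "perimeter (cheeger_set z) / ereal (measure lebesgue (cheeger_set z)) \<le> ereal h0" .
  then show "(INF F\<in>?F. perimeter F / ereal (measure lebesgue F)) \<le> ereal h0"
    using INF_lower[OF E, of "\<lambda>F. perimeter F / ereal (measure lebesgue F)"] by (rule order_trans[rotated])
qed

lemma hull_combination:
  assumes S: "convex S" and p: "x1 \<in> S" "x2 \<in> S" "x3 \<in> S" and c: "0 \<le> \<alpha>" "0 \<le> \<beta>" "0 \<le> \<gamma>" "\<alpha> + \<beta> + \<gamma> = 1"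
  shows "\<alpha> *\<^sub>R x1 + \<beta> *\<^sub>R x2 + \<gamma> *\<^sub>R x3 \<in> S"
proof -
  have "\<alpha> *\<^sub>R x1 + \<beta> *\<^sub>R x2 + \<gamma> *\<^sub>R x3 \<in> convex hull {x1, x2, x3}"
    unfolding convex_hull_3 using c by blast
  then show ?thesis using hull3_subset[OF S p] by blast
qed

abbreviation base_triangle :: "real^2 \<Rightarrow> (real^2) set" where
  "base_triangle z \<equiv> convex hull {tip z 0, tip z 4, tip z 8}"

text \<open>The reentrant corners are the trisection points of the sides, which gives the
  barycentric weights.\<close>

lemma base_triangle_points:
  "z \<in> base_triangle z" "k < 12 \<Longrightarrow> odd k \<Longrightarrow> reent z k \<in> base_triangle z"
proof -
  have v: "tip z 0 \<in> base_triangle z" "tip z 4 \<in> base_triangle z" "tip z 8 \<in> base_triangle z"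
    by (auto intro: hull_inc)
  note comb = hull_combination[OF convex_convex_hull v]
  have pt: "\<alpha> *\<^sub>R tip z 0 + \<beta> *\<^sub>R tip z 4 + \<gamma> *\<^sub>R tip z 8
      = pt 0 z (\<alpha> - \<beta> / 2 - \<gamma> / 2) (3/2 * \<beta> - 3/2 * \<gamma>)" if "\<alpha> + \<beta> + \<gamma> = 1" for \<alpha> \<beta> \<gamma>
  proof -
    have "\<alpha> *\<^sub>R tip z 0 + \<beta> *\<^sub>R tip z 4 + \<gamma> *\<^sub>R tip z 8
      = (\<alpha> + \<beta> + \<gamma>) *\<^sub>R z + (sqrt 3 * (\<alpha> - \<beta> / 2 - \<gamma> / 2)) *\<^sub>R dir 0 + (3/2 * \<beta> - 3/2 * \<gamma>) *\<^sub>R dir (perp 0)"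
      unfolding base_points pt_def
      by (simp add: scaleR_add_right scaleR_add_left scaleR_diff_left scaleR_diff_right right_diff_distrib distrib_left mult_ac)
    then show ?thesis unfolding that pt_def by simp
  qed
  have inT: "pt 0 z a b \<in> base_triangle z"
    if "a = \<alpha> - \<beta> / 2 - \<gamma> / 2" "b = 3/2 * \<beta> - 3/2 * \<gamma>" "0 \<le> \<alpha>" "0 \<le> \<beta>" "0 \<le> \<gamma>" "\<alpha> + \<beta> + \<gamma> = 1" for a b \<alpha> \<beta> \<gamma>
    using comb[OF that(3-6)] pt[OF that(6)] that(1,2) by simp
  have "pt 0 z 0 0 \<in> base_triangle z" by (rule inT[of _ "1/3" "1/3" "1/3"]) auto
  then show "z \<in> base_triangle z" by (simp add: pt_def)
  assume k: "k < 12" "odd k"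
  have "reent z 1 \<in> base_triangle z" unfolding base_points(7) by (rule inT[of _ "2/3" "1/3" 0]) auto
  moreover have "reent z 3 \<in> base_triangle z" unfolding base_points(8) by (rule inT[of _ "1/3" "2/3" 0]) auto
  moreover have "reent z 5 \<in> base_triangle z" unfolding base_points(9) by (rule inT[of _ 0 "2/3" "1/3"]) auto
  moreover have "reent z 7 \<in> base_triangle z" unfolding base_points(10) by (rule inT[of _ 0 "1/3" "2/3"]) auto
  moreover have "reent z 9 \<in> base_triangle z" unfolding base_points(11) by (rule inT[of _ "1/3" 0 "2/3"]) auto
  moreover have "reent z 11 \<in> base_triangle z" unfolding base_points(12) by (rule inT[of _ "2/3" 0 "1/3"]) auto
  moreover have "k \<in> {1, 3, 5, 7, 9, 11}" using less_12_cases[OF k(1)] k(2) by auto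
  ultimately show "reent z k \<in> base_triangle z" by auto
qed

text \<open>Let \<open>i\<close> be the other reentrant direction next to \<open>k\<close>; then
  \<open>dir i + dir j\<close> is sqrt 3 times \<open>dir k\<close>. A point in the central hexagon
  lies in the triangle of the centre and the two corners, any other one in the tip triangle, and the
  weights can be read off. The second claim supplies a neighbourhood of the centre.\<close>

lemma hexagram_cover:
  assumes x: "tip_part (x - z) < sqrt 3 * (1 - reent_part (x - z))"
  shows "x \<in> base_triangle z \<union> (\<Union>s\<in>base_sides z. attached_triangle s)"
    "tip_part (x - z) + reent_part (x - z) \<le> 1/2 \<Longrightarrow> x \<in> base_triangle z"
proof -
  obtain k j s where c: "in_cone k j s (x - z)" by (rule cone_exists)
  then have c': "(k, j, s) \<in> set hex_cones" unfolding in_cone_def by simp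
  note cc = hex_cones_cases[OF c']
  define p where "p = tip_part (x - z)"
  define q where "q = reent_part (x - z)"
  have pq: "0 \<le> p" "0 \<le> q" unfolding p_def q_def by (rule parts_nonneg)+
  have lt: "p < sqrt 3 * (1 - q)" using x unfolding p_def q_def .
  have y: "x - z = p *\<^sub>R dir k + q *\<^sub>R dir j"
    using cone_decomp[OF c', of "x - z"] unfolding p_def q_def cone_parts[OF c] .
  define P where "P = sqrt 3 / 3 * p"
  have "sqrt 3 / 3 * p \<le> sqrt 3 / 3 * (sqrt 3 * (1 - q))" using lt by (intro mult_left_mono) auto
  then have P: "0 \<le> P" "P + q \<le> 1" using pq unfolding P_def by (auto simp: sqrt3_mult)
  have Pp: "P * sqrt 3 = p" unfolding P_def by (simp add: sqrt3_mult mult.commute)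
  define i where "i = (if s = 1 then (k + 11) mod 12 else (k + 1) mod 12)"
  have i: "i < 12" "odd i" and ij: "dir i + dir j = sqrt 3 *\<^sub>R dir k"
  proof -
    show "i < 12" unfolding i_def by simp
    show "odd i" using c' unfolding i_def hex_cones_def by auto
    have "j = (if s = 1 then (k + 1) mod 12 else (k + 11) mod 12)" using c' unfolding hex_cones_def by auto
    moreover have "dir ((k + 11) mod 12) + dir ((k + 1) mod 12) = sqrt 3 *\<^sub>R dir k"
    proof -
      have "A - B + (A + B) = A + A" for A B :: "real^2" by simp
      moreover have "(sqrt 3 / 2) *\<^sub>R dir k + (sqrt 3 / 2) *\<^sub>R dir k = sqrt 3 *\<^sub>R dir k"
        by (subst scaleR_add_left[symmetric]) simp
      ultimately show ?thesis unfolding dir_next[OF cc(1)] by (simp only:)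
    qed
    ultimately show "dir i + dir j = sqrt 3 *\<^sub>R dir k"
      by (cases "s = 1") (simp_all add: i_def add.commute)
  qed
  have tk: "tip z k = z + (dir i + dir j)" unfolding tip_def ij ..
  have pk: "p *\<^sub>R dir k = P *\<^sub>R (dir i + dir j)" unfolding ij using Pp by simp
  have x0: "x = z + P *\<^sub>R (dir i + dir j) + q *\<^sub>R dir j" using y unfolding pk by (simp add: algebra_simps)
  have inner: "x \<in> base_triangle z" if h: "2 * P + q \<le> 1"
  proof -
    have "x = P *\<^sub>R reent z i + (P + q) *\<^sub>R reent z j + (1 - (2 * P + q)) *\<^sub>R z"
      unfolding x0 reent_def by (simp add: vec_eq_iff algebra_simps)
    also have "\<dots> \<in> base_triangle z"
      by (rule hull_combination[OF convex_convex_hull]) (use base_triangle_points i cc h P pq in auto)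
    finally show ?thesis .
  qed
  show "x \<in> base_triangle z" if "tip_part (x - z) + reent_part (x - z) \<le> 1/2"
  proof (rule inner)
    have "P \<le> 1 * p" unfolding P_def using pq sqrt3_bounds by (intro mult_right_mono) auto
    then show "2 * P + q \<le> 1" using that pq unfolding p_def[symmetric] q_def[symmetric] by simp
  qed
  have outer: "x \<in> convex hull {reent z i, tip z k, reent z j}" if h: "\<not> 2 * P + q \<le> 1"
  proof -
    have "x = (1 - P - q) *\<^sub>R reent z i + (2 * P + q - 1) *\<^sub>R tip z k + (1 - P) *\<^sub>R reent z j"
      unfolding x0 reent_def tk by (simp add: vec_eq_iff algebra_simps)
    also have "\<dots> \<in> convex hull {reent z i, tip z k, reent z j}"
      by (rule hull_combination[OF convex_convex_hull]) (use h P pq in \<open>auto intro: hull_inc\<close>)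
    finally show ?thesis .
  qed
  show "x \<in> base_triangle z \<union> (\<Union>s\<in>base_sides z. attached_triangle s)"
  \<comment> \<open>The tips 0, 4 and 8 are vertices of the base triangle; the other three are
    apexes of attached triangles.\<close>
  proof (cases "k \<in> {0, 4, 8}")
    case True
    then have "tip z k \<in> base_triangle z" by (auto intro: hull_inc)
    moreover have "x = P *\<^sub>R tip z k + q *\<^sub>R reent z j + (1 - (P + q)) *\<^sub>R z"
      unfolding x0 reent_def tk by (simp add: vec_eq_iff algebra_simps)
    moreover have "P *\<^sub>R tip z k + q *\<^sub>R reent z j + (1 - (P + q)) *\<^sub>R z \<in> base_triangle z"
      by (rule hull_combination[OF convex_convex_hull]) (use calculation base_triangle_points cc P pq in auto)
    ultimately show ?thesis by simp
  next
    case False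
    have "convex hull {reent z i, tip z k, reent z j} \<in> attached_triangle ` base_sides z"
      using c' False unfolding i_def hex_cones_def base_sides_def
      by (auto simp: base_attached insert_commute)
    then show ?thesis using inner outer by blast
  qed
qed

lemma base_triangle_interior: "interior (base_triangle z) \<noteq> {}"
proof -
  define S where "S = {x. tip_part (x - z) + reent_part (x - z) < 1/2}"
  have "open S" unfolding S_def by (intro open_Collect_less continuous_intros)
  moreover have "S \<subseteq> base_triangle z"
  proof
    fix x assume x: "x \<in> S"
    then have "tip_part (x - z) < 1/2" "reent_part (x - z) < 1/2"
      using parts_nonneg[of "x - z"] unfolding S_def by auto
    moreover from this have "sqrt 3 * (1/2) \<le> sqrt 3 * (1 - reent_part (x - z))" by (intro mult_left_mono) auto
    ultimately have "tip_part (x - z) < sqrt 3 * (1 - reent_part (x - z))" using sqrt3_bounds by linarith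
    then show "x \<in> base_triangle z" using hexagram_cover(2)[of x z] x unfolding S_def by simp
  qed
  moreover have "z \<in> S" unfolding S_def using parts_scale[of 0 0] by simp
  ultimately show ?thesis using interior_maximal by blast
qed

text \<open>The construction starts from the interior of the triangle. Its closure gives back the
  whole triangle, since a convex set with interior points lies in the closure of its
  interior.\<close>

lemma cheeger_set_subset_star:
  "cheeger_set z \<subseteq> interior (closure (interior (base_triangle z)) \<union> (\<Union>s\<in>base_sides z. attached_triangle s))"
proof (rule interior_maximal[OF _ open_cheeger_set])
  have "base_triangle z \<subseteq> closure (interior (base_triangle z))"
    using convex_closure_interior[OF convex_convex_hull base_triangle_interior] closure_subset by blast
  then show "cheeger_set z \<subseteq> closure (interior (base_triangle z)) \<union> (\<Union>s\<in>base_sides z. attached_triangle s)"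
    using hexagram_cover(1) cheeger_set_hexagram by blast
qed

lemma koch_cheeger:
  fixes a b c z :: "real^2"
  assumes sides: "triangle_sides a b c = base_sides z" and abc: "{a, b, c} = {tip z 0, tip z 4, tip z 8}"
  shows "cheeger_constant (koch_region_after a b c 1) = ereal h0"
    "cheeger_constant (koch_region_after a b c 2) = ereal h0"
    "cheeger_constant (koch_region_after a b c 3) = ereal h0"
proof -
  \<comment> \<open>Each region is open, hence contained in the interior of its closure.\<close>
  have mono: "koch_region_after a b c m \<subseteq> koch_region_after a b c (Suc m)" for m
  proof -
    have "open (koch_region_after a b c m)" by (cases m) auto
    then show ?thesis using closure_subset by (simp only: koch_region_after.simps) (intro interior_maximal; blast)
  qed
  have 1: "cheeger_set z \<subseteq> koch_region_after a b c 1"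
    using cheeger_set_subset_star[of z] by (simp add: sides abc)
  have 2: "cheeger_set z \<subseteq> koch_region_after a b c 2"
    using order_trans[OF 1 mono[of 1]] by (simp add: numeral_2_eq_2 del: koch_region_after.simps)
  have 3: "cheeger_set z \<subseteq> koch_region_after a b c 3"
    using order_trans[OF 2 mono[of 2]] by (simp add: numeral_3_eq_3 numeral_2_eq_2 del: koch_region_after.simps)
  note H = koch_region_hull_dom[OF sides abc]
  show "cheeger_constant (koch_region_after a b c 1) = ereal h0"
    "cheeger_constant (koch_region_after a b c 2) = ereal h0"
    "cheeger_constant (koch_region_after a b c 3) = ereal h0"
    using cheeger_constant_between[OF 1 H(1)] cheeger_constant_between[OF 2 H(2)] cheeger_constant_between[OF 3 H(3)] by auto
qed

end

section \<open>Fitting the frame to an arbitrary equilateral triangle\<close>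

lemma koch_cheeger_counterclockwise:
  fixes a b c :: "real^2"
  assumes d: "dist a b = 3" "dist b c = 3" "dist c a = 3" and ccw: "counterclockwise a b c"
  shows "cheeger_constant (koch_region_after a b c 1) = ereal h0"
    "cheeger_constant (koch_region_after a b c 2) = ereal h0"
    "cheeger_constant (koch_region_after a b c 3) = ereal h0"
proof -
  define e1 e2 f1 f2 where ef: "e1 = (b - a) $ 1" "e2 = (b - a) $ 2" "f1 = (c - a) $ 1" "f2 = (c - a) $ 2"
  have sq: "(norm v)\<^sup>2 = (v $ 1)\<^sup>2 + (v $ 2)\<^sup>2" for v :: "real^2"
    unfolding power2_norm_eq_inner by (simp add: inner_vec_def sum_2 power2_eq_square)
  have "norm (b - a) = 3" "norm (c - a) = 3" "norm (b - a - (c - a)) = 3"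
    using d by (simp_all add: dist_norm norm_minus_commute)
  then have E: "e1\<^sup>2 + e2\<^sup>2 = 9" "f1\<^sup>2 + f2\<^sup>2 = 9" "(e1 - f1)\<^sup>2 + (e2 - f2)\<^sup>2 = 9"
    using sq[of "b - a"] sq[of "c - a"] sq[of "b - a - (c - a)"] unfolding ef by auto
  then have dot: "e1 * f1 + e2 * f2 = 9/2" by (simp add: power2_eq_square algebra_simps)
  have cr: "e1 * f2 - e2 * f1 = 9 * sqrt 3 / 2"
  proof -
    have pos: "0 < e1 * f2 - e2 * f1" using ccw unfolding counterclockwise_def ef by simp
    have "(e1 * f2 - e2 * f1)\<^sup>2 + (e1 * f1 + e2 * f2)\<^sup>2 = (e1\<^sup>2 + e2\<^sup>2) * (f1\<^sup>2 + f2\<^sup>2)"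
      by (simp add: power2_eq_square algebra_simps)
    then have "(e1 * f2 - e2 * f1)\<^sup>2 = (9 * sqrt 3 / 2)\<^sup>2"
      unfolding E dot by (simp add: power2_eq_square)
    then show ?thesis using pos by (simp add: power2_eq_iff_nonneg)
  qed
  \<comment> \<open>Inner and cross product determine \<open>f\<close>: it is \<open>e\<close>
    turned by 60 degrees counterclockwise.\<close>
  have "9 * f1 = e1 * (e1 * f1 + e2 * f2) - e2 * (e1 * f2 - e2 * f1)"
    unfolding E(1)[symmetric] by (simp add: power2_eq_square algebra_simps)
  then have f1: "f1 = e1 / 2 - sqrt 3 / 2 * e2" unfolding dot cr by (simp add: field_simps)
  have "9 * f2 = e2 * (e1 * f1 + e2 * f2) + e1 * (e1 * f2 - e2 * f1)"
    unfolding E(1)[symmetric] by (simp add: power2_eq_square algebra_simps)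
  then have f2: "f2 = e2 / 2 + sqrt 3 / 2 * e1" unfolding dot cr by (simp add: field_simps)
  have b: "b $ 1 = a $ 1 + e1" "b $ 2 = a $ 2 + e2" and c: "c $ 1 = a $ 1 + f1" "c $ 2 = a $ 2 + f2"
    unfolding ef by simp_all
  define z where "z = (1/3) *\<^sub>R (a + b + c)"
  \<comment> \<open>The unit vector from the centroid to \<open>a\<close>.\<close>
  define u :: "real^2" where "u = vector [- (sqrt 3 / 6) * e1 + e2 / 6, - (sqrt 3 / 6) * e2 - e1 / 6]"
  define w where "w = - rotate_right u"
  have uc: "u $ 1 = - (sqrt 3 / 6) * e1 + e2 / 6" "u $ 2 = - (sqrt 3 / 6) * e2 - e1 / 6" unfolding u_def by simp_all
  have wc: "w $ 1 = - u $ 2" "w $ 2 = u $ 1" unfolding w_def rotate_right_def by simp_all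
  have un: "(u $ 1)\<^sup>2 + (u $ 2)\<^sup>2 = 1"
  proof -
    have "(u $ 1)\<^sup>2 + (u $ 2)\<^sup>2 = (e1\<^sup>2 + e2\<^sup>2) / 9"
      unfolding uc by (simp add: power2_eq_square field_simps sqrt3_mult)
    then show ?thesis using E by simp
  qed
  interpret hex_plane u w
  proof
    show "u \<bullet> u = 1" "w \<bullet> w = 1" "u \<bullet> w = 0"
      using un by (simp_all add: inner_vec_def sum_2 wc power2_eq_square)
    show "rotate_right u = - w" unfolding w_def by simp
    show "rotate_right w = u" by (simp add: rotate_right_def wc vec_eq_iff forall_2)
    fix x :: "real^2"
    have n: "u $ 1 * u $ 1 + u $ 2 * u $ 2 = 1" using un by (simp add: power2_eq_square)
    have "x $ 1 = x $ 1 * (u $ 1 * u $ 1 + u $ 2 * u $ 2)" "x $ 2 = x $ 2 * (u $ 1 * u $ 1 + u $ 2 * u $ 2)"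
      unfolding n by simp_all
    then show "x = (x \<bullet> u) *\<^sub>R u + (x \<bullet> w) *\<^sub>R w"
      by (simp add: vec_eq_iff forall_2 inner_vec_def sum_2 wc algebra_simps)
  qed
  have zc: "z $ 1 = a $ 1 + (e1 + f1) / 3" "z $ 2 = a $ 2 + (e2 + f2) / 3"
    unfolding z_def by (simp_all add: b c)
  have a': "tip z 0 = a" and b': "tip z 4 = b" and c': "tip z 8 = c"
    unfolding tip_def dir_def
    by (simp_all add: vec_eq_iff forall_2 zc wc uc b c f1 f2 field_simps sqrt3_mult)
  have sides: "triangle_sides a b c = base_sides z"
    using ccw unfolding triangle_sides_def base_sides_def a' b' c' by simp
  have abc: "{a, b, c} = {tip z 0, tip z 4, tip z 8}" unfolding a' b' c' ..
  show "cheeger_constant (koch_region_after a b c 1) = ereal h0"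
    "cheeger_constant (koch_region_after a b c 2) = ereal h0"
    "cheeger_constant (koch_region_after a b c 3) = ereal h0"
    using koch_cheeger[OF sides abc] by auto
qed

lemma koch_region_swap:
  assumes "triangle_sides a b c = triangle_sides a c b"
  shows "koch_region_after a b c m = koch_region_after a c b m"
proof -
  have s: "koch_sides_after a b c m = koch_sides_after a c b m" for m
    by (induction m) (use assms in auto)
  show ?thesis by (induction m) (simp_all add: s insert_commute)
qed

text \<open>A clockwise triple describes the same regions as the triple with \<open>b\<close> and
  \<open>c\<close> exchanged, which is counterclockwise.\<close>

lemma koch_cheeger_equilateral:
  fixes a b c :: "real^2"
  assumes d: "dist a b = 3" "dist b c = 3" "dist c a = 3"
  shows "cheeger_constant (koch_region_after a b c 1) = ereal h0"
    "cheeger_constant (koch_region_after a b c 2) = ereal h0"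
    "cheeger_constant (koch_region_after a b c 3) = ereal h0"
proof -
  have "cheeger_constant (koch_region_after a b c 1) = ereal h0
    \<and> cheeger_constant (koch_region_after a b c 2) = ereal h0
    \<and> cheeger_constant (koch_region_after a b c 3) = ereal h0"
  proof (cases "counterclockwise a b c")
    case True
    then show ?thesis using koch_cheeger_counterclockwise[OF d] by blast
  next
    case False
    \<comment> \<open>If neither order were counterclockwise, the cross product would be 0; but its
      square is 81 minus the square of the inner product 9/2.\<close>
    have ccw: "counterclockwise a c b"
    proof (rule ccontr)
      assume n: "\<not> counterclockwise a c b"
      define e1 e2 f1 f2 where ef: "e1 = (b - a) $ 1" "e2 = (b - a) $ 2" "f1 = (c - a) $ 1" "f2 = (c - a) $ 2"
      have sq: "(norm v)\<^sup>2 = (v $ 1)\<^sup>2 + (v $ 2)\<^sup>2" for v :: "real^2"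
        unfolding power2_norm_eq_inner by (simp add: inner_vec_def sum_2 power2_eq_square)
      have "norm (b - a) = 3" "norm (c - a) = 3" "norm (b - a - (c - a)) = 3"
        using d by (simp_all add: dist_norm norm_minus_commute)
      then have E: "e1\<^sup>2 + e2\<^sup>2 = 9" "f1\<^sup>2 + f2\<^sup>2 = 9" "(e1 - f1)\<^sup>2 + (e2 - f2)\<^sup>2 = 9"
        using sq[of "b - a"] sq[of "c - a"] sq[of "b - a - (c - a)"] unfolding ef by auto
      have dot: "e1 * f1 + e2 * f2 = 9/2" using E by (simp add: power2_eq_square algebra_simps)
      have "e1 * f2 - e2 * f1 = 0"
        using False n unfolding counterclockwise_def ef by (simp add: algebra_simps)
      moreover have "(e1 * f2 - e2 * f1)\<^sup>2 + (e1 * f1 + e2 * f2)\<^sup>2 = (e1\<^sup>2 + e2\<^sup>2) * (f1\<^sup>2 + f2\<^sup>2)"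
        by (simp add: power2_eq_square algebra_simps)
      ultimately show False unfolding E dot by (simp add: power2_eq_square)
    qed
    have d': "dist a c = 3" "dist c b = 3" "dist b a = 3" using d by (simp_all add: dist_commute)
    have "triangle_sides a b c = triangle_sides a c b"
      using False ccw unfolding triangle_sides_def by simp
    then show ?thesis using koch_cheeger_counterclockwise[OF d' ccw] koch_region_swap by metis
  qed
  then show "cheeger_constant (koch_region_after a b c 1) = ereal h0"
    "cheeger_constant (koch_region_after a b c 2) = ereal h0"
    "cheeger_constant (koch_region_after a b c 3) = ereal h0" by blast+
qed

theorem mainTheorem6:
  fixes a b c :: "real^2"
  assumes "dist a b = 3" and "dist b c = 3" and "dist c a = 3"
  shows "cheeger_constant (koch_region a b c 2) = cheeger_constant (koch_region a b c 3)
    \<and> cheeger_constant (koch_region a b c 3) = cheeger_constant (koch_region a b c 4)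
    \<and> cheeger_constant (koch_region a b c 4)
        = ereal ((6 * sqrt 3 - 2 * pi) / (6 - sqrt (6 * pi * sqrt 3 - 18)))"
    \<comment> \<open>The numbering starts from 1, so K_2, K_3 and K_4 are the regions after 1, 2
      and 3 rounds.\<close>
    using koch_cheeger_equilateral[OF assms] unfolding koch_region_def cheeger_curv_def by simp


end
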